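(* Suppose Conditions A, B and C (stated in the context) hold, and assume that $$\Big(\frac{\sigma_\varepsilon}{\xi}\Big)\Big(\frac{s\log(p\vee T)}{\sqrt{Tl_T}}\Big)=o(1).$$ Additionally assume that the jump size $\xi\to0$, and that $(\eta^{0T}\Sigma_\varepsilon\eta^0)/\xi^2\to\sigma^2$. Then the projected least squares estimate $\tilde\tau$ obeys the following limiting distribution: $$T\xi^2\sigma^{-2}(\tilde\tau-\tau^0)\Rightarrow\arg\min_{r\in\mathbb{R}}\big(|r|-2W(r)\big),$$ where $W(\cdot)$ is a two-sided Brownian motion on $\mathbb{R}$ and $\Rightarrow$ denotes convergence in distribution.
   Context: Model. For $t=1,\dots,T$ one observes $y_t\in\mathbb{R}^p$ with $y_t=\mu_1^0+\varepsilon_t$ for $1\le t\le\lfloor T\tau^0\rfloor$ and $y_t=\mu_2^0+\varepsilon_t$ for $\lfloor T\tau^0\rfloor+1\le t\le T$. The means $\mu_1^0,\mu_2^0\in\mathbb{R}^p$ and the change point $\tau^0$ are unknown. All limits are as $T\to\infty$; $p$ and the other model parameters may depend on $T$, with $\log p=o(T^{\delta})$ for some $0<\delta<1/2$. Put $\eta^0=\mu_1^0-\mu_2^0$ and $\xi=\|\eta^0\|_2$ (jump size). Notation: $a\vee b=\max\{a,b\}$, $a\wedge b=\min\{a,b\}$; $\delta_U$ is the subvector of $\delta$ with indices in $U$; $\lfloor\cdot\rfloor$ is the greatest integer function. The symbol $c_u>0$ denotes generic universal constants, not depending on $T$ or any model parameter, possibly different from one term to the next. A random variable $X$ is $\alpha$-subgaussian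 if $E\exp(tX)\le\exp(\alpha^2t^2/2)$ for all $t\in\mathbb{R}$; a random vector $\zeta\in\mathbb{R}^p$ is $\alpha$-subgaussian (variance proxy $\alpha^2$) if $\langle\zeta,v\rangle$ is $\alpha$-subgaussian for every $v$ with $\|v\|_2=1$. Condition A. (i) With $S_1=\{j:\mu^0_{1j}\neq0\}$, $S_2=\{j:\mu^0_{2j}\neq0\}$, $S=S_1\cup S_2$, one has $|S|\le s$ for some $s=s_T\ge1$. (ii) $s\log p/\sqrt T\to0$. (iii) A change point exists and for some positive sequence $l_T$ (with $0<l_T<1/2$), $\tau^0\wedge(1-\tau^0)\ge l_T$; moreover $\frac{\sigma_\varepsilon}{\xi}\Big\{\frac{s\log(p\vee T)}{\sqrt{Tl_T}}\Big\}\le c_u$ for an appropriately chosen small enough constant $c_u>0$. Condition B. The vectors $\varepsilon_1,\dots,\varepsilon_T$ are i.i.d. mean zero subgaussian with variance proxy $\sigma_\varepsilon^2\le c_u$, and $\Sigma_\varepsilon=E\varepsilon_t\varepsilon_t^T$ satisfies $0<\kappa\le\lambda_{\min}(\Sigma_\varepsilon)<\lambda_{\max}(\Sigma_\varepsilon)\le\phi<\infty$. Condition C. There is a fixed sequence $\Delta_T\to0$ such that, with probability $1-\Delta_T$, the estimators $\hat\mu_1,\hat\mu_2$ satisfy $\|\hat\mu_i-\mu_i^0\|_2\le c_u\sigma_\varepsilon\big(\frac{s\log(p\vee T)}{Tl_T}\big)^{1/2}$ for $i=1,2$, and $\hat\mu_1-\mu_1^0,\ \hat\mu_2-\mu_2^0\in\mathcal{A}$,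 where $\mathcal{A}=\{\delta\in\mathbb{R}^p:\|\delta_{S^c}\|_1\le c_u\|\delta_S\|_1\}$. Estimator. For $z\in\mathbb{R}^T$, $\theta_1,\theta_2\in\mathbb{R}$, $\tau\in(0,1)$ let $Q(z,\tau,\theta_1,\theta_2)=\frac1T\sum_{t=1}^{\lfloor T\tau\rfloor}(z_t-\theta_1)^2+\frac1T\sum_{t=\lfloor T\tau\rfloor+1}^{T}(z_t-\theta_2)^2$. Let $\hat\eta=\hat\mu_1-\hat\mu_2$, $\hat\theta_1=\hat\eta^T\hat\mu_1$, $\hat\theta_2=\hat\eta^T\hat\mu_2$, $\hat z_t=\hat\eta^Ty_t$, $\hat z=(\hat z_1,\dots,\hat z_T)^T$. The projected least squares estimate is $\tilde\tau=\arg\min_{\tau\in(0,1)}Q(\hat z,\tau,\hat\theta_1,\hat\theta_2)$, equivalently (the criterion being a step function of $\tau$) the minimizer over $\tau\in\{1/T,2/T,\dots,(T-1)/T\}$. Two-sided Brownian motion: $W(0)=0$, $W(r)=W_1(r)$ for $r>0$, $W(r)=W_2(-r)$ for $r<0$, where $W_1,W_2$ are independent Brownian motions on $[0,\infty)$. *)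

theory Defs
  imports
    "HOL-Probability.Probability"
    "HOL-Library.Landau_Symbols"
    "Jordan_Normal_Form.Char_Poly"
begin

text \<open>
  The dimension varies with the sample size, so \<open>\<real>\<^sup>p\<close> is rendered as functions
  \<open>nat \<Rightarrow> real\<close> of which only the coordinates \<open>j < p\<close> matter. Random vectors take
  values in the product space \<open>rvec p\<close>, whose points are extensional functions.
\<close>

abbreviation rvec :: "nat \<Rightarrow> (nat \<Rightarrow> real) measure" where
  "rvec p \<equiv> Pi\<^sub>M {..<p} (\<lambda>_. borel)"

definition dot :: "nat \<Rightarrow> (nat \<Rightarrow> real) \<Rightarrow> (nat \<Rightarrow> real) \<Rightarrow> real" where
  "dot p u v = (\<Sum>j<p. u j * v j)"

definition norm2 :: "nat \<Rightarrow> (nat \<Rightarrow> real) \<Rightarrow> real" where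
  "norm2 p v = L2_set v {..<p}"

definition support :: "nat \<Rightarrow> (nat \<Rightarrow> real) \<Rightarrow> nat set" where
  "support p v = {j. j < p \<and> v j \<noteq> 0}"

definition sparse_cone :: "nat \<Rightarrow> nat set \<Rightarrow> real \<Rightarrow> (nat \<Rightarrow> real) set" where
  "sparse_cone p S c = {d. (\<Sum>j\<in>{..<p} - S. \<bar>d j\<bar>) \<le> c * (\<Sum>j\<in>S. \<bar>d j\<bar>)}"

text \<open>
  Integrability is required explicitly because the Bochner integral of a
  non-integrable function is \<open>0\<close>, which would satisfy the bound.
\<close>

definition subgaussian :: "'a measure \<Rightarrow> real \<Rightarrow> ('a \<Rightarrow> real) \<Rightarrow> bool" where
  "subgaussian M \<alpha> X \<longleftrightarrow>
     (\<forall>u. integrable M (\<lambda>\<omega>. exp (u * X \<omega>)) \<and>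
          (\<integral>\<omega>. exp (u * X \<omega>) \<partial>M) \<le> exp (\<alpha>\<^sup>2 * u\<^sup>2 / 2))"

definition subgaussian_vec :: "'a measure \<Rightarrow> nat \<Rightarrow> real \<Rightarrow> ('a \<Rightarrow> nat \<Rightarrow> real) \<Rightarrow> bool" where
  "subgaussian_vec M p \<alpha> Z \<longleftrightarrow>
     (\<forall>v. norm2 p v = 1 \<longrightarrow> subgaussian M \<alpha> (\<lambda>\<omega>. dot p (Z \<omega>) v))"

definition second_moment_mat :: "'a measure \<Rightarrow> nat \<Rightarrow> ('a \<Rightarrow> nat \<Rightarrow> real) \<Rightarrow> real mat" where
  "second_moment_mat M p Z = Matrix.mat p p (\<lambda>(i, j). \<integral>\<omega>. Z \<omega> i * Z \<omega> j \<partial>M)"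

definition quad_form :: "nat \<Rightarrow> real mat \<Rightarrow> (nat \<Rightarrow> real) \<Rightarrow> real" where
  "quad_form p A v = Matrix.vec p v \<bullet> (A *\<^sub>v Matrix.vec p v)"

definition lambda_min :: "real mat \<Rightarrow> real" where
  "lambda_min A = Min {k. eigenvalue A k}"

definition lambda_max :: "real mat \<Rightarrow> real" where
  "lambda_max A = Max {k. eigenvalue A k}"

definition Q :: "nat \<Rightarrow> (nat \<Rightarrow> real) \<Rightarrow> real \<Rightarrow> real \<Rightarrow> real \<Rightarrow> real" where
  "Q T z \<tau> \<theta>1 \<theta>2 =
     (1 / real T) * (\<Sum>t\<in>{1..nat \<lfloor>real T * \<tau>\<rfloor>}. (z t - \<theta>1)\<^sup>2) +
     (1 / real T) * (\<Sum>t\<in>{nat \<lfloor>real T * \<tau>\<rfloor> + 1..T}. (z t - \<theta>2)\<^sup>2)"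

definition projected_criterion ::
    "nat \<Rightarrow> nat \<Rightarrow> (nat \<Rightarrow> nat \<Rightarrow> real) \<Rightarrow> (nat \<Rightarrow> real) \<Rightarrow> (nat \<Rightarrow> real) \<Rightarrow> real \<Rightarrow> real" where
  "projected_criterion T p y m1 m2 \<tau> =
     (let h = (\<lambda>j. m1 j - m2 j) in Q T (\<lambda>t. dot p h (y t)) \<tau> (dot p h m1) (dot p h m2))"

text \<open>
  The criterion is constant on each \<open>[k/T, (k+1)/T)\<close>, so its minimizer over \<open>(0,1)\<close> is
  never unique, and minimizing over \<open>(0,1)\<close> also admits \<open>k = 0\<close>, which the grid
  \<open>{1/T, \<dots>, (T-1)/T}\<close> does not contain. Any minimizer over either domain counts as a
  projected least squares estimate.
\<close>

definition projected_lse ::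
    "nat \<Rightarrow> nat \<Rightarrow> (nat \<Rightarrow> nat \<Rightarrow> real) \<Rightarrow> (nat \<Rightarrow> real) \<Rightarrow> (nat \<Rightarrow> real) \<Rightarrow> real \<Rightarrow> bool" where
  "projected_lse T p y m1 m2 \<tau> \<longleftrightarrow>
     is_arg_min (projected_criterion T p y m1 m2) (\<lambda>u. u \<in> {0<..<1}) \<tau> \<or>
     is_arg_min (projected_criterion T p y m1 m2)
       (\<lambda>u. u \<in> (\<lambda>k. real k / real T) ` {1..T - 1}) \<tau>"

text \<open>Brownian motion on \<open>[0,\<infinity>)\<close>; the values at negative times are irrelevant.\<close>

definition brownian_motion :: "'b measure \<Rightarrow> (real \<Rightarrow> 'b \<Rightarrow> real) \<Rightarrow> bool" where
  "brownian_motion N B \<longleftrightarrow>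
     prob_space N \<and>
     (\<forall>t\<ge>0. B t \<in> borel_measurable N) \<and>
     (AE \<omega> in N. B 0 \<omega> = 0) \<and>
     (\<forall>n (ts :: nat \<Rightarrow> real). 0 \<le> ts 0 \<and> (\<forall>i<n. ts i < ts (Suc i)) \<longrightarrow>
        prob_space.indep_vars N (\<lambda>_. borel) (\<lambda>i \<omega>. B (ts (Suc i)) \<omega> - B (ts i) \<omega>) {..<n}) \<and>
     (\<forall>u v. 0 \<le> u \<and> u < v \<longrightarrow>
        distributed N lborel (\<lambda>\<omega>. B v \<omega> - B u \<omega>) (normal_density 0 (sqrt (v - u)))) \<and>
     (AE \<omega> in N. continuous_on {0..} (\<lambda>t. B t \<omega>))"

definition two_sided_brownian_motion :: "'b measure \<Rightarrow> (real \<Rightarrow> 'b \<Rightarrow> real) \<Rightarrow> bool" where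
  "two_sided_brownian_motion N W \<longleftrightarrow>
     (\<exists>W1 W2. brownian_motion N W1 \<and> brownian_motion N W2 \<and>
        prob_space.indep_var N
          (Pi\<^sub>M {0..} (\<lambda>_. borel)) (\<lambda>\<omega>. restrict (\<lambda>t. W1 t \<omega>) {0..})
          (Pi\<^sub>M {0..} (\<lambda>_. borel)) (\<lambda>\<omega>. restrict (\<lambda>t. W2 t \<omega>) {0..}) \<and>
        (\<forall>\<omega>\<in>space N. \<forall>r. W r \<omega> =
           (if r > 0 then W1 r \<omega> else if r < 0 then W2 (- r) \<omega> else 0)))"

text \<open>The random variable \<open>X\<close> is the almost surely unique minimizer of the process \<open>Z\<close>.\<close>

definition argmin_rv :: "'b measure \<Rightarrow> (real \<Rightarrow> 'b \<Rightarrow> real) \<Rightarrow> ('b \<Rightarrow> real) \<Rightarrow> bool" where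
  "argmin_rv N Z X \<longleftrightarrow>
     X \<in> borel_measurable N \<and>
     (AE \<omega> in N. \<forall>r. is_arg_min (\<lambda>u. Z u \<omega>) (\<lambda>_. True) r \<longleftrightarrow> r = X \<omega>)"

end

theory Submission
  imports Defs "HOL-Real_Asymp.Real_Asymp"
begin

text \<open>
  Let \<open>\<eta>'\<close> be the estimated jump. Divided by \<open>|\<eta>'|\<^sup>2\<close>, the increment of the projected criterion from the change
  point to the time at distance \<open>j\<close> from it is \<open>|j| \<xi>\<^sup>2 - 2 U(j)\<close>, where \<open>U\<close> is a two-sided random walk with increments
  \<open>\<eta>\<^sup>T \<epsilon>\<^sub>t\<close>, up to errors that are uniformly negligible on an event of probability tending to one. The plug-in error
  in the noise is controlled by the duality of the \<open>l1\<close> norm, small by sparsity, and the \<open>l\<infinity>\<close> norm of the partial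
  sums of \<open>\<epsilon>\<^sub>t\<close>, bounded by a union bound.

  In the scale \<open>r = j \<xi>\<^sup>2 / \<sigma>\<^sup>2\<close> the argmin is tight by a maximal inequality over dyadic blocks. The walk
  oscillates little between the points of a dyadic grid, and the vector of its increments over the grid
  converges to independent Gaussian increments. Hence an almost minimal grid point near a closed set \<open>F\<close> is asymptotically
  at most as likely as for the Brownian limit. Refining the grid gives
  \<open>limsup P(argmin \<in> F) \<le> P(argmin of the limit \<in> F)\<close>, because the limit has almost surely a unique minimizer:
  a tie between the two sides of a dyadic interval would force an independent Gaussian increment to take a prescribed value.
\<close>

section \<open>Subgaussian variables and maximal inequalities\<close>

text \<open>The estimates may be built from the same data as the criterion, so the noise projected
  on the estimated jump is not a random walk. The proof never conditions on them: it compares with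
  the walk projected on the true jump and bounds the difference pathwise, for all errors in the cone
  at once. Each sample has its own probability space, and only upper bounds for closed sets are
  transported to the limit. These involve inequalities at finitely many grid points rather than
  convergence in a path space, and independence reduces the joint law of the grid increments to its
  marginals. With a = \<xi>^2/\<sigma>^2 and noise divided by \<sigma>^2, a step has drift a and
  variance a v with v -> 1, so m steps take time a m in the limit. The plug-in error is linear in m
  through the drift and of order sqrt m through the noise, whence the weight a m + sqrt (a m). The
  lower bound \<kappa> on the covariance keeps the variance proxy away from zero; this turns the
  rate assumption into divergence of the rescaled sample length on each side of the change
  point.\<close>

lemma (in prob_space) indep_vars_block_sum:
  fixes X :: "'i \<Rightarrow> 'a \<Rightarrow> real"
  assumes ind: "indep_vars (\<lambda>_. borel) X I"
    and K: "\<And>j. j \<in> L \<Longrightarrow> K j \<subseteq> I" and dis: "disjoint_family_on K L"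
  shows "indep_vars (\<lambda>_. borel) (\<lambda>j \<omega>. \<Sum>i\<in>K j. X i \<omega>) L"
proof -
  have "indep_vars (\<lambda>_. borel) (\<lambda>j \<omega>. (\<lambda>f. \<Sum>i\<in>K j. f i) (restrict (\<lambda>i. X i \<omega>) (K j))) L"
    by (rule indep_vars_compose2[OF indep_vars_restrict[OF ind K dis]])
      (auto intro!: borel_measurable_sum measurable_component_singleton)
  then show ?thesis by simp
qed

text \<open>Singleton blocks \<open>{f j}\<close> are disjoint because \<open>f\<close> is
  injective. Used to renumber observations by side and distance from the change point, and to
  restart a walk at a grid point.\<close>

lemma (in prob_space) indep_vars_inj_reindex:
  fixes X :: "'i \<Rightarrow> 'a \<Rightarrow> real"
  assumes "indep_vars (\<lambda>_. borel) X I" "f ` L \<subseteq> I" "inj_on f L"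
  shows "indep_vars (\<lambda>_. borel) (\<lambda>j. X (f j)) L"
  using indep_vars_block_sum[OF assms(1), of L "\<lambda>j. {f j}"] assms(2,3)
  by (auto simp: disjoint_family_on_def inj_on_def)

lemma subgaussian_integrable_exp: "subgaussian M \<alpha> X \<Longrightarrow> integrable M (\<lambda>\<omega>. exp (u * X \<omega>))"
  and subgaussian_mgf_le: "subgaussian M \<alpha> X \<Longrightarrow> (\<integral>\<omega>. exp (u * X \<omega>) \<partial>M) \<le> exp (\<alpha>\<^sup>2 * u\<^sup>2 / 2)"
  by (auto simp: subgaussian_def)

lemma subgaussian_scale:
  assumes "subgaussian M \<alpha> X"
  shows "subgaussian M (\<bar>c\<bar> * \<alpha>) (\<lambda>\<omega>. c * X \<omega>)"
  unfolding subgaussian_def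
proof (intro allI conjI)
  fix u
  show "integrable M (\<lambda>\<omega>. exp (u * (c * X \<omega>)))"
    using subgaussian_integrable_exp[OF assms, of "u * c"] by (simp add: mult.assoc)
  show "(\<integral>\<omega>. exp (u * (c * X \<omega>)) \<partial>M) \<le> exp ((\<bar>c\<bar> * \<alpha>)\<^sup>2 * u\<^sup>2 / 2)"
    using subgaussian_mgf_le[OF assms, of "u * c"] by (simp add: mult.assoc power_mult_distrib mult_ac)
qed

text \<open>Moment generating functions of independent variables multiply, so the squared parameters
  add up.\<close>

lemma (in prob_space) subgaussian_sum:
  fixes X :: "'i \<Rightarrow> 'a \<Rightarrow> real"
  assumes fin: "finite A" and ind: "indep_vars (\<lambda>_. borel) X A"
    and sg: "\<And>i. i \<in> A \<Longrightarrow> subgaussian M \<alpha> (X i)"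
  shows "subgaussian M (sqrt (real (card A)) * \<alpha>) (\<lambda>\<omega>. \<Sum>i\<in>A. X i \<omega>)"
  unfolding subgaussian_def
proof (intro allI conjI)
  fix u
  have ind': "indep_vars (\<lambda>_. borel) (\<lambda>i \<omega>. exp (u * X i \<omega>)) A"
    by (rule indep_vars_compose2[OF ind]) auto
  have int: "\<And>i. i \<in> A \<Longrightarrow> integrable M (\<lambda>\<omega>. exp (u * X i \<omega>))"
    using sg subgaussian_integrable_exp by blast
  have eq: "(\<lambda>\<omega>. exp (u * (\<Sum>i\<in>A. X i \<omega>))) = (\<lambda>\<omega>. \<Prod>i\<in>A. exp (u * X i \<omega>))"
    using fin by (simp add: sum_distrib_left exp_sum)
  show "integrable M (\<lambda>\<omega>. exp (u * (\<Sum>i\<in>A. X i \<omega>)))"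
    unfolding eq by (rule indep_vars_integrable[OF fin ind' int])
  have "(\<integral>\<omega>. exp (u * (\<Sum>i\<in>A. X i \<omega>)) \<partial>M) = (\<Prod>i\<in>A. \<integral>\<omega>. exp (u * X i \<omega>) \<partial>M)"
    unfolding eq by (rule indep_vars_lebesgue_integral[OF fin ind' int])
  also have "\<dots> \<le> (\<Prod>i\<in>A. exp (\<alpha>\<^sup>2 * u\<^sup>2 / 2))"
    by (intro prod_mono conjI subgaussian_mgf_le sg) auto
  also have "\<dots> = exp ((sqrt (real (card A)) * \<alpha>)\<^sup>2 * u\<^sup>2 / 2)"
    by (simp add: exp_of_nat_mult[symmetric] power_mult_distrib)
  finally show "(\<integral>\<omega>. exp (u * (\<Sum>i\<in>A. X i \<omega>)) \<partial>M) \<le> exp ((sqrt (real (card A)) * \<alpha>)\<^sup>2 * u\<^sup>2 / 2)" .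
qed

lemma (in prob_space) subgaussian_tail_upper:
  fixes X :: "'a \<Rightarrow> real"
  assumes X[measurable]: "random_variable borel X" and sg: "subgaussian M \<alpha> X" and "\<alpha> > 0" "x > 0"
  shows "prob {\<omega>\<in>space M. x \<le> X \<omega>} \<le> exp (- (x\<^sup>2 / (2 * \<alpha>\<^sup>2)))"
proof -
  \<comment> \<open>This \<open>u\<close> minimizes the Chernoff exponent
    \<open>\<alpha>\<^sup>2 * u\<^sup>2 / 2 - u * x\<close>.\<close>
  define u where "u = x / \<alpha>\<^sup>2"
  have u: "u > 0" using assms by (simp add: u_def)
  have "{\<omega>\<in>space M. x \<le> X \<omega>} = {\<omega>\<in>space M. exp (u * x) \<le> exp (u * X \<omega>)}"
    using u by auto
  also have "prob \<dots> \<le> (\<integral>\<omega>. exp (u * X \<omega>) \<partial>M) / exp (u * x)"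
    by (rule integral_Markov_inequality_measure[where A = "space M"])
      (auto intro: subgaussian_integrable_exp[OF sg])
  also have "\<dots> \<le> exp (\<alpha>\<^sup>2 * u\<^sup>2 / 2) / exp (u * x)"
    by (intro divide_right_mono subgaussian_mgf_le[OF sg]) auto
  also have "\<dots> = exp (- (x\<^sup>2 / (2 * \<alpha>\<^sup>2)))"
    using assms by (simp add: exp_diff[symmetric] u_def field_simps power2_eq_square)
  finally show ?thesis .
qed

lemma (in prob_space) subgaussian_tail:
  fixes X :: "'a \<Rightarrow> real"
  assumes X[measurable]: "random_variable borel X" and sg: "subgaussian M \<alpha> X" and pos: "\<alpha> > 0" "x > 0"
  shows "prob {\<omega>\<in>space M. x \<le> \<bar>X \<omega>\<bar>} \<le> 2 * exp (- (x\<^sup>2 / (2 * \<alpha>\<^sup>2)))"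
proof -
  have "subgaussian M \<alpha> (\<lambda>\<omega>. - X \<omega>)"
    using subgaussian_scale[OF sg, of "-1"] by simp
  then have neg: "prob {\<omega>\<in>space M. x \<le> - X \<omega>} \<le> exp (- (x\<^sup>2 / (2 * \<alpha>\<^sup>2)))"
    by (intro subgaussian_tail_upper pos) auto
  have "{\<omega>\<in>space M. x \<le> \<bar>X \<omega>\<bar>} = {\<omega>\<in>space M. x \<le> X \<omega>} \<union> {\<omega>\<in>space M. x \<le> - X \<omega>}"
    by auto
  also have "prob \<dots> \<le> prob {\<omega>\<in>space M. x \<le> X \<omega>} + prob {\<omega>\<in>space M. x \<le> - X \<omega>}"
    by (rule measure_Un_le) auto
  also have "\<dots> \<le> 2 * exp (- (x\<^sup>2 / (2 * \<alpha>\<^sup>2)))"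
    using neg subgaussian_tail_upper[OF X sg pos] by simp
  finally show ?thesis .
qed

text \<open>One term of the exponential series is at most the whole sum. Exponential moments thus
  control all polynomial moments.\<close>

lemma power_le_fact_exp:
  fixes x :: real
  assumes "x \<ge> 0"
  shows "x ^ k \<le> fact k * exp x"
proof -
  have s: "summable (\<lambda>n. x ^ n /\<^sub>R fact n)" by (rule summable_exp_generic)
  have "sum (\<lambda>n. x ^ n /\<^sub>R fact n) {k} \<le> (\<Sum>n. x ^ n /\<^sub>R fact n)"
    using assms by (intro sum_le_suminf s) auto
  then have "x ^ k / fact k \<le> exp x" by (simp add: exp_def field_simps)
  then show ?thesis by (simp add: field_simps)
qed

lemma (in prob_space) subgaussian_moment:
  fixes X :: "'a \<Rightarrow> real"
  assumes X[measurable]: "random_variable borel X" and sg: "subgaussian M \<alpha> X" and pos: "\<alpha> > 0"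
  shows "integrable M (\<lambda>\<omega>. \<bar>X \<omega>\<bar> ^ k)"
    and "expectation (\<lambda>\<omega>. \<bar>X \<omega>\<bar> ^ k) \<le> 2 * exp (1 / 2) * fact k * \<alpha> ^ k"
proof -
  \<comment> \<open>\<open>exp (\<bar>X \<omega>\<bar> / \<alpha>)\<close> is at most the sum of the
    two one-sided exponentials, and at u = 1/\<alpha> the subgaussian bound on each of their means
    is \<open>exp (1 / 2)\<close>.\<close>
  let ?B = "\<lambda>\<omega>. fact k * \<alpha> ^ k * (exp (1 / \<alpha> * X \<omega>) + exp (- 1 / \<alpha> * X \<omega>))"
  have le: "\<bar>X \<omega>\<bar> ^ k \<le> ?B \<omega>" for \<omega>
  proof -
    have "\<bar>X \<omega>\<bar> ^ k = \<alpha> ^ k * (\<bar>X \<omega>\<bar> / \<alpha>) ^ k" using pos by (simp add: power_divide)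
    also have "\<dots> \<le> \<alpha> ^ k * (fact k * exp (\<bar>X \<omega>\<bar> / \<alpha>))"
      using pos by (intro mult_left_mono power_le_fact_exp) auto
    also have "exp (\<bar>X \<omega>\<bar> / \<alpha>) \<le> exp (1 / \<alpha> * X \<omega>) + exp (- 1 / \<alpha> * X \<omega>)"
      by (cases "X \<omega> \<ge> 0") (auto simp: add_increasing add_increasing2)
    finally show ?thesis using pos by (simp add: mult_ac)
  qed
  note e = subgaussian_integrable_exp[OF sg, of "1 / \<alpha>"] subgaussian_integrable_exp[OF sg, of "- 1 / \<alpha>"]
  have intB: "integrable M ?B"
    by (intro integrable_mult_right Bochner_Integration.integrable_add e)
  show int: "integrable M (\<lambda>\<omega>. \<bar>X \<omega>\<bar> ^ k)"
    by (rule Bochner_Integration.integrable_bound[OF intB]) (use le pos in \<open>auto intro!: AE_I2 simp: abs_mult\<close>)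
  have "expectation (\<lambda>\<omega>. \<bar>X \<omega>\<bar> ^ k) \<le> expectation ?B"
    by (rule integral_mono[OF int intB le])
  also have "\<dots> = fact k * \<alpha> ^ k * (expectation (\<lambda>\<omega>. exp (1 / \<alpha> * X \<omega>)) + expectation (\<lambda>\<omega>. exp (- 1 / \<alpha> * X \<omega>)))"
    by (simp only: integral_mult_right_zero Bochner_Integration.integral_add[OF e])
  also have "\<dots> \<le> fact k * \<alpha> ^ k * (exp (1/2) + exp (1/2))"
    using subgaussian_mgf_le[OF sg, of "1/\<alpha>"] subgaussian_mgf_le[OF sg, of "-1/\<alpha>"] pos
    by (intro mult_left_mono add_mono) (auto simp: power_divide)
  finally show "expectation (\<lambda>\<omega>. \<bar>X \<omega>\<bar> ^ k) \<le> 2 * exp (1 / 2) * fact k * \<alpha> ^ k"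
    by (simp add: mult_ac)
qed

text \<open>An Ottaviani-type argument. When the partial sums first reach 2x in absolute value at
  time k, either the final sum is still at least x in absolute value, or the sum of the increments
  after k is. The second event is independent of the first passage, and both have a tail of at most
  \<open>e\<close>, so the total is \<open>2 * e\<close>.\<close>

lemma (in prob_space) subgaussian_maximal:
  fixes X :: "nat \<Rightarrow> 'a \<Rightarrow> real"
  assumes ind: "indep_vars (\<lambda>_. borel) X {..<n}"
    and sg: "\<And>i. i < n \<Longrightarrow> subgaussian M \<alpha> (X i)" and pos: "\<alpha> > 0" "x > 0"
  shows "prob {\<omega>\<in>space M. \<exists>m\<le>n. 2 * x \<le> \<bar>\<Sum>i<m. X i \<omega>\<bar>} \<le> 4 * exp (- (x\<^sup>2 / (2 * real n * \<alpha>\<^sup>2)))"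
proof (cases "n = 0")
  case True
  \<comment> \<open>An empty sum cannot reach 2x > 0; the bound itself degenerates to 4 through
    division by zero.\<close>
  then have "{\<omega>\<in>space M. \<exists>m\<le>n. 2 * x \<le> \<bar>\<Sum>i<m. X i \<omega>\<bar>} = {}" using pos by auto
  then show ?thesis by (metis (no_types, lifting) exp_ge_zero measure_empty mult_nonneg_nonneg zero_le_numeral)
next
  case False
  define e where "e = 2 * exp (- (x\<^sup>2 / (2 * real n * \<alpha>\<^sup>2)))"
  have [measurable]: "random_variable borel (X i)" if "i < n" for i
    using ind that by (auto simp: indep_vars_def)
  define S where "S = (\<lambda>m \<omega>. \<Sum>i<m. X i \<omega>)"
  have S[measurable]: "random_variable borel (S m)" if "m \<le> n" for m
    using that unfolding S_def by (intro borel_measurable_sum) auto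
  define A where "A = (\<lambda>k. {\<omega>\<in>space M. (\<forall>m<k. \<bar>S m \<omega>\<bar> < 2 * x) \<and> 2 * x \<le> \<bar>S k \<omega>\<bar>})"
  define B where "B = (\<lambda>k. {\<omega>\<in>space M. x \<le> \<bar>\<Sum>i\<in>{k..<n}. X i \<omega>\<bar>})"
  have Bsum: "random_variable borel (\<lambda>\<omega>. \<Sum>i\<in>{k..<n}. X i \<omega>)" for k
    by (intro borel_measurable_sum) auto
  have A[measurable]: "A k \<in> events" if "k \<le> n" for k
  proof -
    have "A k = {\<omega>\<in>space M. (\<forall>m\<in>{..<k}. \<bar>S m \<omega>\<bar> < 2 * x) \<and> 2 * x \<le> \<bar>S k \<omega>\<bar>}"
      by (auto simp: A_def)
    also have "\<dots> \<in> events"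
      by (intro sets.sets_Collect_conj sets.sets_Collect_finite_All borel_measurable_less
        borel_measurable_le borel_measurable_abs S) (use that in auto)
    finally show ?thesis .
  qed
  have B[measurable]: "B k \<in> events" for k
    unfolding B_def using Bsum[of k] by measurable
  have bound: "prob (B k) \<le> e" if "k \<le> n" for k
  proof (cases "k = n")
    case True
    then have "B k = {}" using pos by (auto simp: B_def)
    then show ?thesis by (simp add: e_def)
  next
    case False
    then have k: "k < n" using that by simp
    have "subgaussian M (sqrt (real (card {k..<n})) * \<alpha>) (\<lambda>\<omega>. \<Sum>i\<in>{k..<n}. X i \<omega>)"
      by (rule subgaussian_sum[OF _ indep_vars_subset[OF ind]]) (auto intro: sg)
    from subgaussian_tail[OF Bsum this _ pos(2)] k pos
    have "prob (B k) \<le> 2 * exp (- (x\<^sup>2 / (2 * (real (n - k) * \<alpha>\<^sup>2))))"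
      by (simp add: B_def power_mult_distrib)
    \<comment> \<open>Shorter tails have smaller variance proxies, so the bound for the full length
      n serves every k.\<close>
    also have "\<dots> \<le> e"
      unfolding e_def using k pos
      by (auto intro!: divide_left_mono mult_right_mono simp: mult.assoc)
    finally show ?thesis .
  qed
  \<comment> \<open>\<open>A k\<close> is decided by the variables before k and \<open>B k\<close>
    by those from k on, so both are events of the independent restrictions to \<open>{..<k}\<close>
    and \<open>{k..<n}\<close>.\<close>
  have indAB: "prob (A k \<inter> B k) = prob (A k) * prob (B k)" if k: "k \<le> n" for k
  proof -
    let ?P = "\<lambda>I. PiM I (\<lambda>_. borel :: real measure)"
    define A' where "A' = {f \<in> space (?P {..<k}). (\<forall>m<k. \<bar>\<Sum>i<m. f i\<bar> < 2 * x) \<and> 2 * x \<le> \<bar>\<Sum>i<k. f i\<bar>}"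
    define B' where "B' = {f \<in> space (?P {k..<n}). x \<le> \<bar>\<Sum>i\<in>{k..<n}. f i\<bar>}"
    have ms: "(\<lambda>f. \<Sum>i<m. f i) \<in> borel_measurable (?P {..<k})" if "m \<le> k" for m
      using that by (auto intro!: borel_measurable_sum measurable_component_singleton)
    have "A' = {f \<in> space (?P {..<k}). (\<forall>m\<in>{..<k}. \<bar>\<Sum>i<m. f i\<bar> < 2 * x) \<and> 2 * x \<le> \<bar>\<Sum>i<k. f i\<bar>}"
      by (auto simp: A'_def)
    also have "\<dots> \<in> sets (?P {..<k})"
      by (intro sets.sets_Collect_conj sets.sets_Collect_finite_All borel_measurable_less
        borel_measurable_le borel_measurable_abs ms) auto
    finally have A': "A' \<in> sets (?P {..<k})" .
    have ms2: "(\<lambda>f. \<Sum>i\<in>{k..<n}. f i) \<in> borel_measurable (?P {k..<n})"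
      by (auto intro!: borel_measurable_sum measurable_component_singleton)
    have B': "B' \<in> sets (?P {k..<n})"
      unfolding B'_def using ms2 by measurable
    have iv: "indep_var (?P {..<k}) (\<lambda>\<omega>. restrict (\<lambda>i. X i \<omega>) {..<k}) (?P {k..<n}) (\<lambda>\<omega>. restrict (\<lambda>i. X i \<omega>) {k..<n})"
      by (rule indep_var_restrict[OF ind]) (use k in auto)
    have r: "(\<Sum>i<m. restrict (\<lambda>i. X i \<omega>) {..<k} i) = S m \<omega>" if "m \<le> k" for m \<omega>
      using that unfolding S_def by (intro sum.cong) auto
    have eA: "A k = (\<lambda>\<omega>. restrict (\<lambda>i. X i \<omega>) {..<k}) -` A' \<inter> space M"
    proof -
      have "restrict (\<lambda>i. X i \<omega>) {..<k} \<in> A' \<longleftrightarrow> (\<forall>m<k. \<bar>S m \<omega>\<bar> < 2 * x) \<and> 2 * x \<le> \<bar>S k \<omega>\<bar>" for \<omega>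
        unfolding A'_def mem_Collect_eq using r[of _ \<omega>] by (simp only: space_PiM less_imp_le order_refl) simp
      then show ?thesis unfolding A_def by blast
    qed
    have eB: "B k = (\<lambda>\<omega>. restrict (\<lambda>i. X i \<omega>) {k..<n}) -` B' \<inter> space M"
    proof -
      have "restrict (\<lambda>i. X i \<omega>) {k..<n} \<in> B' \<longleftrightarrow> x \<le> \<bar>\<Sum>i\<in>{k..<n}. X i \<omega>\<bar>" for \<omega>
        unfolding B'_def by (simp add: space_PiM)
      then show ?thesis unfolding B_def by blast
    qed
    have "A k \<inter> B k = (\<lambda>\<omega>. (restrict (\<lambda>i. X i \<omega>) {..<k}, restrict (\<lambda>i. X i \<omega>) {k..<n})) -` (A' \<times> B') \<inter> space M"
      unfolding eA eB by auto
    then show ?thesis using indep_varD[OF iv A' B'] by (simp add: eA eB)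
  qed
  define E where "E = {\<omega>\<in>space M. \<exists>m\<le>n. 2 * x \<le> \<bar>S m \<omega>\<bar>}"
  have EA: "E \<subseteq> (\<Union>k\<in>{..n}. A k)"
  proof
    fix \<omega> assume w: "\<omega> \<in> E"
    define k where "k = (LEAST m. 2 * x \<le> \<bar>S m \<omega>\<bar>)"
    from w obtain m where m: "m \<le> n" "2 * x \<le> \<bar>S m \<omega>\<bar>" by (auto simp: E_def)
    have "2 * x \<le> \<bar>S k \<omega>\<bar>" "k \<le> n"
      unfolding k_def using m by (auto intro: LeastI Least_le[THEN order_trans])
    moreover have "\<bar>S j \<omega>\<bar> < 2 * x" if "j < k" for j
      using not_less_Least[of j "\<lambda>m. 2 * x \<le> \<bar>S m \<omega>\<bar>"] that by (auto simp: k_def)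
    ultimately show "\<omega> \<in> (\<Union>k\<in>{..n}. A k)" using w by (auto simp: A_def E_def)
  qed
  have Esub: "E \<subseteq> B 0 \<union> (\<Union>k\<in>{..n}. A k \<inter> B k)"
  proof
    fix \<omega> assume w: "\<omega> \<in> E"
    then obtain k where k: "k \<le> n" "\<omega> \<in> A k" using EA by blast
    have "S n \<omega> = S k \<omega> + (\<Sum>i\<in>{k..<n}. X i \<omega>)"
      unfolding S_def using k(1) by (simp add: sum.atLeastLessThan_concat lessThan_atLeast0)
    moreover have "B 0 = {\<omega>\<in>space M. x \<le> \<bar>S n \<omega>\<bar>}" by (simp add: B_def S_def lessThan_atLeast0)
    moreover have "2 * x \<le> \<bar>S k \<omega>\<bar>" "\<omega> \<in> space M" using k by (auto simp: A_def)
    ultimately have "\<omega> \<in> B 0 \<or> \<omega> \<in> B k" unfolding B_def by auto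
    then show "\<omega> \<in> B 0 \<union> (\<Union>k\<in>{..n}. A k \<inter> B k)" using k by auto
  qed
  have disj: "disjoint_family_on A {..n}"
    unfolding disjoint_family_on_def A_def by auto (metis linorder_neqE_nat not_less)
  have "prob E \<le> prob (B 0 \<union> (\<Union>k\<in>{..n}. A k \<inter> B k))"
    by (rule finite_measure_mono[OF Esub]) auto
  also have "\<dots> \<le> prob (B 0) + prob (\<Union>k\<in>{..n}. A k \<inter> B k)"
    by (rule measure_Un_le) auto
  also have "prob (\<Union>k\<in>{..n}. A k \<inter> B k) \<le> (\<Sum>k\<in>{..n}. prob (A k \<inter> B k))"
    by (rule finite_measure_subadditive_finite) auto
  also have "\<dots> \<le> (\<Sum>k\<in>{..n}. prob (A k) * e)"
    by (intro sum_mono) (auto simp: indAB intro!: mult_left_mono bound)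
  also have "\<dots> = prob (\<Union>k\<in>{..n}. A k) * e"
    by (subst finite_measure_finite_Union[OF _ _ disj]) (auto simp: sum_distrib_right)
  also have "\<dots> \<le> 1 * e" by (intro mult_right_mono) (auto simp: e_def)
  finally have "prob E \<le> 2 * e" using bound[of 0] by simp
  then show ?thesis by (simp add: E_def S_def e_def)
qed

text \<open>Lowers the exponents 2^j q of the dyadic blocks below to (j + 1) q, so that their bounds
  sum to a geometric series.\<close>

lemma Suc_le_two_power: "real (Suc j) \<le> 2 ^ j"
proof -
  have "Suc j \<le> 2 ^ j" by (rule Suc_leI[OF less_exp])
  then have "real (Suc j) \<le> real (2 ^ j)" by (rule of_nat_mono)
  then show ?thesis by simp
qed

text \<open>Peeling over the blocks 2^j K <= m <= 2^(j+1) K: within a block the line is at least c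
  2^j K, so the maximal inequality with x = c 2^j K / 2 applies. Its exponent is at least 2^j q with
  q = c^2 K / (16 \<alpha>^2), and the geometric series sums to 4 / (exp q - 1), at most 4 / q. The
  bound is invariant under refinement of the time step, when \<alpha>^2 and c scale with the step
  and K inversely to it.\<close>

lemma (in prob_space) subgaussian_walk_below_line:
  fixes X :: "nat \<Rightarrow> 'a \<Rightarrow> real"
  assumes ind: "indep_vars (\<lambda>_. borel) X {..<n}"
    and sg: "\<And>i. i < n \<Longrightarrow> subgaussian M \<alpha> (X i)" and pos: "\<alpha> > 0" "c > 0" and K: "K \<ge> 1"
  shows "prob {\<omega>\<in>space M. \<exists>m\<le>n. K \<le> real m \<and> c * real m \<le> \<bar>\<Sum>i<m. X i \<omega>\<bar>} \<le> 64 * \<alpha>\<^sup>2 / (c\<^sup>2 * K)"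
proof -
  define q where "q = c\<^sup>2 * K / (16 * \<alpha>\<^sup>2)"
  have q: "q > 0" using pos K by (simp add: q_def)
  have [measurable]: "random_variable borel (X i)" if "i < n" for i
    using ind that by (auto simp: indep_vars_def)
  define N where "N j = min n (nat \<lfloor>2 ^ Suc j * K\<rfloor>)" for j
  define E where "E j = {\<omega>\<in>space M. \<exists>m\<le>N j. 2 * (c * 2 ^ j * K / 2) \<le> \<bar>\<Sum>i<m. X i \<omega>\<bar>}" for j
  have E: "E j \<in> events" for j
  proof -
    have "E j = (\<Union>m\<in>{..N j}. {\<omega>\<in>space M. 2 * (c * 2 ^ j * K / 2) \<le> \<bar>\<Sum>i<m. X i \<omega>\<bar>})"
      by (auto simp: E_def)
    also have "\<dots> \<in> events"
      by (intro sets.finite_UN borel_measurable_le borel_measurable_abs borel_measurable_sum) (auto simp: N_def)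
    finally show ?thesis .
  qed
  have prE: "prob (E j) \<le> 4 * exp (- q) ^ Suc j" if "n > 0" for j
  proof -
    have "1 \<le> 2 ^ Suc j * K" using K mult_mono[of 1 "2 ^ Suc j" 1 K] one_le_power[of "2::real" "Suc j"] by simp
    then have N1: "N j \<ge> 1" and N2: "real (N j) \<le> 2 ^ Suc j * K"
      using that by (auto simp: N_def le_nat_iff min_def) linarith+
    have "prob (E j) \<le> 4 * exp (- ((c * 2 ^ j * K / 2)\<^sup>2 / (2 * real (N j) * \<alpha>\<^sup>2)))"
      unfolding E_def
      by (rule subgaussian_maximal) (use pos K in \<open>auto simp: N_def intro: sg indep_vars_subset[OF ind]\<close>)
    also have "\<dots> \<le> 4 * exp (- (real (Suc j) * q))"
    proof -
      have "real (Suc j) * q \<le> 2 ^ j * q"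
        by (rule mult_right_mono[OF Suc_le_two_power]) (use q in simp)
      also have "\<dots> = (c * 2 ^ j * K / 2)\<^sup>2 / (2 * (2 ^ Suc j * K) * \<alpha>\<^sup>2)"
        using pos K by (simp add: q_def field_simps power2_eq_square)
      also have "\<dots> \<le> (c * 2 ^ j * K / 2)\<^sup>2 / (2 * real (N j) * \<alpha>\<^sup>2)"
        using N1 N2 pos K by (intro divide_left_mono mult_right_mono mult_left_mono mult_pos_pos) auto
      finally show ?thesis by simp
    qed
    also have "exp (- (real (Suc j) * q)) = exp (- q) ^ Suc j"
      by (simp only: exp_of_nat_mult[symmetric] mult_minus_right)
    finally show ?thesis .
  qed
  define F where "F = {\<omega>\<in>space M. \<exists>m\<le>n. K \<le> real m \<and> c * real m \<le> \<bar>\<Sum>i<m. X i \<omega>\<bar>}"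
  show ?thesis
  proof (cases "n = 0")
    case True
    then have "F = {}" using K by (auto simp: F_def)
    then show ?thesis using pos K by (simp add: F_def[symmetric])
  next
    case False
    have "F \<subseteq> (\<Union>j\<in>{..n}. E j)"
    proof
      fix \<omega> assume "\<omega> \<in> F"
      then obtain m where m: "m \<le> n" "K \<le> real m" "c * real m \<le> \<bar>\<Sum>i<m. X i \<omega>\<bar>" and w: "\<omega> \<in> space M"
        by (auto simp: F_def)
      \<comment> \<open>The first block whose right end reaches m. Minimality puts m beyond its left
        end; for j = 0 this is the condition \<open>K \<le> real m\<close>.\<close>
      define j where "j = (LEAST j. real m \<le> 2 ^ Suc j * K)"
      have "real m \<le> 2 ^ Suc m * K"
      proof -
        have "real m \<le> 2 ^ Suc m" using Suc_le_two_power[of m] by simp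
        also have "\<dots> \<le> 2 ^ Suc m * K" using K mult_left_mono[of 1 K "2 ^ Suc m"] by simp
        finally show ?thesis .
      qed
      then have j: "real m \<le> 2 ^ Suc j * K" "j \<le> m"
        unfolding j_def by (auto intro: LeastI Least_le)
      have j2: "2 ^ j * K \<le> real m"
      proof (cases j)
        case (Suc i)
        then have "\<not> real m \<le> 2 ^ Suc i * K"
          using not_less_Least[of i "\<lambda>j. real m \<le> 2 ^ Suc j * K"] by (simp add: j_def)
        then show ?thesis using Suc by simp
      qed (use m in simp)
      have "m \<le> N j" using m(1) j(1) by (simp add: N_def le_nat_floor)
      moreover have "2 * (c * 2 ^ j * K / 2) \<le> \<bar>\<Sum>i<m. X i \<omega>\<bar>"
        using order_trans[OF mult_left_mono[OF j2, of c] m(3)] pos by (simp add: mult.assoc)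
      ultimately have "\<omega> \<in> E j" using w by (auto simp: E_def)
      then show "\<omega> \<in> (\<Union>j\<in>{..n}. E j)" using j(2) m(1) by auto
    qed
    then have "prob F \<le> prob (\<Union>j\<in>{..n}. E j)" by (rule finite_measure_mono) (use E in auto)
    also have "\<dots> \<le> (\<Sum>j\<in>{..n}. prob (E j))"
      by (rule finite_measure_subadditive_finite) (use E in auto)
    also have "\<dots> \<le> (\<Sum>j\<in>{..n}. 4 * exp (- q) ^ Suc j)"
      using False by (intro sum_mono prE) auto
    also have "\<dots> = 4 * exp (- q) * (\<Sum>j\<in>{..n}. exp (- q) ^ j)"
      by (simp add: sum_distrib_left mult_ac)
    also have "\<dots> \<le> 4 * exp (- q) * (1 / (1 - exp (- q)))"
    proof (intro mult_left_mono)
      have "(\<Sum>j\<in>{..n}. exp (- q) ^ j) \<le> (\<Sum>j. exp (- q) ^ j)"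
        using q by (intro sum_le_suminf summable_geometric) auto
      then show "(\<Sum>j\<in>{..n}. exp (- q) ^ j) \<le> 1 / (1 - exp (- q))"
        using q by (subst (asm) suminf_geometric) auto
    qed auto
    also have "\<dots> = 4 / (exp q - 1)"
      using q by (simp add: field_simps exp_minus)
    also have "\<dots> \<le> 4 / q"
      using q exp_ge_add_one_self[of q] by (intro divide_left_mono) (simp_all del: exp_ge_add_one_self)
    also have "\<dots> = 64 * \<alpha>\<^sup>2 / (c\<^sup>2 * K)" using pos K by (simp add: q_def)
    finally show ?thesis by (simp add: F_def)
  qed
qed

section \<open>Weak convergence of independent coordinates\<close>

text \<open>Reverse Fatou for events: the tail unions \<open>D k\<close> decrease to the set of
  points lying in infinitely many \<open>E n\<close>, which is almost surely contained in
  \<open>F\<close>.\<close>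

lemma (in finite_measure) eventually_measure_le_limsup:
  assumes En: "\<And>n. E n \<in> sets M" and E: "F \<in> sets M"
    and lim: "AE x in M. (\<exists>\<^sub>\<infinity>n. x \<in> E n) \<longrightarrow> x \<in> F" and e: "(e::real) > 0"
  shows "eventually (\<lambda>n. measure M (E n) \<le> measure M F + e) sequentially"
proof -
  define D where "D k = (\<Union>n\<in>{k..}. E n)" for k
  have D[measurable]: "D k \<in> sets M" for k unfolding D_def using En by auto
  have "(\<lambda>k. measure M (D k)) \<longlonglongrightarrow> measure M (\<Inter>k. D k)"
  proof (rule finite_Lim_measure_decseq)
    show "decseq D" unfolding decseq_def D_def by (force intro: order_trans)
  qed auto
  moreover have "measure M (\<Inter>k. D k) \<le> measure M F"
    using lim by (intro finite_measure_mono_AE E)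
      (auto simp: D_def INFM_nat_le elim!: eventually_mono)
  ultimately have "eventually (\<lambda>k. measure M (D k) < measure M F + e) sequentially"
    using e by (intro order_tendstoD(2)) auto
  then show ?thesis
  proof eventually_elim
    case (elim k)
    have "measure M (E k) \<le> measure M (D k)" by (rule finite_measure_mono[OF _ D]) (auto simp: D_def)
    with elim show ?case by simp
  qed
qed

text \<open>A finite product measure is determined by its values on rectangles, and a coordinatewise
  map pulls rectangles back to rectangles.\<close>

lemma distr_PiM_coordinatewise:
  fixes Y :: "'i \<Rightarrow> 'a \<Rightarrow> real"
  assumes fin: "finite I" and ps: "\<And>i. prob_space (\<Omega> i)" and Y[measurable]: "\<And>i. Y i \<in> borel_measurable (\<Omega> i)"
  shows "distr (PiM I \<Omega>) (PiM I (\<lambda>_. borel)) (\<lambda>\<omega>. \<lambda>i\<in>I. Y i (\<omega> i)) = PiM I (\<lambda>i. distr (\<Omega> i) borel (Y i))"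
    and "(\<lambda>\<omega>. \<lambda>i\<in>I. Y i (\<omega> i)) \<in> measurable (PiM I \<Omega>) (PiM I (\<lambda>_. borel))"
proof -
  show meas: "(\<lambda>\<omega>. \<lambda>i\<in>I. Y i (\<omega> i)) \<in> measurable (PiM I \<Omega>) (PiM I (\<lambda>_. borel))"
    by (rule measurable_restrict) measurable
  have pd: "prob_space (distr (\<Omega> i) borel (Y i))" for i
    by (rule prob_space.prob_space_distr[OF ps]) measurable
  interpret O: product_prob_space \<Omega> I
    by (intro product_prob_spaceI ps)
  interpret R: product_prob_space "\<lambda>i. distr (\<Omega> i) borel (Y i)" I
    by (intro product_prob_spaceI pd)
  show "distr (PiM I \<Omega>) (PiM I (\<lambda>_. borel)) (\<lambda>\<omega>. \<lambda>i\<in>I. Y i (\<omega> i)) = PiM I (\<lambda>i. distr (\<Omega> i) borel (Y i))"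
  proof (rule R.PiM_eqI[OF fin])
    show "sets (distr (PiM I \<Omega>) (PiM I (\<lambda>_. borel)) (\<lambda>\<omega>. \<lambda>i\<in>I. Y i (\<omega> i))) = sets (PiM I (\<lambda>i. distr (\<Omega> i) borel (Y i)))"
      by (simp cong: sets_PiM_cong)
  next
    fix A assume A: "\<And>i. i \<in> I \<Longrightarrow> A i \<in> sets (distr (\<Omega> i) borel (Y i))"
    then have A': "\<And>i. i \<in> I \<Longrightarrow> A i \<in> sets borel" by simp
    have "emeasure (distr (PiM I \<Omega>) (PiM I (\<lambda>_. borel)) (\<lambda>\<omega>. \<lambda>i\<in>I. Y i (\<omega> i))) (Pi\<^sub>E I A) =
      emeasure (PiM I \<Omega>) ((\<lambda>\<omega>. \<lambda>i\<in>I. Y i (\<omega> i)) -` (Pi\<^sub>E I A) \<inter> space (PiM I \<Omega>))"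
      by (rule emeasure_distr[OF meas]) (use A' fin in \<open>auto intro!: sets_PiM_I_finite\<close>)
    also have "(\<lambda>\<omega>. \<lambda>i\<in>I. Y i (\<omega> i)) -` (Pi\<^sub>E I A) \<inter> space (PiM I \<Omega>) = Pi\<^sub>E I (\<lambda>i. Y i -` A i \<inter> space (\<Omega> i))"
      by (auto simp: space_PiM PiE_iff)
    also have "emeasure (PiM I \<Omega>) \<dots> = (\<Prod>i\<in>I. emeasure (\<Omega> i) (Y i -` A i \<inter> space (\<Omega> i)))"
      by (rule O.emeasure_PiM[OF fin]) (use A' in \<open>auto intro: measurable_sets[OF Y]\<close>)
    also have "\<dots> = (\<Prod>i\<in>I. emeasure (distr (\<Omega> i) borel (Y i)) (A i))"
      by (intro prod.cong refl) (use A' in \<open>auto simp: emeasure_distr\<close>)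
    finally show "emeasure (distr (PiM I \<Omega>) (PiM I (\<lambda>_. borel)) (\<lambda>\<omega>. \<lambda>i\<in>I. Y i (\<omega> i))) (Pi\<^sub>E I A) =
      (\<Prod>i\<in>I. emeasure (distr (\<Omega> i) borel (Y i)) (A i))" .
  qed
qed

text \<open>Skorohod's representation, applied to each coordinate, turns weak convergence of the marginals into
  pointwise convergence of a random vector with independent coordinates.\<close>

lemma PiM_weak_conv_limsup:
  fixes \<mu> :: "nat \<Rightarrow> 'i \<Rightarrow> real measure" and \<nu> :: "'i \<Rightarrow> real measure"
  assumes fin: "finite I"
    and \<mu>: "\<And>n i. i \<in> I \<Longrightarrow> real_distribution (\<mu> n i)" and \<nu>: "\<And>i. i \<in> I \<Longrightarrow> real_distribution (\<nu> i)"
    and conv: "\<And>i. i \<in> I \<Longrightarrow> weak_conv_m (\<lambda>n. \<mu> n i) (\<nu> i)"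
    and C: "C \<in> sets (PiM I (\<lambda>_. borel))"
    and closed: "\<And>f g. (\<And>i. i \<in> I \<Longrightarrow> (\<lambda>n. f n i) \<longlonglongrightarrow> g i) \<Longrightarrow> g \<in> extensional I \<Longrightarrow> (\<exists>\<^sub>\<infinity>n. f n \<in> C) \<Longrightarrow> g \<in> C"
    and e: "e > 0"
  shows "eventually (\<lambda>n. measure (PiM I (\<mu> n)) C \<le> measure (PiM I \<nu>) C + e) sequentially"
proof -
  have "\<exists>\<Omega> Ys Y. prob_space (\<Omega> :: real measure) \<and> (\<forall>n. Ys n \<in> borel_measurable \<Omega>) \<and> (Y \<in> borel_measurable \<Omega>) \<and>
     (i \<in> I \<longrightarrow> (\<forall>n. distr \<Omega> borel (Ys n) = \<mu> n i) \<and> distr \<Omega> borel Y = \<nu> i \<and> (\<forall>x\<in>space \<Omega>. (\<lambda>n. Ys n x) \<longlonglongrightarrow> Y x))" for i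
  proof (cases "i \<in> I")
    case True
    then show ?thesis using Skorohod[OF \<mu> \<nu> conv, of i] by (auto simp: measurable_lborel1)
  next
    case False
    \<comment> \<open>Indices outside \<open>I\<close> get a point mass, so that the choice of
      spaces and variables is total.\<close>
    have "prob_space (return borel (0::real))" by (rule prob_space_return) simp
    then show ?thesis using False by (intro exI[of _ "return borel 0"] exI[of _ "\<lambda>_. id"] exI[of _ id]) auto
  qed
  then obtain \<Omega> Ys Y where ps: "\<And>i. prob_space (\<Omega> i :: real measure)"
    and Ys: "\<And>i n. Ys i n \<in> borel_measurable (\<Omega> i)" and Y: "\<And>i. Y i \<in> borel_measurable (\<Omega> i)"
    and dYs: "\<And>i n. i \<in> I \<Longrightarrow> distr (\<Omega> i) borel (Ys i n) = \<mu> n i" and dY: "\<And>i. i \<in> I \<Longrightarrow> distr (\<Omega> i) borel (Y i) = \<nu> i"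
    and lim: "\<And>i x. i \<in> I \<Longrightarrow> x \<in> space (\<Omega> i) \<Longrightarrow> (\<lambda>n. Ys i n x) \<longlonglongrightarrow> Y i x"
    by metis
  define Z where "Z n = (\<lambda>\<omega>. \<lambda>i\<in>I. Ys i n (\<omega> i))" for n
  define Z' where "Z' = (\<lambda>\<omega>. \<lambda>i\<in>I. Y i (\<omega> i))"
  interpret O: product_prob_space \<Omega> I by (intro product_prob_spaceI ps)
  have fm: "finite_measure (PiM I \<Omega>)" by (rule prob_space.finite_measure[OF prob_space_PiM[OF ps]])
  have Zm: "Z n \<in> measurable (PiM I \<Omega>) (PiM I (\<lambda>_. borel))" for n
    unfolding Z_def by (rule distr_PiM_coordinatewise(2)[OF fin ps Ys])
  have Zm': "Z' \<in> measurable (PiM I \<Omega>) (PiM I (\<lambda>_. borel))"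
    unfolding Z'_def by (rule distr_PiM_coordinatewise(2)[OF fin ps Y])
  have 1: "measure (PiM I (\<mu> n)) C = measure (PiM I \<Omega>) (Z n -` C \<inter> space (PiM I \<Omega>))" for n
  proof -
    have "PiM I (\<mu> n) = PiM I (\<lambda>i. distr (\<Omega> i) borel (Ys i n))"
      by (intro PiM_cong) (auto simp: dYs)
    also have "\<dots> = distr (PiM I \<Omega>) (PiM I (\<lambda>_. borel)) (Z n)"
      unfolding Z_def by (rule distr_PiM_coordinatewise(1)[OF fin ps Ys, symmetric])
    finally show ?thesis using measure_distr[OF Zm C] by simp
  qed
  have 2: "measure (PiM I \<nu>) C = measure (PiM I \<Omega>) (Z' -` C \<inter> space (PiM I \<Omega>))"
  proof -
    have "PiM I \<nu> = PiM I (\<lambda>i. distr (\<Omega> i) borel (Y i))"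
      by (intro PiM_cong) (auto simp: dY)
    also have "\<dots> = distr (PiM I \<Omega>) (PiM I (\<lambda>_. borel)) Z'"
      unfolding Z'_def by (rule distr_PiM_coordinatewise(1)[OF fin ps Y, symmetric])
    finally show ?thesis using measure_distr[OF Zm' C] by simp
  qed
  show ?thesis unfolding 1 2
  proof (rule finite_measure.eventually_measure_le_limsup[OF fm _ _ _ e])
    show "AE x in PiM I \<Omega>. (\<exists>\<^sub>\<infinity>n. x \<in> Z n -` C \<inter> space (PiM I \<Omega>)) \<longrightarrow> x \<in> Z' -` C \<inter> space (PiM I \<Omega>)"
    proof (rule AE_I2, rule impI)
      fix x assume x: "x \<in> space (PiM I \<Omega>)" and inf: "\<exists>\<^sub>\<infinity>n. x \<in> Z n -` C \<inter> space (PiM I \<Omega>)"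
      \<comment> \<open>The coupled vectors converge at every sample point, which lets
        \<open>closed\<close> be applied to each point separately.\<close>
      have "Z' x \<in> C"
      proof (rule closed[of "\<lambda>n. Z n x"])
        show "(\<lambda>n. Z n x i) \<longlonglongrightarrow> Z' x i" if "i \<in> I" for i
          using lim[OF that, of "x i"] x that by (auto simp: Z_def Z'_def space_PiM PiE_iff)
        show "Z' x \<in> extensional I" by (simp add: Z'_def)
        show "\<exists>\<^sub>\<infinity>n. Z n x \<in> C" using inf by (rule INFM_mono) auto
      qed
      then show "x \<in> Z' -` C \<inter> space (PiM I \<Omega>)" using x by auto
    qed
  qed (use Zm Zm' C in \<open>auto intro: measurable_sets\<close>)
qed

section \<open>Gaussian limits through characteristic functions\<close>

lemma (in prob_space) char_normal:
  assumes d: "distributed M lborel X (normal_density 0 (sqrt h))" and h: "h > 0"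
  shows "char (distr M borel X) t = complex_of_real (exp (- (h * t\<^sup>2 / 2)))"
proof -
  have X[measurable]: "random_variable borel X" using distributed_measurable[OF d] by simp
  have "distributed M lborel (\<lambda>x. X x / sqrt h) std_normal_density"
    using normal_standard_normal_convert[of "sqrt h" X 0] d h by simp
  then have "distr M lborel (\<lambda>x. X x / sqrt h) = std_normal_distribution"
    by (rule distributed_distr_eq_density)
  then have "distr M borel (\<lambda>x. X x / sqrt h) = std_normal_distribution"
    by (metis distr_cong sets_lborel)
  then have c: "char (distr M borel (\<lambda>x. X x / sqrt h)) (sqrt h * t) = complex_of_real (exp (- ((sqrt h * t)\<^sup>2) / 2))"
    by (simp add: char_std_normal_distribution)
  have "char (distr M borel X) t = (CLINT x|M. iexp (t * X x))"
    by (simp add: char_def integral_distr)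
  also have "\<dots> = char (distr M borel (\<lambda>x. X x / sqrt h)) (sqrt h * t)"
    using h by (simp add: char_def integral_distr)
  finally show ?thesis using h unfolding c by (simp add: power_mult_distrib)
qed

lemma (in prob_space) subgaussian_normal:
  assumes d: "distributed M lborel X (normal_density 0 (sqrt h))" and h: "h > 0"
  shows "subgaussian M (sqrt h) X"
  unfolding subgaussian_def
proof
  fix u :: real
  \<comment> \<open>Completing the square: exponential tilting of a centered Gaussian density shifts
    its mean to h u.\<close>
  have eq: "normal_density 0 (sqrt h) x * exp (u * x) = exp (h * u\<^sup>2 / 2) * normal_density (h * u) (sqrt h) x" for x
  proof -
    have "- (x\<^sup>2 / (2 * h)) + u * x = h * u\<^sup>2 / 2 + (- ((x - h * u)\<^sup>2 / (2 * h)))"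
      using h by (simp add: field_simps power2_eq_square)
    then have "exp (- (x\<^sup>2 / (2 * h))) * exp (u * x) = exp (h * u\<^sup>2 / 2) * exp (- ((x - h * u)\<^sup>2 / (2 * h)))"
      by (simp only: exp_add[symmetric])
    then show ?thesis using h by (simp add: normal_density_def mult_ac)
  qed
  have i: "integrable lborel (\<lambda>x. normal_density 0 (sqrt h) x * exp (u * x))"
    unfolding eq using h by (intro integrable_mult_right integrable_normal_density) simp
  have v: "(\<integral>x. normal_density 0 (sqrt h) x * exp (u * x) \<partial>lborel) = exp (h * u\<^sup>2 / 2)"
    unfolding eq using h by (simp add: integral_normal_density)
  have "integrable M (\<lambda>\<omega>. exp (u * X \<omega>))"
    using distributed_integrable[OF d, of "\<lambda>x. exp (u * x)"] i by simp
  moreover have "(\<integral>\<omega>. exp (u * X \<omega>) \<partial>M) = exp (h * u\<^sup>2 / 2)"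
    using distributed_integral[OF d, of "\<lambda>x. exp (u * x)"] v by simp
  ultimately show "integrable M (\<lambda>\<omega>. exp (u * X \<omega>)) \<and> (\<integral>\<omega>. exp (u * X \<omega>) \<partial>M) \<le> exp ((sqrt h)\<^sup>2 * u\<^sup>2 / 2)"
    using h by simp
qed

text \<open>The upper half rests on (1 + y) (1 - y + y^2) = 1 + y^3 >= 1 together with 1 + y <= exp
  y.\<close>

lemma exp_minus_quadratic_approx:
  fixes y :: real
  assumes "y \<ge> 0"
  shows "\<bar>exp (- y) - (1 - y)\<bar> \<le> y\<^sup>2"
proof -
  have 1: "1 - y \<le> exp (- y)" using exp_ge_add_one_self[of "- y"] by simp
  have "(1 + y) * (1 - y + y\<^sup>2) = 1 + y ^ 3" by (simp add: algebra_simps power2_eq_square power3_eq_cube)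
  then have "1 \<le> (1 + y) * (1 - y + y\<^sup>2)" using assms by simp
  also have "\<dots> \<le> exp y * (1 - y + y\<^sup>2)"
  proof (rule mult_right_mono)
    show "1 + y \<le> exp y" by (rule exp_ge_add_one_self)
    have "0 \<le> (y - 1 / 2)\<^sup>2 + 3 / 4" by (simp add: add_nonneg_nonneg)
    also have "\<dots> = 1 - y + y\<^sup>2" by (simp add: power2_eq_square algebra_simps)
    finally show "0 \<le> 1 - y + y\<^sup>2" .
  qed
  finally have "exp (- y) \<le> 1 - y + y\<^sup>2" by (simp add: exp_minus field_simps)
  with 1 show ?thesis by (simp add: abs_if)
qed

text \<open>A Lindeberg argument made quantitative by subgaussianity: the third absolute moment of a
  term is of order a^(3/2) and there are about h / a terms, so the total error in the characteristic
  function is of order sqrt a. Each factor is compared with the Gaussian factor \<open>w n\<close>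
  of the same variance; as all factors have modulus at most 1, the error of the product is at most
  the sum of the errors.\<close>

lemma subgaussian_array_clt:
  fixes X :: "nat \<Rightarrow> 'i \<Rightarrow> 'a \<Rightarrow> real"
  assumes prob: "\<And>n. prob_space (M n)" and fin: "\<And>n. finite (A n)"
    and ind: "\<And>n. prob_space.indep_vars (M n) (\<lambda>_. borel) (X n) (A n)"
    and mean: "\<And>n i. i \<in> A n \<Longrightarrow> (\<integral>\<omega>. X n i \<omega> \<partial>M n) = 0"
    and var: "\<And>n i. i \<in> A n \<Longrightarrow> (\<integral>\<omega>. (X n i \<omega>)\<^sup>2 \<partial>M n) = a n * v n"
    and sg: "\<And>n i. i \<in> A n \<Longrightarrow> subgaussian (M n) (K * sqrt (a n)) (X n i)"
    and K: "K > 0" and a: "\<And>n. a n > 0" "a \<longlonglongrightarrow> 0" and v: "v \<longlonglongrightarrow> 1"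
    and h: "(\<lambda>n. real (card (A n)) * a n) \<longlonglongrightarrow> h"
  shows "(\<lambda>n. char (distr (M n) borel (\<lambda>\<omega>. \<Sum>i\<in>A n. X n i \<omega>)) t) \<longlonglongrightarrow> complex_of_real (exp (- (h * t\<^sup>2 / 2)))"
proof -
  \<comment> \<open>The 6 in the Taylor bound t^2 / 6 cancels the 3! of the third moment
    bound.\<close>
  define C where "C = \<bar>t\<bar> ^ 3 * 2 * exp (1 / 2) * K ^ 3"
  define w where "w n = complex_of_real (exp (- (t\<^sup>2 * (a n * v n) / 2)))" for n
  define b where "b n = C * (a n * sqrt (a n)) + (t\<^sup>2 * (a n * v n) / 2)\<^sup>2" for n
  have main: "norm (char (distr (M n) borel (\<lambda>\<omega>. \<Sum>i\<in>A n. X n i \<omega>)) t - w n ^ card (A n)) \<le> real (card (A n)) * b n" for n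
  proof -
    interpret prob_space "M n" by (rule prob)
    have rv: "random_variable borel (X n i)" if "i \<in> A n" for i
      using ind[of n] that by (auto simp: indep_vars_def)
    have eq: "char (distr (M n) borel (\<lambda>\<omega>. \<Sum>i\<in>A n. X n i \<omega>)) t = (\<Prod>i\<in>A n. char (distr (M n) borel (X n i)) t)"
      by (rule char_distr_sum[OF ind])
    have Ka: "K * sqrt (a n) > 0" using K a by simp
    have av: "a n * v n \<ge> 0" if "i \<in> A n" for i
      using var[OF that] by (metis integral_nonneg_AE AE_I2 zero_le_power2)
    have each: "norm (char (distr (M n) borel (X n i)) t - w n) \<le> b n" if i: "i \<in> A n" for i
    proof -
      note mom = subgaussian_moment[OF rv[OF i] sg[OF i] Ka]
      have i1: "integrable (M n) (X n i)"
        using mom(1)[of 1] rv[OF i] by (simp add: integrable_abs_iff)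
      have i2: "integrable (M n) (\<lambda>\<omega>. (X n i \<omega>)\<^sup>2)" using mom(1)[of 2] by simp
      have "norm (char (distr (M n) borel (X n i)) t - (1 - t\<^sup>2 * (a n * v n) / 2)) \<le>
        (t\<^sup>2 / 6) * expectation (\<lambda>x. min (6 * (X n i x)\<^sup>2) (\<bar>t\<bar> * \<bar>X n i x\<bar> ^ 3))"
        by (rule char_approx3'[OF rv[OF i] i1 i2 mean[OF i] _ refl]) (simp add: mean[OF i] var[OF i])
      also have "\<dots> \<le> (t\<^sup>2 / 6) * (\<bar>t\<bar> * (2 * exp (1 / 2) * fact 3 * (K * sqrt (a n)) ^ 3))"
      proof (intro mult_left_mono)
        have "expectation (\<lambda>x. min (6 * (X n i x)\<^sup>2) (\<bar>t\<bar> * \<bar>X n i x\<bar> ^ 3)) \<le> expectation (\<lambda>x. \<bar>t\<bar> * \<bar>X n i x\<bar> ^ 3)"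
          by (intro integral_mono integrable_min integrable_mult_right i2 mom(1)) auto
        also have "\<dots> = \<bar>t\<bar> * expectation (\<lambda>x. \<bar>X n i x\<bar> ^ 3)" by simp
        also have "\<dots> \<le> \<bar>t\<bar> * (2 * exp (1 / 2) * fact 3 * (K * sqrt (a n)) ^ 3)"
          by (intro mult_left_mono mom(2)) simp
        finally show "expectation (\<lambda>x. min (6 * (X n i x)\<^sup>2) (\<bar>t\<bar> * \<bar>X n i x\<bar> ^ 3)) \<le> \<bar>t\<bar> * (2 * exp (1 / 2) * fact 3 * (K * sqrt (a n)) ^ 3)" .
      qed simp
      also have "\<dots> = C * (a n * sqrt (a n))"
        using a(1)[of n] by (simp add: C_def fact_numeral power_mult_distrib power3_eq_cube power2_eq_square)
      finally have 1: "norm (char (distr (M n) borel (X n i)) t - (1 - t\<^sup>2 * (a n * v n) / 2)) \<le> C * (a n * sqrt (a n))" .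
      have "norm (w n - (1 - t\<^sup>2 * (a n * v n) / 2)) = \<bar>exp (- (t\<^sup>2 * (a n * v n) / 2)) - (1 - t\<^sup>2 * (a n * v n) / 2)\<bar>"
        unfolding w_def by (metis norm_of_real of_real_1 of_real_diff real_norm_def)
      also have "\<dots> \<le> (t\<^sup>2 * (a n * v n) / 2)\<^sup>2"
        using av[OF i] by (intro exp_minus_quadratic_approx) simp
      finally have 2: "norm (w n - (1 - t\<^sup>2 * (a n * v n) / 2)) \<le> (t\<^sup>2 * (a n * v n) / 2)\<^sup>2" .
      have tri: "norm (x - y) \<le> norm (x - z) + norm (y - z)" for x y z :: complex
        using norm_triangle_ineq4[of "x - z" "y - z"] by simp
      have "norm (char (distr (M n) borel (X n i)) t - w n) \<le> norm (char (distr (M n) borel (X n i)) t - (1 - t\<^sup>2 * (a n * v n) / 2)) + norm (w n - (1 - t\<^sup>2 * (a n * v n) / 2))"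
        by (rule tri)
      with 1 2 show ?thesis by (simp add: b_def)
    qed
    have "norm ((\<Prod>i\<in>A n. char (distr (M n) borel (X n i)) t) - (\<Prod>i\<in>A n. w n)) \<le> (\<Sum>i\<in>A n. norm (char (distr (M n) borel (X n i)) t - w n))"
    proof (rule norm_prod_diff)
      show "norm (char (distr (M n) borel (X n i)) t) \<le> 1" if "i \<in> A n" for i
        using real_distribution.cmod_char_le_1[OF real_distribution_distr[OF rv[OF that]]] .
      show "norm (w n) \<le> 1" if "i \<in> A n" for i using av[OF that] by (simp add: w_def)
    qed
    also have "\<dots> \<le> (\<Sum>i\<in>A n. b n)" by (intro sum_mono each)
    finally show ?thesis by (simp add: eq)
  qed
  have sq: "(\<lambda>n. sqrt (a n)) \<longlonglongrightarrow> 0" using tendsto_real_sqrt[OF a(2)] by simp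
  have "(\<lambda>n. (real (card (A n)) * a n) * (C * sqrt (a n) + a n * (t\<^sup>2 * v n / 2)\<^sup>2)) \<longlonglongrightarrow> h * (C * 0 + 0 * (t\<^sup>2 * 1 / 2)\<^sup>2)"
    by (intro tendsto_intros h sq a v) simp
  moreover have "(real (card (A n)) * a n) * (C * sqrt (a n) + a n * (t\<^sup>2 * v n / 2)\<^sup>2) = real (card (A n)) * b n" for n
    by (simp add: b_def power2_eq_square algebra_simps)
  ultimately have lim0: "(\<lambda>n. real (card (A n)) * b n) \<longlonglongrightarrow> 0" by simp
  have "(\<lambda>n. w n ^ card (A n)) = (\<lambda>n. complex_of_real (exp (- ((real (card (A n)) * a n) * v n * t\<^sup>2 / 2))))"
    unfolding w_def of_real_power[symmetric] exp_of_nat_mult[symmetric] by (simp add: mult_ac)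
  moreover have "(\<lambda>n. complex_of_real (exp (- ((real (card (A n)) * a n) * v n * t\<^sup>2 / 2)))) \<longlonglongrightarrow> complex_of_real (exp (- (h * 1 * t\<^sup>2 / 2)))"
    by (intro tendsto_intros h v) simp_all
  ultimately have "(\<lambda>n. w n ^ card (A n)) \<longlonglongrightarrow> complex_of_real (exp (- (h * t\<^sup>2 / 2)))" by simp
  then show ?thesis
    by (rule Lim_transform) (rule Lim_null_comparison[OF always_eventually[OF allI[OF main]] lim0])
qed

section \<open>Dyadic grids and Gaussian anticoncentration\<close>

lemma dyadic_ceiling_tendsto:
  fixes r :: real assumes "r \<ge> 0"
  shows "(\<lambda>k. real (nat \<lceil>r * 2 ^ k\<rceil>) / 2 ^ k) \<longlonglongrightarrow> r"
proof (rule tendsto_sandwich[of "\<lambda>_. r" _ _ "\<lambda>k. r + (1 / 2) ^ k"])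
  show "\<forall>\<^sub>F k in sequentially. real (nat \<lceil>r * 2 ^ k\<rceil>) / 2 ^ k \<le> r + (1 / 2) ^ k"
  proof (intro always_eventually allI)
    fix k
    have "0 \<le> r * 2 ^ k" using assms by simp
    then have "real (nat \<lceil>r * 2 ^ k\<rceil>) \<le> r * 2 ^ k + 1" by (subst of_nat_nat) linarith+
    then have "real (nat \<lceil>r * 2 ^ k\<rceil>) / 2 ^ k \<le> (r * 2 ^ k + 1) / 2 ^ k" by (rule divide_right_mono) simp
    then show "real (nat \<lceil>r * 2 ^ k\<rceil>) / 2 ^ k \<le> r + (1 / 2) ^ k" by (simp add: add_divide_distrib power_divide)
  qed
  show "\<forall>\<^sub>F k in sequentially. r \<le> real (nat \<lceil>r * 2 ^ k\<rceil>) / 2 ^ k"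
    using real_nat_ceiling_ge[of "r * 2 ^ _"] by (intro always_eventually allI) (simp add: field_simps)
  have "(\<lambda>k. r + (1 / 2) ^ k) \<longlonglongrightarrow> r + 0" by (intro tendsto_intros LIMSEQ_realpow_zero) auto
  then show "(\<lambda>k. r + (1 / 2) ^ k) \<longlonglongrightarrow> r" by simp
qed simp

lemma dyadic_floor_tendsto:
  fixes r :: real assumes "r \<ge> 0"
  shows "(\<lambda>k. real (nat \<lfloor>r * 2 ^ k\<rfloor>) / 2 ^ k) \<longlonglongrightarrow> r"
proof (rule tendsto_sandwich[of "\<lambda>k. r - (1 / 2) ^ k" _ _ "\<lambda>_. r"])
  show "\<forall>\<^sub>F k in sequentially. r - (1 / 2) ^ k \<le> real (nat \<lfloor>r * 2 ^ k\<rfloor>) / 2 ^ k"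
  proof (intro always_eventually allI)
    fix k
    have "0 \<le> r * 2 ^ k" using assms by simp
    then have "r * 2 ^ k - 1 \<le> real (nat \<lfloor>r * 2 ^ k\<rfloor>)" by (subst of_nat_nat) linarith+
    then have "(r * 2 ^ k - 1) / 2 ^ k \<le> real (nat \<lfloor>r * 2 ^ k\<rfloor>) / 2 ^ k" by (rule divide_right_mono) simp
    then show "r - (1 / 2) ^ k \<le> real (nat \<lfloor>r * 2 ^ k\<rfloor>) / 2 ^ k" by (simp add: diff_divide_distrib power_divide)
  qed
  show "\<forall>\<^sub>F k in sequentially. real (nat \<lfloor>r * 2 ^ k\<rfloor>) / 2 ^ k \<le> r"
    using assms by (intro always_eventually allI) (simp add: field_simps)
  have "(\<lambda>k. r - (1 / 2) ^ k) \<longlonglongrightarrow> r - 0" by (intro tendsto_intros LIMSEQ_realpow_zero) auto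
  then show "(\<lambda>k. r - (1 / 2) ^ k) \<longlonglongrightarrow> r" by simp
qed simp

text \<open>Rounding u up to the grid costs at most one mesh and the interval takes another, hence
  the mesh below (v - u) / 2. Such an interval will separate two hypothetical minimizers.\<close>

lemma dyadic_interval_between:
  fixes u v :: real assumes "0 \<le> u" "u < v"
  shows "\<exists>k i. u \<le> real i / 2 ^ k \<and> real (Suc i) / 2 ^ k \<le> v"
proof -
  obtain k where k: "(1 / 2) ^ k < (v - u) / 2"
    using real_arch_pow_inv[of "(v - u) / 2" "1 / 2"] assms by auto
  define i where "i = nat \<lceil>u * 2 ^ k\<rceil>"
  have 1: "u \<le> real i / 2 ^ k"
    using real_nat_ceiling_ge[of "u * 2 ^ k"] by (simp add: field_simps i_def)
  have "0 \<le> u * 2 ^ k" using assms by simp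
  then have "real i \<le> u * 2 ^ k + 1" unfolding i_def by (subst of_nat_nat) linarith+
  then have "real (Suc i) / 2 ^ k \<le> (u * 2 ^ k + 2) / 2 ^ k" by (intro divide_right_mono) auto
  also have "\<dots> = u + 2 * (1 / 2) ^ k" by (simp add: add_divide_distrib power_divide)
  also have "\<dots> \<le> v" using k by (simp add: field_simps)
  finally show ?thesis using 1 by blast
qed

text \<open>On rectangles the probability factors first between the two processes and then within
  each of them. The whole paths \<open>X True\<close> and \<open>X False\<close> enter as points of
  one space \<open>S\<close>, so independence of the paths passes to all functionals
  \<open>f b i\<close> at once.\<close>

lemma (in prob_space) indep_vars_two_processes:
  fixes f :: "bool \<Rightarrow> nat \<Rightarrow> 'c \<Rightarrow> real"
  assumes iv: "indep_var S (X True) S (X False)"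
    and f: "\<And>b i. f b i \<in> borel_measurable S"
    and ind: "\<And>b. indep_vars (\<lambda>_. borel) (\<lambda>i \<omega>. f b i (X b \<omega>)) {..<n}"
  shows "indep_vars (\<lambda>_. borel) (\<lambda>j \<omega>. f (fst j) (snd j) (X (fst j) \<omega>)) (UNIV \<times> {..<n})"
proof (cases "n = 0")
  case True
  then show ?thesis by (simp add: indep_vars_def indep_sets_def)
next
  case False
  have X: "random_variable S (X b)" for b
    using indep_var_rv1[OF iv] indep_var_rv2[OF iv] by (cases b) auto
  have rv: "random_variable borel (\<lambda>\<omega>. f b i (X b \<omega>))" for b i
    using measurable_compose[OF X f] .
  have ne: "UNIV \<times> {..<n} \<noteq> ({} :: (bool \<times> nat) set)" using False by auto
  show ?thesis
  proof (subst indep_vars_finite[where E = "\<lambda>_. sets borel", OF ne])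
    show "\<forall>A\<in>(UNIV :: bool set) \<times> {..<n} \<rightarrow> sets borel. prob (\<Inter>j\<in>UNIV \<times> {..<n}. (\<lambda>\<omega>. f (fst j) (snd j) (X (fst j) \<omega>)) -` A j \<inter> space M) =
      (\<Prod>j\<in>UNIV \<times> {..<n}. prob ((\<lambda>\<omega>. f (fst j) (snd j) (X (fst j) \<omega>)) -` A j \<inter> space M))"
    proof
      fix A assume A: "A \<in> (UNIV :: bool set) \<times> {..<n} \<rightarrow> sets (borel :: real measure)"
      define C where "C b = {x \<in> space S. \<forall>i\<in>{..<n}. f b i x \<in> A (b, i)}" for b
      have C: "C b \<in> sets S" for b
        unfolding C_def
      proof (rule sets.sets_Collect_finite_All)
        fix i assume "i \<in> {..<n}"
        then have "f b i -` A (b, i) \<inter> space S \<in> sets S" using A by (intro measurable_sets[OF f]) auto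
        also have "f b i -` A (b, i) \<inter> space S = {x \<in> space S. f b i x \<in> A (b, i)}" by auto
        finally show "{x \<in> space S. f b i x \<in> A (b, i)} \<in> sets S" .
      qed simp
      have each: "prob (X b -` C b \<inter> space M) = (\<Prod>i<n. prob ((\<lambda>\<omega>. f b i (X b \<omega>)) -` A (b, i) \<inter> space M))" for b
      proof -
        have "X b -` C b \<inter> space M = (\<Inter>i\<in>{..<n}. (\<lambda>\<omega>. f b i (X b \<omega>)) -` A (b, i) \<inter> space M)"
          using False measurable_space[OF X[of b]] by (auto simp: C_def)
        also have "prob \<dots> = (\<Prod>i<n. prob ((\<lambda>\<omega>. f b i (X b \<omega>)) -` A (b, i) \<inter> space M))"
          by (rule indep_varsD_finite[OF ind]) (use False A in auto)
        finally show ?thesis .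
      qed
      have "(\<Inter>j\<in>UNIV \<times> {..<n}. (\<lambda>\<omega>. f (fst j) (snd j) (X (fst j) \<omega>)) -` A j \<inter> space M) =
        (\<lambda>\<omega>. (X True \<omega>, X False \<omega>)) -` (C True \<times> C False) \<inter> space M"
      proof (rule Set.set_eqI)
        fix \<omega>
        have "\<omega> \<in> (\<Inter>j\<in>UNIV \<times> {..<n}. (\<lambda>\<omega>. f (fst j) (snd j) (X (fst j) \<omega>)) -` A j \<inter> space M) \<longleftrightarrow>
          \<omega> \<in> space M \<and> (\<forall>b. \<forall>i\<in>{..<n}. f b i (X b \<omega>) \<in> A (b, i))" (is "?L \<longleftrightarrow> _")
        proof
          assume L: ?L
          have "(True, 0) \<in> UNIV \<times> {..<n}" using False by simp
          with L have "\<omega> \<in> space M" by blast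
          moreover have "f b i (X b \<omega>) \<in> A (b, i)" if "i \<in> {..<n}" for b i
          proof -
            have "(b, i) \<in> UNIV \<times> {..<n}" using that by simp
            then have "\<omega> \<in> (\<lambda>\<omega>. f (fst (b, i)) (snd (b, i)) (X (fst (b, i)) \<omega>)) -` A (b, i)" using L by blast
            then show ?thesis by simp
          qed
          ultimately show "\<omega> \<in> space M \<and> (\<forall>b. \<forall>i\<in>{..<n}. f b i (X b \<omega>) \<in> A (b, i))" by blast
        qed auto
        also have "\<dots> \<longleftrightarrow> \<omega> \<in> space M \<and> (\<forall>b. X b \<omega> \<in> C b)"
          unfolding C_def using measurable_space[OF X] by blast
        also have "\<dots> \<longleftrightarrow> \<omega> \<in> (\<lambda>\<omega>. (X True \<omega>, X False \<omega>)) -` (C True \<times> C False) \<inter> space M"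
          by (auto simp: all_bool_eq)
        finally show "?L \<longleftrightarrow> \<omega> \<in> (\<lambda>\<omega>. (X True \<omega>, X False \<omega>)) -` (C True \<times> C False) \<inter> space M" .
      qed
      also have "prob \<dots> = prob (X True -` C True \<inter> space M) * prob (X False -` C False \<inter> space M)"
        by (rule indep_varD[OF iv C C])
      also have "\<dots> = (\<Prod>b\<in>UNIV. \<Prod>i<n. prob ((\<lambda>\<omega>. f b i (X b \<omega>)) -` A (b, i) \<inter> space M))"
        by (simp add: each UNIV_bool)
      also have "\<dots> = (\<Prod>j\<in>UNIV \<times> {..<n}. prob ((\<lambda>\<omega>. f (fst j) (snd j) (X (fst j) \<omega>)) -` A j \<inter> space M))"
        by (simp add: prod.cartesian_product split_def)
      finally show "prob (\<Inter>j\<in>UNIV \<times> {..<n}. (\<lambda>\<omega>. f (fst j) (snd j) (X (fst j) \<omega>)) -` A j \<inter> space M) =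
        (\<Prod>j\<in>UNIV \<times> {..<n}. prob ((\<lambda>\<omega>. f (fst j) (snd j) (X (fst j) \<omega>)) -` A j \<inter> space M))" .
    qed
  qed (use rv in \<open>auto simp: sets.sigma_sets_eq[of borel, simplified] Int_stable_def\<close>)
qed

text \<open>Convergence to zero places a point, for every j, in the event that |Y n| < 1 / (j + 1)
  from some index on. That event has probability at most C / (j + 1), because any single index
  already gives this bound.\<close>

lemma (in prob_space) AE_not_tendsto_zero:
  fixes Y :: "nat \<Rightarrow> 'a \<Rightarrow> real"
  assumes Y: "\<And>n. n \<ge> n0 \<Longrightarrow> random_variable borel (Y n)"
    and le: "\<And>n e. n \<ge> n0 \<Longrightarrow> e > 0 \<Longrightarrow> prob {\<omega>\<in>space M. \<bar>Y n \<omega>\<bar> < e} \<le> C * e"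
  shows "AE \<omega> in M. \<not> (\<lambda>n. Y n \<omega>) \<longlonglongrightarrow> 0"
proof -
  define A where "A e m = (\<Inter>n\<in>{m..}. {\<omega>\<in>space M. \<bar>Y (n + n0) \<omega>\<bar> < e})" for e m
  have s: "{\<omega>\<in>space M. \<bar>Y (n + n0) \<omega>\<bar> < e} \<in> events" for n e
    using Y[of "n + n0"] by measurable
  have A: "A e m \<in> events" for e m
    unfolding A_def by (rule sets.countable_INT') (use s in auto)
  have le': "prob (\<Union>m. A e m) \<le> C * e" if e: "e > 0" for e
  proof -
    have "(\<lambda>m. prob (A e m)) \<longlonglongrightarrow> prob (\<Union>m. A e m)"
      by (rule finite_Lim_measure_incseq) (use A in \<open>auto simp: incseq_def A_def\<close>)
    moreover have "prob (A e m) \<le> C * e" for m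
    proof -
      have "prob (A e m) \<le> prob {\<omega>\<in>space M. \<bar>Y (m + n0) \<omega>\<bar> < e}"
        by (rule finite_measure_mono[OF _ s]) (auto simp: A_def)
      then show ?thesis using le[of "m + n0" e] e by simp
    qed
    ultimately show ?thesis by (intro LIMSEQ_le_const2) auto
  qed
  define T where "T = (\<Inter>j::nat. \<Union>m. A (1 / real (Suc j)) m)"
  have T: "T \<in> events" unfolding T_def using A by (intro sets.countable_INT') auto
  have "prob T = 0"
  proof -
    have "prob T \<le> C * (1 / real (Suc j))" for j
    proof -
      have "prob T \<le> prob (\<Union>m. A (1 / real (Suc j)) m)"
        by (rule finite_measure_mono) (use A in \<open>auto simp: T_def\<close>)
      also have "\<dots> \<le> C * (1 / real (Suc j))" by (rule le') simp
      finally show ?thesis .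
    qed
    moreover have "(\<lambda>j. C * (1 / real (Suc j))) \<longlonglongrightarrow> C * 0"
      by (intro tendsto_intros LIMSEQ_Suc[OF lim_1_over_n])
    ultimately have "prob T \<le> 0" by (intro LIMSEQ_le_const) auto
    then show ?thesis by (simp add: measure_le_0_iff)
  qed
  then have "AE \<omega> in M. \<omega> \<notin> T" using T by (simp add: prob_eq_0)
  then show ?thesis
  proof (rule AE_mp, intro AE_I2 impI notI)
    fix \<omega> assume w: "\<omega> \<in> space M" "\<omega> \<notin> T" and lim: "(\<lambda>n. Y n \<omega>) \<longlonglongrightarrow> 0"
    have "\<omega> \<in> (\<Union>m. A (1 / real (Suc j)) m)" for j
    proof -
      have "eventually (\<lambda>n. \<bar>Y (n + n0) \<omega>\<bar> < 1 / real (Suc j)) sequentially"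
        using LIMSEQ_ignore_initial_segment[OF lim, of n0, THEN tendsto_rabs] by (intro order_tendstoD(2)) auto
      then show ?thesis using w by (auto simp: A_def eventually_sequentially)
    qed
    then show False using w by (auto simp: T_def)
  qed
qed

text \<open>Given V = v, the event confines G to an interval of length e, and the density of G is at
  most 1 / s; it remains to integrate over the law of V.\<close>

lemma (in prob_space) normal_anticoncentration:
  assumes iv: "indep_var borel V borel G" and d: "distributed M lborel G (normal_density 0 s)"
    and s: "s > 0" and e: "e > 0"
  shows "prob {\<omega>\<in>space M. \<bar>V \<omega> + 2 * G \<omega>\<bar> < e} \<le> 1 / s * e"
proof -
  have V[measurable]: "random_variable borel V" and G[measurable]: "random_variable borel G"
    using indep_var_rv1[OF iv] indep_var_rv2[OF iv] .
  define A where "A = {x :: real \<times> real. \<bar>fst x + 2 * snd x\<bar> < e}"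
  have A: "A \<in> sets (borel \<Otimes>\<^sub>M borel)" unfolding A_def borel_prod
    by (intro borel_open open_Collect_less continuous_intros)
  have dist: "distr M borel V \<Otimes>\<^sub>M distr M borel G = distr M (borel \<Otimes>\<^sub>M borel) (\<lambda>x. (V x, G x))"
    using iv by (simp add: indep_var_distribution_eq)
  interpret G: prob_space "distr M borel G" by (rule prob_space_distr) measurable
  interpret V: prob_space "distr M borel V" by (rule prob_space_distr) measurable
  have dG: "distr M borel G = density lborel (normal_density 0 s)"
    using distributed_distr_eq_density[OF d] by (metis distr_cong sets_lborel)
  have "emeasure M {\<omega>\<in>space M. \<bar>V \<omega> + 2 * G \<omega>\<bar> < e} = emeasure (distr M (borel \<Otimes>\<^sub>M borel) (\<lambda>x. (V x, G x))) A"
    by (subst emeasure_distr[OF _ A]) (auto simp: A_def intro!: arg_cong[where f = "emeasure M"])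
  also have "\<dots> = (\<integral>\<^sup>+ v. emeasure (distr M borel G) (Pair v -` A) \<partial>distr M borel V)"
    unfolding dist[symmetric] by (rule G.emeasure_pair_measure_alt) (use A in \<open>simp cong: sets_pair_measure_cong\<close>)
  also have "\<dots> \<le> (\<integral>\<^sup>+ v. ennreal (1 / s * e) \<partial>distr M borel V)"
  proof (rule nn_integral_mono)
    fix v
    have eq: "Pair v -` A = {(- v - e) / 2 <..< (- v + e) / 2}" by (auto simp: A_def abs_less_iff field_simps)
    have dens: "normal_density 0 s x \<le> 1 / s" for x
    proof -
      have "normal_density 0 s x \<le> 1 / sqrt (2 * pi * s\<^sup>2) * 1"
        unfolding normal_density_def by (intro mult_left_mono) auto
      also have "\<dots> \<le> 1 / s"
      proof -
        have "s = sqrt (s\<^sup>2)" using s by simp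
        also have "\<dots> \<le> sqrt (2 * pi * s\<^sup>2)"
          using pi_gt3 mult_right_mono[of 1 "2 * pi" "s\<^sup>2"] by (intro real_sqrt_le_mono) simp
        finally show ?thesis using s by (simp add: frac_le)
      qed
      finally show ?thesis .
    qed
    have "emeasure (distr M borel G) (Pair v -` A) = (\<integral>\<^sup>+ x. ennreal (normal_density 0 s x) * indicator {(- v - e) / 2 <..< (- v + e) / 2} x \<partial>lborel)"
      unfolding dG eq by (subst emeasure_density) auto
    also have "\<dots> \<le> (\<integral>\<^sup>+ x. ennreal (1 / s) * indicator {(- v - e) / 2 <..< (- v + e) / 2} x \<partial>lborel)"
      by (intro nn_integral_mono mult_right_mono ennreal_leI dens) auto
    also have "\<dots> = ennreal (1 / s) * emeasure lborel {(- v - e) / 2 <..< (- v + e) / 2}"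
      by (subst nn_integral_cmult_indicator) auto
    also have "\<dots> = ennreal (1 / s * e)"
      using e s by (simp add: field_simps ennreal_mult[symmetric])
    finally show "emeasure (distr M borel G) (Pair v -` A) \<le> ennreal (1 / s * e)" .
  qed
  also have "\<dots> = ennreal (1 / s * e)" using V.emeasure_space_1 by simp
  finally show ?thesis using e s by (simp add: emeasure_eq_measure)
qed

section \<open>Two-sided Brownian motion with drift\<close>

text \<open>Both sides form one family indexed by a boolean, \<open>True\<close> for positive times.
  Independence is recorded for increments over equidistant grids, jointly over both sides, which is
  the form in which the later arguments use it.\<close>

locale two_sided_bm = prob_space N for N :: "'b measure" +
  fixes B :: "bool \<Rightarrow> real \<Rightarrow> 'b \<Rightarrow> real"
  assumes meas: "\<And>b t. t \<ge> 0 \<Longrightarrow> random_variable borel (B b t)"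
    and start: "\<And>b. AE \<omega> in N. B b 0 \<omega> = 0"
    and cont: "\<And>b. AE \<omega> in N. continuous_on {0..} (\<lambda>t. B b t \<omega>)"
    and incr_normal: "\<And>b u v. 0 \<le> u \<Longrightarrow> u < v \<Longrightarrow>
      distributed N lborel (\<lambda>\<omega>. B b v \<omega> - B b u \<omega>) (normal_density 0 (sqrt (v - u)))"
    and incr_indep: "\<And>h n. h > 0 \<Longrightarrow> indep_vars (\<lambda>_. borel)
      (\<lambda>j \<omega>. B (fst j) (real (Suc (snd j)) * h) \<omega> - B (fst j) (real (snd j) * h) \<omega>) (UNIV \<times> {..<n})"

lemma two_sided_brownian_motion_imp_bm:
  assumes "two_sided_brownian_motion N W"
  shows "\<exists>B. two_sided_bm N B \<and>
    (\<forall>\<omega>\<in>space N. \<forall>r. W r \<omega> = (if r > 0 then B True r \<omega> else if r < 0 then B False (- r) \<omega> else 0))"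
proof -
  obtain W1 W2 where bm: "brownian_motion N W1" "brownian_motion N W2"
    and iv: "prob_space.indep_var N
          (Pi\<^sub>M {0..} (\<lambda>_. borel)) (\<lambda>\<omega>. restrict (\<lambda>t. W1 t \<omega>) {0..})
          (Pi\<^sub>M {0..} (\<lambda>_. borel)) (\<lambda>\<omega>. restrict (\<lambda>t. W2 t \<omega>) {0..})"
    and W: "\<And>\<omega> r. \<omega> \<in> space N \<Longrightarrow> W r \<omega> =
           (if r > 0 then W1 r \<omega> else if r < 0 then W2 (- r) \<omega> else 0)"
    using assms unfolding two_sided_brownian_motion_def by blast
  define B where "B b = (if b then W1 else W2)" for b
  have bmB: "brownian_motion N (B b)" for b using bm by (simp add: B_def)
  interpret prob_space N using bm by (simp add: brownian_motion_def)
  let ?S = "PiM {0::real..} (\<lambda>_. borel :: real measure)"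
  have "two_sided_bm N B"
  proof
    show "random_variable borel (B b t)" if "t \<ge> 0" for b t
      using bmB[of b] that by (simp add: brownian_motion_def)
    show "AE \<omega> in N. B b 0 \<omega> = 0" for b using bmB[of b] by (simp add: brownian_motion_def)
    show "AE \<omega> in N. continuous_on {0..} (\<lambda>t. B b t \<omega>)" for b using bmB[of b] by (simp add: brownian_motion_def)
    show "distributed N lborel (\<lambda>\<omega>. B b v \<omega> - B b u \<omega>) (normal_density 0 (sqrt (v - u)))"
      if "0 \<le> u" "u < v" for b u v
      using bmB[of b] that by (simp add: brownian_motion_def)
    fix h :: real and n :: nat assume h: "h > 0"
    define X where "X b \<omega> = restrict (\<lambda>t. B b t \<omega>) {0..}" for b \<omega>
    \<comment> \<open>Grid increments are measurable functionals of the restricted paths, and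
      independence of the two sides is given in terms of these paths.\<close>
    define f where "f i x = (x (real (Suc i) * h) - x (real i * h) :: real)" for i :: nat and x
    have fX: "f i (X b \<omega>) = B b (real (Suc i) * h) \<omega> - B b (real i * h) \<omega>" for i b \<omega>
      using h by (simp add: f_def X_def)
    have "indep_vars (\<lambda>_. borel) (\<lambda>j \<omega>. f (snd j) (X (fst j) \<omega>)) (UNIV \<times> {..<n})"
    proof (rule indep_vars_two_processes[of ?S X "\<lambda>b i. f i"])
      show "indep_var ?S (X True) ?S (X False)"
        using iv unfolding X_def[abs_def] B_def by simp
      show "f i \<in> borel_measurable ?S" for i
        unfolding f_def using h by (intro borel_measurable_diff measurable_component_singleton) auto
      show "indep_vars (\<lambda>_. borel) (\<lambda>i \<omega>. f i (X b \<omega>)) {..<n}" for b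
      proof -
        have "\<forall>n (ts :: nat \<Rightarrow> real). 0 \<le> ts 0 \<and> (\<forall>i<n. ts i < ts (Suc i)) \<longrightarrow>
          indep_vars (\<lambda>_. borel) (\<lambda>i \<omega>. B b (ts (Suc i)) \<omega> - B b (ts i) \<omega>) {..<n}"
          using bmB[of b] unfolding brownian_motion_def by (elim conjE)
        from this[rule_format, of "\<lambda>i. real i * h" n] show ?thesis
          using h by (simp only: fX) simp
      qed
    qed
    then show "indep_vars (\<lambda>_. borel)
      (\<lambda>j \<omega>. B (fst j) (real (Suc (snd j)) * h) \<omega> - B (fst j) (real (snd j) * h) \<omega>) (UNIV \<times> {..<n})"
      by (simp only: fX)
  qed
  moreover have "\<forall>\<omega>\<in>space N. \<forall>r. W r \<omega> = (if r > 0 then B True r \<omega> else if r < 0 then B False (- r) \<omega> else 0)"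
    using W by (simp add: B_def)
  ultimately show ?thesis by blast
qed

context two_sided_bm
begin

definition incr :: "nat \<Rightarrow> bool \<times> nat \<Rightarrow> 'b \<Rightarrow> real" where
  "incr n j \<omega> = B (fst j) (real (Suc (snd j)) / 2 ^ n) \<omega> - B (fst j) (real (snd j) / 2 ^ n) \<omega>"

definition drifted :: "bool \<Rightarrow> real \<Rightarrow> 'b \<Rightarrow> real" where
  "drifted b r \<omega> = r - 2 * B b r \<omega>"

lemma incr_indep_dyadic: "indep_vars (\<lambda>_. borel) (incr n) (UNIV \<times> {..<m})"
  using incr_indep[of "1 / 2 ^ n" m] by (simp add: incr_def[abs_def])

lemma incr_measurable: "random_variable borel (incr n j)"
  unfolding incr_def using meas by (intro borel_measurable_diff) auto

lemma incr_distributed: "distributed N lborel (incr n j) (normal_density 0 (sqrt (1 / 2 ^ n)))"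
  using incr_normal[of "real (snd j) / 2 ^ n" "real (Suc (snd j)) / 2 ^ n" "fst j"]
  by (simp add: incr_def[abs_def] divide_strict_right_mono add_divide_distrib)

lemma sum_incr:
  assumes "c \<le> d"
  shows "(\<Sum>l\<in>{c..<d}. incr n (b, l) \<omega>) = B b (real d / 2 ^ n) \<omega> - B b (real c / 2 ^ n) \<omega>"
  using sum_Suc_diff'[OF assms, of "\<lambda>l. B b (real l / 2 ^ n) \<omega>"] by (simp add: incr_def)

lemma walk_incr: "(\<Sum>l<d. incr n (b, l) \<omega>) = B b (real d / 2 ^ n) \<omega> - B b 0 \<omega>"
  using sum_incr[of 0 d n b \<omega>] by (simp add: lessThan_atLeast0)

text \<open>At grid level k the line has slope 1 / (4 2^k) per step, the increments have variance 1
  / 2^k and the starting index is R 2^k, so the peeling bound equals 1024 / R at every level. Nested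
  grids make the events increase with k; the bound therefore holds for all dyadic times together,
  and continuity extends the estimate to all real times.\<close>

lemma AE_sublinear: "AE \<omega> in N. \<exists>R. \<forall>r\<ge>R. r \<ge> 0 \<longrightarrow> \<bar>B b r \<omega>\<bar> \<le> r / 4"
proof -
  define E where "E R k = {\<omega>\<in>space N. \<exists>m\<le>k * 2 ^ k. real R * 2 ^ k \<le> real m \<and>
    1 / (4 * 2 ^ k) * real m \<le> \<bar>B b (real m / 2 ^ k) \<omega> - B b 0 \<omega>\<bar>}" for R k :: nat
  have mE: "E R k \<in> events" for R k
    unfolding E_def using meas by (intro sets.sets_Collect_countable_Ex sets.sets_Collect_conj
      borel_measurable_le borel_measurable_abs borel_measurable_diff) auto
  have pE: "prob (E R k) \<le> 1024 / real R" if R: "R \<ge> 1" for R k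
  proof -
    have *: "prob {\<omega>\<in>space N. \<exists>m\<le>k * 2 ^ k. real R * 2 ^ k \<le> real m \<and>
        1 / (4 * 2 ^ k) * real m \<le> \<bar>\<Sum>i<m. incr k (b, i) \<omega>\<bar>}
      \<le> 64 * (sqrt (1 / 2 ^ k))\<^sup>2 / ((1 / (4 * 2 ^ k))\<^sup>2 * (real R * 2 ^ k))"
    proof (rule subgaussian_walk_below_line)
      show "indep_vars (\<lambda>_. borel) (\<lambda>i. incr k (b, i)) {..<k * 2 ^ k}"
        by (rule indep_vars_inj_reindex[OF incr_indep_dyadic[of k "k * 2 ^ k"]]) (auto simp: inj_on_def)
      show "subgaussian N (sqrt (1 / 2 ^ k)) (incr k (b, i))" for i
        by (rule subgaussian_normal[OF incr_distributed]) simp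
      show "1 \<le> real R * 2 ^ k" using R mult_mono[of 1 "real R" 1 "2 ^ k"] by simp
    qed auto
    also have "64 * (sqrt (1 / 2 ^ k))\<^sup>2 / ((1 / (4 * 2 ^ k))\<^sup>2 * (real R * 2 ^ k)) = 1024 / real R"
      by (simp add: field_simps power2_eq_square)
    finally show ?thesis unfolding E_def walk_incr .
  qed
  have incE: "incseq (E R)" for R
  proof (rule incseq_SucI, rule subsetI)
    fix k \<omega> assume "\<omega> \<in> E R k"
    then obtain m where m: "m \<le> k * 2 ^ k" "real R * 2 ^ k \<le> real m"
      "1 / (4 * 2 ^ k) * real m \<le> \<bar>B b (real m / 2 ^ k) \<omega> - B b 0 \<omega>\<bar>" "\<omega> \<in> space N"
      by (auto simp: E_def)
    \<comment> \<open>The time m / 2^k is the point with index 2m of the next grid.\<close>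
    have "2 * m \<le> Suc k * 2 ^ Suc k" using m(1) by (simp add: algebra_simps)
    moreover have "real R * 2 ^ Suc k \<le> real (2 * m)" using m(2) by simp
    moreover have "1 / (4 * 2 ^ Suc k) * real (2 * m) \<le> \<bar>B b (real (2 * m) / 2 ^ Suc k) \<omega> - B b 0 \<omega>\<bar>"
      using m(3) by simp
    ultimately show "\<omega> \<in> E R (Suc k)" using m(4) unfolding E_def by blast
  qed
  have pU: "prob (\<Union>k. E R k) \<le> 1024 / real R" if "R \<ge> 1" for R
  proof (rule LIMSEQ_le_const2)
    show "(\<lambda>k. prob (E R k)) \<longlonglongrightarrow> prob (\<Union>k. E R k)"
      by (rule finite_Lim_measure_incseq) (use mE incE in auto)
  qed (use pE that in auto)
  define T where "T = (\<Inter>R\<in>{1..}. \<Union>k. E R k)"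
  have T: "T \<in> events" unfolding T_def using mE by (intro sets.countable_INT') auto
  have "prob T = 0"
  proof -
    have "prob T \<le> 1024 / real (Suc j)" for j
    proof -
      have "prob T \<le> prob (\<Union>k. E (Suc j) k)"
        by (rule finite_measure_mono) (use mE in \<open>auto simp: T_def\<close>)
      also have "\<dots> \<le> 1024 / real (Suc j)" by (rule pU) simp
      finally show ?thesis .
    qed
    moreover have "(\<lambda>j. 1024 * (1 / real (Suc j))) \<longlonglongrightarrow> 1024 * 0"
      by (intro tendsto_intros LIMSEQ_Suc[OF lim_1_over_n])
    ultimately have "prob T \<le> 0" by (intro LIMSEQ_le_const[of _ 0]) auto
    then show ?thesis by (simp add: measure_le_0_iff)
  qed
  then have "AE \<omega> in N. \<omega> \<notin> T" using T by (simp add: prob_eq_0)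
  moreover note start[of b] cont[of b] AE_space
  ultimately show ?thesis
  proof eventually_elim
    case (elim \<omega>)
    then obtain R where R: "\<And>k. \<omega> \<notin> E R k" by (auto simp: T_def)
    have "\<bar>B b r \<omega>\<bar> \<le> r / 4" if r: "r \<ge> real R" for r
    proof -
      have r0: "r \<ge> 0" using r by simp
      define q where "q k = real (nat \<lceil>r * 2 ^ k\<rceil>) / 2 ^ k" for k
      have q0: "q k \<ge> 0" for k unfolding q_def by (rule divide_nonneg_pos) simp_all
      have q: "q \<longlonglongrightarrow> r" unfolding q_def by (rule dyadic_ceiling_tendsto[OF r0])
      have "(\<lambda>k. B b (q k) \<omega>) \<longlonglongrightarrow> B b r \<omega>"
        by (rule continuous_on_tendsto_compose[OF elim(3) q]) (auto intro!: always_eventually r0 q0)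
      then have l1: "(\<lambda>k. \<bar>B b (q k) \<omega>\<bar>) \<longlonglongrightarrow> \<bar>B b r \<omega>\<bar>" by (rule tendsto_rabs)
      have l2: "(\<lambda>k. q k / 4) \<longlonglongrightarrow> r / 4" by (intro tendsto_intros q) simp
      show ?thesis
      proof (rule tendsto_le[OF _ l2 l1])
        show "\<forall>\<^sub>F k in sequentially. \<bar>B b (q k) \<omega>\<bar> \<le> q k / 4"
        proof (rule eventually_sequentiallyI[of "nat \<lceil>r\<rceil>"])
          fix k assume k: "nat \<lceil>r\<rceil> \<le> k"
          define m where "m = nat \<lceil>r * 2 ^ k\<rceil>"
          have rk: "r \<le> real k" using k by linarith
          have "r * 2 ^ k \<le> real (k * 2 ^ k)" using rk by simp
          then have 1: "m \<le> k * 2 ^ k" unfolding m_def by (simp only: nat_ceiling_le_eq)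
          have "r * 2 ^ k \<le> real m" unfolding m_def by (rule real_nat_ceiling_ge)
          moreover have "real R * 2 ^ k \<le> r * 2 ^ k" using r by simp
          ultimately have 2: "real R * 2 ^ k \<le> real m" by linarith
          have "\<not> 1 / (4 * 2 ^ k) * real m \<le> \<bar>B b (real m / 2 ^ k) \<omega> - B b 0 \<omega>\<bar>"
            using R[of k] 1 2 elim(4) unfolding E_def by blast
          then show "\<bar>B b (q k) \<omega>\<bar> \<le> q k / 4"
            using elim(2) by (simp add: q_def m_def field_simps)
        qed
      qed simp
    qed
    then show ?case by blast
  qed
qed

text \<open>Indexed by countable data, so that ties can be excluded for all dyadic intervals at
  once. On side b the point v lies beyond the interval and minimizes globally, while u attains the
  same value either before the interval or on the other side.\<close>

definition tied :: "bool \<Rightarrow> nat \<Rightarrow> nat \<Rightarrow> 'b \<Rightarrow> bool" where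
  "tied b k i \<omega> \<longleftrightarrow> (\<exists>b' u v. 0 \<le> u \<and> (b' = b \<longrightarrow> u \<le> real i / 2 ^ k) \<and> real (Suc i) / 2 ^ k \<le> v \<and>
     drifted b' u \<omega> = drifted b v \<omega> \<and> (\<forall>b'' r. r \<ge> 0 \<longrightarrow> drifted b v \<omega> \<le> drifted b'' r \<omega>))"

text \<open>A tie between the minimum over one side of a dyadic interval and the minimum over the other side
  would make an independent Gaussian increment hit a value determined by the rest of the path.\<close>

lemma AE_not_tied: "AE \<omega> in N. \<not> tied b k i \<omega>"
proof -
  \<comment> \<open>The endpoints of the fixed interval as indices of the finer grid at level
    n.\<close>
  define c d where "c n = i * 2 ^ (n - k)" and "d n = Suc i * 2 ^ (n - k)" for n :: nat
  have cd: "c n < d n" for n by (simp add: c_def d_def)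
  have ceq: "real (c n) / 2 ^ n = real i / 2 ^ k" and deq: "real (d n) / 2 ^ n = real (Suc i) / 2 ^ k" if "n \<ge> k" for n
    using that by (auto simp: c_def d_def le_iff_add power_add field_simps)
  \<comment> \<open>From \<open>n0\<close> on the grid refines level k and its horizon n contains
    the interval.\<close>
  define n0 where "n0 = k + Suc i"
  have dle: "d n \<le> n * 2 ^ n" if "n \<ge> n0" for n
    unfolding d_def using that by (intro mult_mono power_increasing) (auto simp: n0_def)
  define L where "L n = {j \<in> UNIV \<times> {..n * 2 ^ n}. fst j = b \<longrightarrow> snd j \<le> c n}" for n
  define Rt where "Rt n = {d n..n * 2 ^ n}" for n
  define Blk where "Blk n = {b} \<times> {c n..<d n}" for n
  define I where "I n = (UNIV :: bool set) \<times> {..<n * 2 ^ n}" for n :: nat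
  have finL: "finite (L n)" for n by (simp add: L_def)
  have L0: "(b, 0) \<in> L n" for n by (simp add: L_def)
  have finR: "finite (Rt n)" for n by (simp add: Rt_def)
  have R0: "Rt n \<noteq> {}" if "n \<ge> n0" for n using dle[OF that] by (simp add: Rt_def)
  \<comment> \<open>The minimum over \<open>L\<close> minus the minimum over \<open>Rt\<close>, with
    the increments inside the interval left out of the paths in \<open>Rt\<close>. Every index in
    \<open>Rt\<close> is at least \<open>d n\<close>, so exactly the sum \<open>G\<close> is left
    out each time: \<open>V + 2 * G\<close> is the true difference of the two minima, while
    \<open>V\<close> itself does not see the block.\<close>
  define V where "V n x = Min ((\<lambda>j. real (snd j) / 2 ^ n - 2 * (\<Sum>l<snd j. x (fst j, l))) ` L n) -
    Min ((\<lambda>j. real j / 2 ^ n - 2 * (\<Sum>l\<in>{..<j} - {c n..<d n}. x (b, l))) ` Rt n)" for n and x :: "bool \<times> nat \<Rightarrow> real"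
  define G where "G n x = (\<Sum>l\<in>{c n..<d n}. x (b, l))" for n and x :: "bool \<times> nat \<Rightarrow> real"
  define Y where "Y n \<omega> = V n (\<lambda>j. incr n j \<omega>) + 2 * G n (\<lambda>j. incr n j \<omega>)" for n \<omega>
  have G: "G n (\<lambda>j. incr n j \<omega>) = B b (real (Suc i) / 2 ^ k) \<omega> - B b (real i / 2 ^ k) \<omega>" if "n \<ge> k" for n \<omega>
    unfolding G_def sum_incr[OF less_imp_le[OF cd]] ceq[OF that] deq[OF that] ..
  have iv: "indep_var borel (\<lambda>\<omega>. V n (\<lambda>j. incr n j \<omega>)) borel (\<lambda>\<omega>. G n (\<lambda>j. incr n j \<omega>))" if n: "n \<ge> n0" for n
  proof -
    let ?P = "\<lambda>A. PiM A (\<lambda>_. borel :: real measure)"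
    have sub: "Blk n \<subseteq> I n" using dle[OF n] by (auto simp: Blk_def I_def)
    have 1: "indep_var (?P (I n - Blk n)) (\<lambda>\<omega>. restrict (\<lambda>j. incr n j \<omega>) (I n - Blk n)) (?P (Blk n)) (\<lambda>\<omega>. restrict (\<lambda>j. incr n j \<omega>) (Blk n))"
      by (rule indep_var_restrict[OF incr_indep_dyadic[of n "n * 2 ^ n"]]) (use sub in \<open>auto simp: I_def\<close>)
    have inL: "(fst j, l) \<in> I n - Blk n" if "j \<in> L n" "l \<in> {..<snd j}" for j l
      using that by (auto simp: L_def I_def Blk_def)
    have inR: "(b, l) \<in> I n - Blk n" if "j \<in> Rt n" "l \<in> {..<j} - {c n..<d n}" for j l
      using that by (auto simp: Rt_def I_def Blk_def)
    have mV: "V n \<in> borel_measurable (?P (I n - Blk n))"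
      unfolding V_def by (intro borel_measurable_diff borel_measurable_Min finL finR borel_measurable_times borel_measurable_const
        borel_measurable_sum measurable_component_singleton) (erule (1) inL | erule (1) inR)+
    have mG: "G n \<in> borel_measurable (?P (Blk n))"
      unfolding G_def by (intro borel_measurable_sum measurable_component_singleton) (auto simp: Blk_def)
    have eqV: "V n (restrict (\<lambda>j. incr n j \<omega>) (I n - Blk n)) = V n (\<lambda>j. incr n j \<omega>)" for \<omega>
      unfolding V_def using inL inR
      by (intro arg_cong2[where f = "(-)"] arg_cong[where f = Min] image_cong refl arg_cong2[where f = "(*)"] sum.cong) (auto simp del: Diff_iff)
    have eqG: "G n (restrict (\<lambda>j. incr n j \<omega>) (Blk n)) = G n (\<lambda>j. incr n j \<omega>)" for \<omega>
      unfolding G_def by (intro sum.cong) (auto simp: Blk_def)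
    show ?thesis using indep_var_compose[OF 1 mV mG] by (simp add: comp_def eqV eqG)
  qed
  \<comment> \<open>At every level from \<open>n0\<close> on, \<open>G\<close> is the increment over
    the same interval, of variance 1 / 2^k, so the anticoncentration bound is uniform in n.\<close>
  have "AE \<omega> in N. \<not> (\<lambda>n. Y n \<omega>) \<longlonglongrightarrow> 0"
  proof (rule AE_not_tendsto_zero)
    fix n assume n: "n \<ge> n0"
    then have nk: "n \<ge> k" by (simp add: n0_def)
    show "random_variable borel (Y n)"
      unfolding Y_def using indep_var_rv1[OF iv[OF n]] indep_var_rv2[OF iv[OF n]] by measurable
    fix e :: real assume e: "e > 0"
    show "prob {\<omega>\<in>space N. \<bar>Y n \<omega>\<bar> < e} \<le> 1 / sqrt (1 / 2 ^ k) * e"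
      unfolding Y_def
    proof (rule normal_anticoncentration[OF iv[OF n] _ _ e])
      have "real (Suc i) / 2 ^ k - real i / 2 ^ k = 1 / 2 ^ k" by (simp add: field_simps)
      then show "distributed N lborel (\<lambda>\<omega>. G n (\<lambda>j. incr n j \<omega>)) (normal_density 0 (sqrt (1 / 2 ^ k)))"
        unfolding G[OF nk] using incr_normal[of "real i / 2 ^ k" "real (Suc i) / 2 ^ k" b]
        by (simp add: divide_strict_right_mono)
    qed simp
  qed
  moreover have "AE \<omega> in N. \<forall>b. B b 0 \<omega> = 0 \<and> continuous_on {0..} (\<lambda>t. B b t \<omega>)"
    using start cont by (simp add: AE_all_countable)
  ultimately show ?thesis
  proof eventually_elim
    case (elim \<omega>)
    have dr: "drifted b' (real j / 2 ^ n) \<omega> = real j / 2 ^ n - 2 * (\<Sum>l<j. incr n (b', l) \<omega>)" for b' j n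
      using elim(2) by (simp add: drifted_def walk_incr)
    show ?case
    proof
      assume "tied b k i \<omega>"
      then obtain b' u v where u: "0 \<le> u" "b' = b \<Longrightarrow> u \<le> real i / 2 ^ k" and v: "real (Suc i) / 2 ^ k \<le> v"
        and eq: "drifted b' u \<omega> = drifted b v \<omega>" and mn: "\<And>b'' r. r \<ge> 0 \<Longrightarrow> drifted b v \<omega> \<le> drifted b'' r \<omega>"
        unfolding tied_def by blast
      define z where "z = drifted b v \<omega>"
      have v0: "v \<ge> 0" using v by (rule order_trans[rotated]) simp
      define U where "U n = Min ((\<lambda>j. drifted (fst j) (real (snd j) / 2 ^ n) \<omega>) ` L n)" for n
      define H where "H n = Min ((\<lambda>j. drifted b (real j / 2 ^ n) \<omega>) ` Rt n)" for n
      have dcont: "(\<lambda>n. drifted b'' (q n) \<omega>) \<longlonglongrightarrow> drifted b'' r \<omega>"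
        if "q \<longlonglongrightarrow> r" "r \<ge> 0" "\<And>n. q n \<ge> 0" for b'' q r
        unfolding drifted_def using elim(2) that
        by (intro tendsto_intros continuous_on_tendsto_compose[of "{0..}" "\<lambda>t. B b'' t \<omega>"]) auto
      have YU: "Y n \<omega> = U n - H n" if n: "n \<ge> n0" for n
      proof -
        have "U n = Min ((\<lambda>j. real (snd j) / 2 ^ n - 2 * (\<Sum>l<snd j. incr n (fst j, l) \<omega>)) ` L n)"
          unfolding U_def dr ..
        moreover have "Min ((\<lambda>j. real j / 2 ^ n - 2 * (\<Sum>l\<in>{..<j} - {c n..<d n}. incr n (b, l) \<omega>)) ` Rt n) = H n + 2 * G n (\<lambda>j. incr n j \<omega>)"
        proof -
          have "real j / 2 ^ n - 2 * (\<Sum>l\<in>{..<j} - {c n..<d n}. incr n (b, l) \<omega>) = drifted b (real j / 2 ^ n) \<omega> + 2 * G n (\<lambda>j. incr n j \<omega>)"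
            if "j \<in> Rt n" for j
          proof -
            have "(\<Sum>l\<in>{..<j} - {c n..<d n}. incr n (b, l) \<omega>) = (\<Sum>l<j. incr n (b, l) \<omega>) - (\<Sum>l\<in>{c n..<d n}. incr n (b, l) \<omega>)"
              using that by (intro sum_diff) (auto simp: Rt_def)
            then show ?thesis by (simp add: dr G_def)
          qed
          then have "(\<lambda>j. real j / 2 ^ n - 2 * (\<Sum>l\<in>{..<j} - {c n..<d n}. incr n (b, l) \<omega>)) ` Rt n = (\<lambda>j. drifted b (real j / 2 ^ n) \<omega> + 2 * G n (\<lambda>j. incr n j \<omega>)) ` Rt n"
            by (intro image_cong) auto
          then show ?thesis
            unfolding H_def using Min_add_commute[OF finR R0[OF n], of "\<lambda>j. drifted b (real j / 2 ^ n) \<omega>" "2 * G n (\<lambda>j. incr n j \<omega>)"] by simp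
        qed
        ultimately show ?thesis by (simp add: Y_def V_def)
      qed
      \<comment> \<open>Squeezed between the global minimum and the value at a grid point near u.
        Rounding down keeps that point on the near side of the interval; for \<open>H\<close> the
        point v is rounded up to stay beyond it.\<close>
      have Ulim: "U \<longlonglongrightarrow> z"
      proof (rule tendsto_sandwich[of "\<lambda>_. z" _ _ "\<lambda>n. drifted b' (real (nat \<lfloor>u * 2 ^ n\<rfloor>) / 2 ^ n) \<omega>"])
        show "\<forall>\<^sub>F n in sequentially. z \<le> U n"
          using finL L0 by (intro always_eventually allI) (auto simp: U_def z_def intro!: Min.boundedI mn)
        show "\<forall>\<^sub>F n in sequentially. U n \<le> drifted b' (real (nat \<lfloor>u * 2 ^ n\<rfloor>) / 2 ^ n) \<omega>"
        proof (rule eventually_sequentiallyI[of "max n0 (nat \<lceil>u\<rceil>)"])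
          fix n assume n: "max n0 (nat \<lceil>u\<rceil>) \<le> n"
          have "u \<le> real n" using n by linarith
          then have "u * 2 ^ n \<le> real (n * 2 ^ n)" by simp
          then have "nat \<lfloor>u * 2 ^ n\<rfloor> \<le> n * 2 ^ n" by linarith
          moreover have "nat \<lfloor>u * 2 ^ n\<rfloor> \<le> c n" if "b' = b"
          proof -
            have "u \<le> real (c n) / 2 ^ n" using u(2)[OF that] ceq[of n] n by (simp add: n0_def)
            then have "u * 2 ^ n \<le> real (c n)" by (simp add: field_simps)
            then show ?thesis by linarith
          qed
          ultimately have "(b', nat \<lfloor>u * 2 ^ n\<rfloor>) \<in> L n" by (auto simp: L_def)
          then show "U n \<le> drifted b' (real (nat \<lfloor>u * 2 ^ n\<rfloor>) / 2 ^ n) \<omega>"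
            unfolding U_def by (intro Min_le) (auto simp: finL intro!: image_eqI[of _ _ "(b', nat \<lfloor>u * 2 ^ n\<rfloor>)"])
        qed
        show "(\<lambda>n. drifted b' (real (nat \<lfloor>u * 2 ^ n\<rfloor>) / 2 ^ n) \<omega>) \<longlonglongrightarrow> z"
          unfolding z_def eq[symmetric] by (rule dcont[OF dyadic_floor_tendsto[OF u(1)] u(1)]) simp
      qed simp
      have Hlim: "H \<longlonglongrightarrow> z"
      proof (rule tendsto_sandwich[of "\<lambda>_. z" _ _ "\<lambda>n. drifted b (real (nat \<lceil>v * 2 ^ n\<rceil>) / 2 ^ n) \<omega>"])
        show "\<forall>\<^sub>F n in sequentially. z \<le> H n"
        proof (rule eventually_sequentiallyI[of n0])
          fix n assume n: "n0 \<le> n"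
          show "z \<le> H n" unfolding H_def z_def using finR R0[OF n] by (intro Min.boundedI) (auto intro!: mn)
        qed
        show "\<forall>\<^sub>F n in sequentially. H n \<le> drifted b (real (nat \<lceil>v * 2 ^ n\<rceil>) / 2 ^ n) \<omega>"
        proof (rule eventually_sequentiallyI[of "max n0 (nat \<lceil>v\<rceil>)"])
          fix n assume n: "max n0 (nat \<lceil>v\<rceil>) \<le> n"
          have "v \<le> real n" using n by linarith
          then have "v * 2 ^ n \<le> real (n * 2 ^ n)" by simp
          then have 1: "nat \<lceil>v * 2 ^ n\<rceil> \<le> n * 2 ^ n" by (simp only: nat_ceiling_le_eq)
          have "real (d n) / 2 ^ n \<le> v" using v deq[of n] n by (simp add: n0_def)
          then have "real (d n) \<le> v * 2 ^ n" by (simp add: field_simps)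
          then have "d n \<le> nat \<lceil>v * 2 ^ n\<rceil>" by linarith
          with 1 have "nat \<lceil>v * 2 ^ n\<rceil> \<in> Rt n" by (simp add: Rt_def)
          then show "H n \<le> drifted b (real (nat \<lceil>v * 2 ^ n\<rceil>) / 2 ^ n) \<omega>"
            unfolding H_def by (intro Min_le) (auto simp: finR)
        qed
        show "(\<lambda>n. drifted b (real (nat \<lceil>v * 2 ^ n\<rceil>) / 2 ^ n) \<omega>) \<longlonglongrightarrow> z"
          unfolding z_def by (rule dcont[OF dyadic_ceiling_tendsto[OF v0] v0]) simp
      qed simp
      have "(\<lambda>n. U n - H n) \<longlonglongrightarrow> z - z" by (intro tendsto_diff Ulim Hlim)
      moreover have "\<forall>\<^sub>F n in sequentially. Y n \<omega> = U n - H n"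
        using YU by (intro eventually_sequentiallyI[of n0]) auto
      ultimately have "(\<lambda>n. Y n \<omega>) \<longlonglongrightarrow> 0" by (simp add: tendsto_cong)
      then show False using elim(1) by simp
    qed
  qed
qed

section \<open>Existence, uniqueness and measurability of the minimizer\<close>

definition drifted_line :: "'b \<Rightarrow> real \<Rightarrow> real" where
  "drifted_line \<omega> r = drifted (r \<ge> 0) \<bar>r\<bar> \<omega>"

text \<open>Collects the almost sure properties, so that existence and uniqueness of the minimizer
  become purely pathwise statements.\<close>

definition regular_path :: "'b \<Rightarrow> bool" where
  "regular_path \<omega> \<longleftrightarrow> (\<forall>b. B b 0 \<omega> = 0 \<and> continuous_on {0..} (\<lambda>t. B b t \<omega>) \<and>
     (\<exists>R. \<forall>r\<ge>R. r \<ge> 0 \<longrightarrow> \<bar>B b r \<omega>\<bar> \<le> r / 4)) \<and> (\<forall>b k i. \<not> tied b k i \<omega>)"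

lemma AE_regular_path: "AE \<omega> in N. regular_path \<omega>"
  unfolding regular_path_def using start cont AE_sublinear AE_not_tied
  by (simp add: AE_all_countable)

text \<open>The two branches agree at 0 because both motions start there, so the origin may be
  described from either side.\<close>

lemma drifted_line_at:
  assumes "regular_path \<omega>" "u \<ge> 0"
  shows "drifted_line \<omega> (if b then u else - u) = drifted b u \<omega>"
  using assms by (cases "u = 0"; cases b) (auto simp: drifted_line_def drifted_def regular_path_def)

lemma continuous_drifted_line:
  assumes "regular_path \<omega>"
  shows "continuous_on UNIV (drifted_line \<omega>)"
proof -
  have c: "continuous_on {0..} (\<lambda>t. drifted b t \<omega>)" for b
    using assms unfolding drifted_def regular_path_def by (intro continuous_intros) auto
  have "continuous_on {0..} (drifted_line \<omega>)"
    by (rule continuous_on_eq[OF c[of True]]) (auto simp: drifted_line_def)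
  moreover have "continuous_on {..0} (drifted_line \<omega>)"
  proof (rule continuous_on_eq)
    show "continuous_on {..0} (\<lambda>t. drifted False (- t) \<omega>)"
      by (rule continuous_on_compose2[OF c[of False]]) (auto intro!: continuous_intros)
    fix x :: real assume "x \<in> {..0}"
    then show "drifted False (- x) \<omega> = drifted_line \<omega> x"
      using drifted_line_at[OF assms, of "- x" False] by simp
  qed
  ultimately have "continuous_on ({0..} \<union> {..0}) (drifted_line \<omega>)"
    by (intro continuous_on_closed_Un) auto
  moreover have "{0..} \<union> {..0} = (UNIV :: real set)" by auto
  ultimately show ?thesis by simp
qed

text \<open>Where |B| <= |r| / 4, the noise term 2 B takes at most half of the drift |r|.\<close>

lemma drifted_line_coercive:
  assumes "regular_path \<omega>"
  shows "\<exists>R\<ge>0. \<forall>r. \<bar>r\<bar> \<ge> R \<longrightarrow> drifted_line \<omega> r \<ge> \<bar>r\<bar> / 2"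
proof -
  obtain R where R: "\<And>b r. r \<ge> R b \<Longrightarrow> r \<ge> 0 \<Longrightarrow> \<bar>B b r \<omega>\<bar> \<le> r / 4"
    using assms unfolding regular_path_def by metis
  show ?thesis
  proof (intro exI[of _ "max 0 (max (R True) (R False))"] conjI allI impI)
    fix r :: real assume r: "max 0 (max (R True) (R False)) \<le> \<bar>r\<bar>"
    then have "R (r \<ge> 0) \<le> \<bar>r\<bar>" by (cases "r \<ge> 0") auto
    then have "\<bar>B (r \<ge> 0) \<bar>r\<bar> \<omega>\<bar> \<le> \<bar>r\<bar> / 4" by (rule R) simp
    then show "\<bar>r\<bar> / 2 \<le> drifted_line \<omega> r" unfolding drifted_line_def drifted_def by linarith
  qed simp
qed

lemma drifted_line_attains_inf:
  assumes p: "regular_path \<omega>" and S: "closed S" "y \<in> S"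
  shows "\<exists>x\<in>S. \<forall>z\<in>S. drifted_line \<omega> x \<le> drifted_line \<omega> z"
proof -
  obtain R where R: "\<And>r. \<bar>r\<bar> \<ge> R \<Longrightarrow> drifted_line \<omega> r \<ge> \<bar>r\<bar> / 2" using drifted_line_coercive[OF p] by blast
  \<comment> \<open>Outside [-m, m] the line is at least |z| / 2, hence at least its value at y; so
    the minimum over the compact part is the minimum over \<open>S\<close>.\<close>
  define m where "m = max R (max \<bar>y\<bar> (2 * \<bar>drifted_line \<omega> y\<bar>))"
  define K where "K = S \<inter> {- m..m}"
  have "compact K" unfolding K_def using S by (intro closed_Int_compact) auto
  moreover have yK: "y \<in> K" using S by (auto simp: K_def m_def)
  ultimately obtain x where x: "x \<in> K" "\<And>z. z \<in> K \<Longrightarrow> drifted_line \<omega> x \<le> drifted_line \<omega> z"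
    using continuous_attains_inf[of K "drifted_line \<omega>"] continuous_on_subset[OF continuous_drifted_line[OF p]] by blast
  have "drifted_line \<omega> x \<le> drifted_line \<omega> z" if "z \<in> S" for z
  proof (cases "z \<in> K")
    case False
    then have z: "\<bar>z\<bar> \<ge> m" using that by (auto simp: K_def)
    then have "drifted_line \<omega> z \<ge> \<bar>z\<bar> / 2" by (intro R) (simp add: m_def)
    moreover have "\<bar>z\<bar> \<ge> 2 * \<bar>drifted_line \<omega> y\<bar>" using z by (simp add: m_def)
    ultimately show ?thesis using x(2)[OF yK] by linarith
  qed (rule x(2))
  then show ?thesis using x(1) by (auto simp: K_def)
qed

text \<open>Between two minimizers x < y fits a dyadic interval: on the positive side when y > 0,
  otherwise on the negative side, where x is the point beyond it. Either way the interval is tied,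
  which a regular path excludes.\<close>

lemma drifted_line_ex1_min:
  assumes p: "regular_path \<omega>"
  shows "\<exists>!x. \<forall>z. drifted_line \<omega> x \<le> drifted_line \<omega> z"
proof (rule ex_ex1I)
  show "\<exists>x. \<forall>z. drifted_line \<omega> x \<le> drifted_line \<omega> z"
    using drifted_line_attains_inf[OF p, of UNIV 0] by auto
next
  have lt: False if x: "\<And>z. drifted_line \<omega> x \<le> drifted_line \<omega> z" and y: "\<And>z. drifted_line \<omega> y \<le> drifted_line \<omega> z" and xy: "x < y" for x y
  proof -
    have eq: "drifted_line \<omega> x = drifted_line \<omega> y" using x[of y] y[of x] by simp
    have min: "drifted_line \<omega> y \<le> drifted b r \<omega>" if "r \<ge> 0" for b r
      using y drifted_line_at[OF p that, of b] by metis
    show False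
    proof (cases "y > 0")
      case True
      \<comment> \<open>A negative x sits on the other branch, and the interval then only has to fit
        between 0 and y.\<close>
      obtain k i where ki: "max x 0 \<le> real i / 2 ^ k" "real (Suc i) / 2 ^ k \<le> y"
        using dyadic_interval_between[of "max x 0" y] True xy by auto
      have "tied True k i \<omega>"
        unfolding tied_def
      proof (intro exI conjI allI impI)
        show "0 \<le> \<bar>x\<bar>" by simp
        show "(x \<ge> 0) = True \<Longrightarrow> \<bar>x\<bar> \<le> real i / 2 ^ k" using ki by auto
        show "real (Suc i) / 2 ^ k \<le> y" by (rule ki)
        show "drifted (x \<ge> 0) \<bar>x\<bar> \<omega> = drifted True y \<omega>" using eq True by (simp add: drifted_line_def)
        show "drifted True y \<omega> \<le> drifted b r \<omega>" if "0 \<le> r" for b r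
          using min[OF that, of b] True by (simp add: drifted_line_def)
      qed
      then show False using p by (simp add: regular_path_def)
    next
      case False
      obtain k i where ki: "- y \<le> real i / 2 ^ k" "real (Suc i) / 2 ^ k \<le> - x"
        using dyadic_interval_between[of "- y" "- x"] False xy by auto
      have dx: "drifted_line \<omega> x = drifted False (- x) \<omega>"
        using drifted_line_at[OF p, of "- x" False] False xy by simp
      have dy: "drifted_line \<omega> y = drifted False (- y) \<omega>"
        using drifted_line_at[OF p, of "- y" False] False by simp
      have "tied False k i \<omega>"
        unfolding tied_def
      proof (intro exI conjI allI impI)
        show "0 \<le> - y" using False by simp
        show "- y \<le> real i / 2 ^ k" by (rule ki)
        show "real (Suc i) / 2 ^ k \<le> - x" by (rule ki)
        show "drifted False (- y) \<omega> = drifted False (- x) \<omega>" using eq dx dy by simp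
        show "drifted False (- x) \<omega> \<le> drifted b r \<omega>" if "0 \<le> r" for b r
          using min[OF that, of b] dx eq by simp
      qed
      then show False using p by (simp add: regular_path_def)
    qed
  qed
  show "x = y" if "\<forall>z. drifted_line \<omega> x \<le> drifted_line \<omega> z" "\<forall>z. drifted_line \<omega> y \<le> drifted_line \<omega> z" for x y
    using lt[of x y] lt[of y x] that by (cases x y rule: linorder_cases) blast+
qed

lemma drifted_line_measurable: "(\<lambda>\<omega>. drifted_line \<omega> r) \<in> borel_measurable N"
  unfolding drifted_line_def drifted_def using meas[of "\<bar>r\<bar>" "r \<ge> 0"] by measurable

text \<open>The right-hand side involves only countably many times, which makes the minimizer a random variable.\<close>

lemma argmin_le_iff:
  assumes p: "regular_path \<omega>" and x: "\<And>z. drifted_line \<omega> x \<le> drifted_line \<omega> z"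
  shows "x \<le> a \<longleftrightarrow> (\<forall>n::nat. \<forall>q'::rat. of_rat q' > a \<longrightarrow> (\<exists>q::rat. of_rat q \<le> a \<and>
    drifted_line \<omega> (of_rat q) < drifted_line \<omega> (of_rat q') + 1 / real (Suc n)))"
proof
  have c: "\<exists>\<delta>>0. \<forall>y. \<bar>y - r\<bar> < \<delta> \<longrightarrow> \<bar>drifted_line \<omega> y - drifted_line \<omega> r\<bar> < e" if "e > 0" for r e
    using continuous_drifted_line[OF p] that unfolding continuous_on_iff dist_real_def by blast
  {
    assume xa: "x \<le> a"
    show "\<forall>n::nat. \<forall>q'::rat. of_rat q' > a \<longrightarrow> (\<exists>q::rat. of_rat q \<le> a \<and>
      drifted_line \<omega> (of_rat q) < drifted_line \<omega> (of_rat q') + 1 / real (Suc n))"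
    proof (intro allI impI)
      fix n :: nat and q' :: rat
      obtain \<delta> where d: "\<delta> > 0" "\<And>y. \<bar>y - x\<bar> < \<delta> \<Longrightarrow> \<bar>drifted_line \<omega> y - drifted_line \<omega> x\<bar> < 1 / real (Suc n)"
        using c[of "1 / real (Suc n)" x] by auto
      obtain q where q: "x - \<delta> < of_rat q" "of_rat q < x" using of_rat_dense[of "x - \<delta>" x] d(1) by auto
      then have "\<bar>drifted_line \<omega> (of_rat q) - drifted_line \<omega> x\<bar> < 1 / real (Suc n)" by (intro d) auto
      then have "drifted_line \<omega> (of_rat q) < drifted_line \<omega> (of_rat q') + 1 / real (Suc n)"
        using x[of "of_rat q'"] by linarith
      then show "\<exists>q::rat. of_rat q \<le> a \<and> drifted_line \<omega> (of_rat q) < drifted_line \<omega> (of_rat q') + 1 / real (Suc n)"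
        using q xa by (intro exI[of _ q]) auto
    qed
  }
  assume A: "\<forall>n::nat. \<forall>q'::rat. of_rat q' > a \<longrightarrow> (\<exists>q::rat. of_rat q \<le> a \<and>
      drifted_line \<omega> (of_rat q) < drifted_line \<omega> (of_rat q') + 1 / real (Suc n))"
  show "x \<le> a"
  proof (rule ccontr)
    assume "\<not> x \<le> a"
    then have xa: "a < x" by simp
    obtain m where m: "m \<le> a" "\<And>z. z \<le> a \<Longrightarrow> drifted_line \<omega> m \<le> drifted_line \<omega> z"
      using drifted_line_attains_inf[OF p, of "{..a}" a] by auto
    have lt: "drifted_line \<omega> x < drifted_line \<omega> m"
    proof (rule ccontr)
      assume "\<not> ?thesis"
      then have "\<forall>z. drifted_line \<omega> m \<le> drifted_line \<omega> z" using x by (meson not_less order_trans)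
      then have "m = x" using drifted_line_ex1_min[OF p] x by blast
      then show False using m xa by simp
    qed
    \<comment> \<open>Half of the gap between the minimum over \<open>{..a}\<close> and the global
      minimum: one half absorbs the rational approximation of x, the other the slack 1 / (n +
      1).\<close>
    define e where "e = (drifted_line \<omega> m - drifted_line \<omega> x) / 2"
    have e: "e > 0" using lt by (simp add: e_def)
    obtain n where n: "1 / real (Suc n) < e" using e by (metis nat_approx_posE)
    obtain \<delta> where d: "\<delta> > 0" "\<And>y. \<bar>y - x\<bar> < \<delta> \<Longrightarrow> \<bar>drifted_line \<omega> y - drifted_line \<omega> x\<bar> < e"
      using c[OF e, of x] by auto
    obtain q' where q': "x < of_rat q'" "of_rat q' < x + \<delta>" using of_rat_dense[of x "x + \<delta>"] d(1) by auto
    have "\<bar>drifted_line \<omega> (of_rat q') - drifted_line \<omega> x\<bar> < e" using q' by (intro d) auto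
    moreover obtain q where "of_rat q \<le> a" "drifted_line \<omega> (of_rat q) < drifted_line \<omega> (of_rat q') + 1 / real (Suc n)"
      using A q' xa by (meson less_trans)
    moreover have "drifted_line \<omega> m \<le> drifted_line \<omega> (of_rat q)" by (rule m(2)) fact
    ultimately show False using n unfolding e_def by argo
  qed
qed

text \<open>The second conclusion restates the identification of X in terms of
  \<open>drifted\<close>, the form in which limits of grid points will appear.\<close>

theorem ex_argmin:
  assumes W: "\<And>\<omega> r. \<omega> \<in> space N \<Longrightarrow> W r \<omega> = (if r > 0 then B True r \<omega> else if r < 0 then B False (- r) \<omega> else 0)"
  shows "\<exists>X. argmin_rv N (\<lambda>r \<omega>. \<bar>r\<bar> - 2 * W r \<omega>) X \<and>
    (AE \<omega> in N. (\<forall>b. B b 0 \<omega> = 0 \<and> continuous_on {0..} (\<lambda>t. B b t \<omega>)) \<and>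
      (\<forall>b u. u \<ge> 0 \<longrightarrow> (\<forall>b' r. r \<ge> 0 \<longrightarrow> drifted b u \<omega> \<le> drifted b' r \<omega>) \<longrightarrow> X \<omega> = (if b then u else - u)))"
proof -
  obtain E where E: "E \<in> null_sets N" "{\<omega>\<in>space N. \<not> regular_path \<omega>} \<subseteq> E"
    using AE_regular_path by (auto elim!: AE_E simp: null_sets_def)
  \<comment> \<open>Outside the measurable null set \<open>E\<close> every path is regular, so the
    description denotes; the default 0 on \<open>E\<close> keeps \<open>X\<close> measurable on the
    whole space.\<close>
  define X where "X \<omega> = (if \<omega> \<in> E then 0 else THE x. \<forall>z. drifted_line \<omega> x \<le> drifted_line \<omega> z)" for \<omega>
  have reg: "regular_path \<omega>" if "\<omega> \<in> space N - E" for \<omega> using that E by auto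
  have X: "drifted_line \<omega> (X \<omega>) \<le> drifted_line \<omega> z" if "\<omega> \<in> space N - E" for \<omega> z
    using theI'[OF drifted_line_ex1_min[OF reg[OF that]]] that by (auto simp: X_def)
  have Xu: "x = X \<omega>" if "\<omega> \<in> space N - E" "\<And>z. drifted_line \<omega> x \<le> drifted_line \<omega> z" for \<omega> x
    using drifted_line_ex1_min[OF reg[OF that(1)]] X[OF that(1)] that(2) by blast
  have Em[measurable]: "E \<in> events" using E by auto
  have mX: "X \<in> borel_measurable N"
  proof (rule borel_measurableI_le)
    fix a
    note drifted_line_measurable[measurable]
    have "{\<omega>\<in>space N. X \<omega> \<le> a} = {\<omega>\<in>space N. if \<omega> \<in> E then 0 \<le> a else (\<forall>n::nat. \<forall>q'::rat. of_rat q' > a \<longrightarrow> (\<exists>q::rat. of_rat q \<le> a \<and>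
      drifted_line \<omega> (of_rat q) < drifted_line \<omega> (of_rat q') + 1 / real (Suc n)))}"
    proof (intro Collect_cong conj_cong refl)
      fix \<omega> assume w: "\<omega> \<in> space N"
      show "X \<omega> \<le> a \<longleftrightarrow> (if \<omega> \<in> E then 0 \<le> a else (\<forall>n::nat. \<forall>q'::rat. of_rat q' > a \<longrightarrow> (\<exists>q::rat. of_rat q \<le> a \<and>
        drifted_line \<omega> (of_rat q) < drifted_line \<omega> (of_rat q') + 1 / real (Suc n))))"
      proof (cases "\<omega> \<in> E")
        case False
        then have "\<omega> \<in> space N - E" using w by simp
        from argmin_le_iff[OF reg[OF this] X[OF this]] False show ?thesis by simp
      qed (simp add: X_def)
    qed
    also have "\<dots> \<in> events" by measurable
    finally show "{\<omega>\<in>space N. X \<omega> \<le> a} \<in> events" .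
  qed
  have AE: "AE \<omega> in N. \<omega> \<in> space N - E"
    using AE_not_in[OF E(1)] AE_space by eventually_elim auto
  have Z: "\<bar>r\<bar> - 2 * W r \<omega> = drifted_line \<omega> r" if "\<omega> \<in> space N - E" for r \<omega>
    using W[of \<omega> r] that reg[OF that] by (auto simp: drifted_line_def drifted_def regular_path_def)
  have "argmin_rv N (\<lambda>r \<omega>. \<bar>r\<bar> - 2 * W r \<omega>) X"
    unfolding argmin_rv_def
  proof (intro conjI mX)
    show "AE \<omega> in N. \<forall>r. is_arg_min (\<lambda>u. \<bar>u\<bar> - 2 * W u \<omega>) (\<lambda>_. True) r \<longleftrightarrow> r = X \<omega>"
      using AE
    proof eventually_elim
      case (elim \<omega>)
      show ?case unfolding is_arg_min_def Z[OF elim] not_ex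
        using X[OF elim] Xu[OF elim] by (auto simp: not_less)
    qed
  qed
  moreover have "AE \<omega> in N. (\<forall>b. B b 0 \<omega> = 0 \<and> continuous_on {0..} (\<lambda>t. B b t \<omega>)) \<and>
      (\<forall>b u. u \<ge> 0 \<longrightarrow> (\<forall>b' r. r \<ge> 0 \<longrightarrow> drifted b u \<omega> \<le> drifted b' r \<omega>) \<longrightarrow> X \<omega> = (if b then u else - u))"
    using AE
  proof eventually_elim
    case (elim \<omega>)
    note r = reg[OF elim]
    have "X \<omega> = (if b then u else - u)" if "u \<ge> 0" "\<forall>b' r. r \<ge> 0 \<longrightarrow> drifted b u \<omega> \<le> drifted b' r \<omega>" for b u
      by (rule Xu[OF elim, symmetric]) (use that in \<open>simp add: drifted_line_at[OF r that(1)], simp add: drifted_line_def\<close>)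
    then show ?case using r by (auto simp: regular_path_def)
  qed
  ultimately show ?thesis by blast
qed

end

section \<open>Argmin convergence for two-sided random walks\<close>

text \<open>Order passes to the limit even along infinitely many indices only, which is all that a
  limsup event provides.\<close>

lemma tendsto_le_INFM:
  fixes f g :: "nat \<Rightarrow> real"
  assumes "f \<longlonglongrightarrow> x" "g \<longlonglongrightarrow> y" "\<exists>\<^sub>\<infinity>n. f n \<le> g n"
  shows "x \<le> y"
proof (rule ccontr)
  assume "\<not> x \<le> y"
  then have "\<forall>\<^sub>F n in sequentially. g n < f n"
    using order_tendstoD(2)[OF assms(2), of "(x + y) / 2"] order_tendstoD(1)[OF assms(1), of "(x + y) / 2"]
    by (auto elim: eventually_elim2)
  then have "\<forall>\<^sub>F n in sequentially. \<not> f n \<le> g n" by (rule eventually_mono) simp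
  then show False using assms(3) unfolding cofinite_eq_sequentially frequently_def by blast
qed

abbreviation signed :: "bool \<Rightarrow> real \<Rightarrow> real" where
  "signed b u \<equiv> (if b then u else - u)"

text \<open>The abstract argmin problem, free of dimension and plug-in estimates: \<open>a\<close>
  is the time step, \<open>r\<close> the rescaled estimator, \<open>e\<close> its rounding error and
  \<open>\<rho>\<close> the relative plug-in error. The minimizing index may equal \<open>L\<close>
  while competitors stay strictly below it, because the splits from 1 to T - 1 contain neither 0 nor
  T, whereas minimization over the open interval may return split 0.\<close>

locale two_sided_walks = two_sided_bm N B for N :: "'b measure" and B +
  fixes M :: "nat \<Rightarrow> 'a measure" and Y :: "nat \<Rightarrow> bool \<times> nat \<Rightarrow> 'a \<Rightarrow> real" and L :: "nat \<Rightarrow> bool \<Rightarrow> nat"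
    and a v e \<rho> :: "nat \<Rightarrow> real" and K :: real and r :: "nat \<Rightarrow> 'a \<Rightarrow> real" and Good :: "nat \<Rightarrow> 'a set"
    and X :: "'b \<Rightarrow> real"
  assumes M: "\<And>n. prob_space (M n)"
    and ind: "\<And>n. prob_space.indep_vars (M n) (\<lambda>_. borel) (Y n) {j. snd j < L n (fst j)}"
    and mean: "\<And>n j. snd j < L n (fst j) \<Longrightarrow> (\<integral>\<omega>. Y n j \<omega> \<partial>M n) = 0"
    and var: "\<And>n j. snd j < L n (fst j) \<Longrightarrow> (\<integral>\<omega>. (Y n j \<omega>)\<^sup>2 \<partial>M n) = a n * v n"
    and sg: "\<And>n j. snd j < L n (fst j) \<Longrightarrow> subgaussian (M n) (K * sqrt (a n)) (Y n j)"
    and K: "K > 0" and a: "\<And>n. a n > 0" "a \<longlonglongrightarrow> 0" and v: "v \<longlonglongrightarrow> 1"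
    and aL: "\<And>b. filterlim (\<lambda>n. a n * real (L n b)) at_top sequentially"
    and r_meas: "\<And>n. r n \<in> borel_measurable (M n)"
    and Good: "\<And>n. Good n \<in> sets (M n)" "(\<lambda>n. measure (M n) (Good n)) \<longlonglongrightarrow> 1"
    and near_min: "\<And>n \<omega>. \<omega> \<in> Good n \<Longrightarrow> \<exists>b m. m \<le> L n b \<and> \<bar>r n \<omega> - signed b (a n * real m)\<bar> \<le> e n \<and>
      (\<forall>b' m'. m' < L n b' \<longrightarrow> a n * real m - 2 * (\<Sum>i<m. Y n (b, i) \<omega>) \<le> a n * real m' - 2 * (\<Sum>i<m'. Y n (b', i) \<omega>)
        + \<rho> n * (a n * real m + sqrt (a n * real m) + a n * real m' + sqrt (a n * real m')))"
    and e: "e \<longlonglongrightarrow> 0" and \<rho>: "\<And>n. \<rho> n \<ge> 0" "\<rho> \<longlonglongrightarrow> 0"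
    and X_meas: "X \<in> borel_measurable N"
    and X_argmin: "AE \<omega> in N. (\<forall>b. B b 0 \<omega> = 0 \<and> continuous_on {0..} (\<lambda>t. B b t \<omega>)) \<and>
      (\<forall>b u. u \<ge> 0 \<longrightarrow> (\<forall>b' r. r \<ge> 0 \<longrightarrow> drifted b u \<omega> \<le> drifted b' r \<omega>) \<longrightarrow> X \<omega> = signed b u)"
begin

section \<open>Tightness of the near-minimizer\<close>

definition walk :: "nat \<Rightarrow> bool \<Rightarrow> nat \<Rightarrow> 'a \<Rightarrow> real" where
  "walk n b m \<omega> = (\<Sum>i<m. Y n (b, i) \<omega>)"

lemma Y_meas: "snd j < L n (fst j) \<Longrightarrow> Y n j \<in> borel_measurable (M n)"
proof -
  assume j: "snd j < L n (fst j)"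
  have "\<forall>i\<in>{j. snd j < L n (fst j)}. Y n i \<in> borel_measurable (M n)"
    using ind[of n] unfolding prob_space.indep_vars_def[OF M[of n]] by (elim conjE)
  then show "Y n j \<in> borel_measurable (M n)" using j by blast
qed

lemma ind_shifted: "c + m \<le> L n b \<Longrightarrow> prob_space.indep_vars (M n) (\<lambda>_. borel) (\<lambda>i. Y n (b, c + i)) {..<m}"
  by (rule prob_space.indep_vars_inj_reindex[OF M ind]) (auto simp: inj_on_def)

lemma walk_meas: "m \<le> L n b \<Longrightarrow> walk n b m \<in> borel_measurable (M n)"
  unfolding walk_def by (intro borel_measurable_sum Y_meas) auto

lemma eventually_aL: "\<forall>\<^sub>F n in sequentially. C < a n * real (L n b)"
  using aL[of b] by (simp add: filterlim_at_top_dense)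

text \<open>Compared with the change point itself, where the criterion increment vanishes, a
  near-minimizer at time u >= 1 requires a walk of at least u / 4 once \<open>\<rho>\<close> is
  below 1 / 8. Beyond time R - 1 the walk exceeds a quarter of the drift with probability at most
  1024 K^2 / (R - 1) per side, uniformly in the step size.\<close>

lemma tight:
  assumes \<epsilon>: "\<epsilon> > 0"
  shows "\<exists>R. \<forall>\<^sub>F n in sequentially. measure (M n) {\<omega>\<in>Good n. \<bar>r n \<omega>\<bar> > R} \<le> \<epsilon>"
proof -
  \<comment> \<open>Makes 1024 K^2 / (R - 1) at most \<epsilon> / 2; moreover R >= 2 forces u >= 1,
    where sqrt u <= u.\<close>
  define R where "R = 2 + 2048 * K\<^sup>2 / \<epsilon>"
  have R: "R \<ge> 2" using \<epsilon> by (simp add: R_def)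
  have "\<forall>\<^sub>F n in sequentially. a n < 1" using a(2) by (rule order_tendstoD) simp
  moreover have "\<forall>\<^sub>F n in sequentially. e n < 1" using e by (rule order_tendstoD) simp
  moreover have "\<forall>\<^sub>F n in sequentially. \<rho> n < 1 / 8" using \<rho>(2) by (rule order_tendstoD) simp
  moreover note eventually_aL[of 0 True]
  ultimately have "\<forall>\<^sub>F n in sequentially. measure (M n) {\<omega>\<in>Good n. \<bar>r n \<omega>\<bar> > R} \<le> \<epsilon>"
  proof eventually_elim
    case (elim n)
    interpret Mn: prob_space "M n" by (rule M)
    have an: "a n > 0" by (rule a)
    define T where "T b = {\<omega>\<in>space (M n). \<exists>m\<le>L n b. (R - 1) / a n \<le> real m \<and> a n / 4 * real m \<le> \<bar>\<Sum>i<m. Y n (b, i) \<omega>\<bar>}" for b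
    have T: "T b \<in> sets (M n)" for b
    proof -
      have "T b = (\<Union>m\<in>{m. m \<le> L n b \<and> (R - 1) / a n \<le> real m}. {\<omega>\<in>space (M n). a n / 4 * real m \<le> \<bar>walk n b m \<omega>\<bar>})"
        by (auto simp: T_def walk_def)
      also have "\<dots> \<in> sets (M n)"
        by (intro sets.finite_UN borel_measurable_le borel_measurable_abs borel_measurable_const walk_meas) auto
      finally show ?thesis .
    qed
    have pT: "measure (M n) (T b) \<le> \<epsilon> / 2" for b
    proof -
      have "measure (M n) (T b) \<le> 64 * (K * sqrt (a n))\<^sup>2 / ((a n / 4)\<^sup>2 * ((R - 1) / a n))"
        unfolding T_def
      proof (rule Mn.subgaussian_walk_below_line)
        show "Mn.indep_vars (\<lambda>_. borel) (\<lambda>i. Y n (b, i)) {..<L n b}"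
          using ind_shifted[of 0 "L n b" n b] by simp
        show "1 \<le> (R - 1) / a n" using R elim an by (simp add: field_simps)
      qed (use sg K an in auto)
      also have "\<dots> = 1024 * K\<^sup>2 / (R - 1)"
        using an R by (simp add: power_mult_distrib field_simps power2_eq_square)
      also have "\<dots> \<le> 1024 * K\<^sup>2 / (2048 * K\<^sup>2 / \<epsilon>)"
        using \<epsilon> K by (intro divide_left_mono) (auto simp: R_def intro!: mult_pos_pos divide_pos_pos add_pos_nonneg)
      also have "\<dots> = \<epsilon> / 2" using K \<epsilon> by simp
      finally show ?thesis .
    qed
    have "{\<omega>\<in>Good n. \<bar>r n \<omega>\<bar> > R} \<subseteq> T True \<union> T False"
    proof
      fix \<omega> assume w: "\<omega> \<in> {\<omega>\<in>Good n. \<bar>r n \<omega>\<bar> > R}"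
      then obtain b m where m: "m \<le> L n b" "\<bar>r n \<omega> - signed b (a n * real m)\<bar> \<le> e n"
        and min: "\<And>b' m'. m' < L n b' \<Longrightarrow> a n * real m - 2 * walk n b m \<omega> \<le> a n * real m' - 2 * walk n b' m' \<omega>
        + \<rho> n * (a n * real m + sqrt (a n * real m) + a n * real m' + sqrt (a n * real m'))"
        using near_min[of \<omega> n] unfolding walk_def by blast
      define u where "u = a n * real m"
      have u0: "u \<ge> 0" using an by (simp add: u_def)
      have "\<bar>r n \<omega>\<bar> \<le> u + e n" using m(2) u0 by (auto simp: u_def split: if_splits)
      then have u: "u > R - 1" using w elim by simp
      then have u1: "u \<ge> 1" using R by simp
      \<comment> \<open>The competitor is m' = 0, admissible as soon as the side is
        nonempty.\<close>
      have "0 < L n True" using elim(4) an by (simp add: zero_less_mult_iff)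
      from min[OF this] have 1: "u - 2 * walk n b m \<omega> \<le> \<rho> n * (u + sqrt u)"
        by (simp add: u_def walk_def)
      have "sqrt u \<le> u" using u1 real_sqrt_le_mono[of u "u\<^sup>2"] by (simp add: power2_eq_square)
      then have "\<rho> n * (u + sqrt u) \<le> 1 / 8 * (u + u)" using elim(3) \<rho>(1)[of n] u0 by (intro mult_mono) auto
      with 1 have "u / 4 \<le> walk n b m \<omega>" using u0 by simp
      then have "a n / 4 * real m \<le> \<bar>\<Sum>i<m. Y n (b, i) \<omega>\<bar>" by (simp add: u_def walk_def)
      moreover have "(R - 1) / a n \<le> real m" using u an by (simp add: u_def field_simps)
      moreover have "\<omega> \<in> space (M n)" using w sets.sets_into_space[OF Good(1)] by blast
      ultimately have "\<omega> \<in> T b" using m(1) by (auto simp: T_def)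
      then show "\<omega> \<in> T True \<union> T False" by (cases b) auto
    qed
    then have "measure (M n) {\<omega>\<in>Good n. \<bar>r n \<omega>\<bar> > R} \<le> measure (M n) (T True \<union> T False)"
      by (rule Mn.finite_measure_mono) (use T in auto)
    also have "\<dots> \<le> measure (M n) (T True) + measure (M n) (T False)" by (rule measure_Un_le) (use T in auto)
    also have "\<dots> \<le> \<epsilon>" using pT[of True] pT[of False] by simp
    finally show ?case .
  qed
  then show ?thesis by blast
qed

section \<open>Grid points of the walk and its oscillation between them\<close>

definition knot :: "nat \<Rightarrow> nat \<Rightarrow> nat \<Rightarrow> nat" where
  "knot n k j = nat \<lfloor>real j / (2 ^ k * a n)\<rfloor>"

text \<open>Vanishes under refinement of the grid, but so slowly compared with the typical
  oscillation 2^(-k/2) over a mesh that the union bound over all blocks still tends to zero.\<close>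

definition tol :: "nat \<Rightarrow> real" where
  "tol k = 1 / real (Suc k)"

lemma tol_pos: "tol k > 0" by (simp add: tol_def)

lemma tol_tendsto: "tol \<longlonglongrightarrow> 0"
  unfolding tol_def[abs_def] by (rule LIMSEQ_Suc[OF lim_1_over_n])

lemma knot_mono: "i \<le> j \<Longrightarrow> knot n k i \<le> knot n k j"
  unfolding knot_def using a(1)[of n] by (intro nat_mono floor_mono divide_right_mono) auto

lemma knot_le: "real (knot n k j) \<le> real j / (2 ^ k * a n)"
  unfolding knot_def using a(1)[of n] by (intro of_nat_floor) simp

lemma knot_gt: "real j / (2 ^ k * a n) - 1 < real (knot n k j)"
  unfolding knot_def using a(1)[of n] by linarith

lemma knot_le': "a n * real (knot n k j) \<le> real j / 2 ^ k"
  using knot_le[of n k j] a(1)[of n] by (simp add: field_simps)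

lemma knot_diff_le: "real (knot n k (Suc j) - knot n k j) \<le> 1 / (2 ^ k * a n) + 1"
proof -
  have "real (knot n k (Suc j)) - real (knot n k j) \<le> real (Suc j) / (2 ^ k * a n) - (real j / (2 ^ k * a n) - 1)"
    using knot_le[of n k "Suc j"] knot_gt[of j k n] by linarith
  also have "\<dots> = 1 / (2 ^ k * a n) + 1" by (simp add: add_divide_distrib)
  finally show ?thesis using knot_mono[of j "Suc j" n k] by (simp add: of_nat_diff)
qed

lemma eventually_knot_less: "\<forall>\<^sub>F n in sequentially. \<forall>j\<le>k * 2 ^ k. knot n k j < L n b"
  using eventually_aL[of "real k" b]
proof eventually_elim
  case (elim n)
  show ?case
  proof (intro allI impI)
    fix j assume "j \<le> k * 2 ^ k"
    then have "real j \<le> real k * 2 ^ k" by (metis of_nat_le_iff of_nat_mult of_nat_numeral of_nat_power)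
    then have "real j / 2 ^ k \<le> real k" by (simp add: field_simps)
    then have "a n * real (knot n k j) < a n * real (L n b)" using knot_le'[of n k j] elim by linarith
    then show "knot n k j < L n b" using a(1)[of n] by simp
  qed
qed

text \<open>Inside some block up to time k the walk moves by tol / 4 or more; written as 2 (tol / 8)
  to match the maximal inequality.\<close>

definition osc :: "nat \<Rightarrow> nat \<Rightarrow> 'a set" where
  "osc n k = {\<omega>\<in>space (M n). \<exists>j\<in>UNIV \<times> {..<k * 2 ^ k}. \<exists>m\<le>knot n k (Suc (snd j)) - knot n k (snd j).
     2 * (tol k / 8) \<le> \<bar>\<Sum>i<m. Y n (fst j, knot n k (snd j) + i) \<omega>\<bar>}"

definition osc_bound :: "nat \<Rightarrow> real" where
  "osc_bound k = 8 * real k * 2 ^ k * exp (- (2 ^ k / (256 * K\<^sup>2 * (real (Suc k))\<^sup>2)))"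

text \<open>Union bound over the 2 k 2^k blocks, each treated with the maximal inequality. A block
  has at most 2 / (2^k a) steps once a < 1 / 2^k, the factor 2 absorbing the extra step from
  rounding.\<close>

lemma osc_measure:
  "\<forall>\<^sub>F n in sequentially. osc n k \<in> sets (M n) \<and> measure (M n) (osc n k) \<le> osc_bound k"
proof -
  have "\<forall>\<^sub>F n in sequentially. a n < 1 / 2 ^ k" using a(2) by (rule order_tendstoD) simp
  then show ?thesis using eventually_knot_less[of k True] eventually_knot_less[of k False]
  proof eventually_elim
    case (elim n)
    interpret Mn: prob_space "M n" by (rule M)
    have an: "a n > 0" by (rule a)
    have kL: "knot n k j \<le> L n b" if "j \<le> k * 2 ^ k" for j b using elim(2,3) that by (cases b) auto
    define d where "d j = knot n k (Suc (snd j)) - knot n k (snd j)" for j :: "bool \<times> nat"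
    define Os where "Os j = {\<omega>\<in>space (M n). \<exists>m\<le>d j. 2 * (tol k / 8) \<le> \<bar>\<Sum>i<m. Y n (fst j, knot n k (snd j) + i) \<omega>\<bar>}" for j
    have dj: "knot n k (snd j) + d j \<le> L n (fst j)" if "j \<in> UNIV \<times> {..<k * 2 ^ k}" for j
      using kL[of "Suc (snd j)" "fst j"] that knot_mono[of "snd j" "Suc (snd j)" n k] by (auto simp: d_def)
    have Os: "Os j \<in> sets (M n)" if "j \<in> UNIV \<times> {..<k * 2 ^ k}" for j
    proof -
      have "Os j = (\<Union>m\<in>{..d j}. {\<omega>\<in>space (M n). 2 * (tol k / 8) \<le> \<bar>\<Sum>i<m. Y n (fst j, knot n k (snd j) + i) \<omega>\<bar>})"
        by (auto simp: Os_def)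
      also have "\<dots> \<in> sets (M n)"
        using dj[OF that] by (intro sets.finite_UN borel_measurable_le borel_measurable_abs borel_measurable_const borel_measurable_sum Y_meas) auto
      finally show ?thesis .
    qed
    have pO: "measure (M n) (Os j) \<le> 4 * exp (- (2 ^ k / (256 * K\<^sup>2 * (real (Suc k))\<^sup>2)))" if j: "j \<in> UNIV \<times> {..<k * 2 ^ k}" for j
    proof (cases "d j = 0")
      case True
      then have "Os j = {}" using tol_pos[of k] by (auto simp: Os_def)
      then show ?thesis by simp
    next
      case False
      have "measure (M n) (Os j) \<le> 4 * exp (- ((tol k / 8)\<^sup>2 / (2 * real (d j) * (K * sqrt (a n))\<^sup>2)))"
        unfolding Os_def
        by (rule Mn.subgaussian_maximal[OF ind_shifted]) (use dj[OF j] sg K an tol_pos in auto)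
      also have "\<dots> \<le> 4 * exp (- ((tol k / 8)\<^sup>2 / (2 * (2 / (2 ^ k * a n)) * (K * sqrt (a n))\<^sup>2)))"
      proof -
        have "real (d j) \<le> 2 / (2 ^ k * a n)"
        proof -
          have "1 \<le> 1 / (2 ^ k * a n)" using elim(1) an by (simp add: field_simps)
          then show ?thesis using knot_diff_le[of n k "snd j"] by (simp add: d_def)
        qed
        then have "(tol k / 8)\<^sup>2 / (2 * (2 / (2 ^ k * a n)) * (K * sqrt (a n))\<^sup>2) \<le> (tol k / 8)\<^sup>2 / (2 * real (d j) * (K * sqrt (a n))\<^sup>2)"
          using False K an by (intro divide_left_mono mult_right_mono mult_left_mono mult_pos_pos) auto
        then show ?thesis by simp
      qed
      also have "(tol k / 8)\<^sup>2 / (2 * (2 / (2 ^ k * a n)) * (K * sqrt (a n))\<^sup>2) = 2 ^ k / (256 * K\<^sup>2 * (real (Suc k))\<^sup>2)"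
      proof -
        define c where "c = real (Suc k)"
        have c: "c > 0" "tol k = 1 / c" by (simp_all add: c_def tol_def)
        show ?thesis unfolding c_def[symmetric] c(2) using an K c(1)
          by (simp add: power_mult_distrib power_divide field_simps)
      qed
      finally show ?thesis .
    qed
    have oU: "osc n k = (\<Union>j\<in>UNIV \<times> {..<k * 2 ^ k}. Os j)"
      unfolding osc_def Os_def d_def by blast
    have "measure (M n) (\<Union>j\<in>UNIV \<times> {..<k * 2 ^ k}. Os j) \<le> (\<Sum>j\<in>UNIV \<times> {..<k * 2 ^ k}. measure (M n) (Os j))"
      by (rule Mn.finite_measure_subadditive_finite) (use Os in auto)
    also have "\<dots> \<le> (\<Sum>j\<in>(UNIV :: bool set) \<times> {..<k * 2 ^ k}. 4 * exp (- (2 ^ k / (256 * K\<^sup>2 * (real (Suc k))\<^sup>2))))"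
      by (intro sum_mono pO)
    also have "\<dots> = osc_bound k" by (simp add: osc_bound_def)
    finally show ?case using Os unfolding oU by auto
  qed
qed

lemma osc_bound_tendsto: "osc_bound \<longlonglongrightarrow> 0"
proof -
  have "(\<lambda>k. 8 * real k * 2 ^ k * exp (- (2 ^ k / (256 * K\<^sup>2 * (real (Suc k))\<^sup>2)))) \<longlonglongrightarrow> 0"
    using K by real_asymp
  then show ?thesis by (simp add: osc_bound_def[abs_def])
qed

section \<open>Grid increments and almost minimal grid points\<close>

abbreviation index :: "nat \<Rightarrow> (bool \<times> nat) set" where
  "index k \<equiv> UNIV \<times> {..<k * 2 ^ k}"

abbreviation grid :: "nat \<Rightarrow> (bool \<times> nat) set" where
  "grid k \<equiv> UNIV \<times> {..k * 2 ^ k}"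

text \<open>Truncation at \<open>L\<close> makes the block sums independent for every n; for large n
  it leaves any fixed block unchanged.\<close>

definition block :: "nat \<Rightarrow> nat \<Rightarrow> bool \<times> nat \<Rightarrow> (bool \<times> nat) set" where
  "block n k j = {fst j} \<times> ({knot n k (snd j)..<knot n k (Suc (snd j))} \<inter> {..<L n (fst j)})"

definition block_sum :: "nat \<Rightarrow> nat \<Rightarrow> bool \<times> nat \<Rightarrow> 'a \<Rightarrow> real" where
  "block_sum n k j \<omega> = (\<Sum>i\<in>block n k j. Y n i \<omega>)"

definition grid_value :: "nat \<Rightarrow> bool \<times> nat \<Rightarrow> (bool \<times> nat \<Rightarrow> real) \<Rightarrow> real" where
  "grid_value k p x = real (snd p) / 2 ^ k - 2 * (\<Sum>l<snd p. x (fst p, l))"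

text \<open>The bound \<open>R + 1\<close> keeps these points in a compact set, and the tolerance
  leaves room for rounding the estimator to the grid.\<close>

definition near :: "real set \<Rightarrow> real \<Rightarrow> nat \<Rightarrow> (bool \<times> nat) set" where
  "near F R k = {p \<in> grid k. real (snd p) / 2 ^ k \<le> R + 1 \<and>
     (\<exists>f\<in>F. \<bar>signed (fst p) (real (snd p) / 2 ^ k) - f\<bar> \<le> tol k)}"

text \<open>A condition on finitely many increments, with non-strict inequalities so that it is
  closed. It is evaluated both at the block sums of the walk and at the Brownian increments.\<close>

definition almost_min :: "real set \<Rightarrow> real \<Rightarrow> nat \<Rightarrow> (bool \<times> nat \<Rightarrow> real) set" where
  "almost_min F R k = {x \<in> space (PiM (index k) (\<lambda>_. borel)).
     \<exists>p\<in>near F R k. \<forall>q\<in>grid k. grid_value k p x \<le> grid_value k q x + tol k}"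

lemma finite_near: "finite (near F R k)"
  by (rule finite_subset[of _ "grid k"]) (auto simp: near_def)

lemma block_sub: "block n k j \<subseteq> {j. snd j < L n (fst j)}"
  by (auto simp: block_def)

lemma block_sum_indep: "prob_space.indep_vars (M n) (\<lambda>_. borel) (block_sum n k) J"
  unfolding block_sum_def[abs_def]
proof (rule prob_space.indep_vars_block_sum[OF M ind block_sub])
  have "block n k i \<inter> block n k j = {}" if "i \<noteq> j" for i j
  proof (cases "fst i = fst j")
    case True
    then have "snd i \<noteq> snd j" using that by (auto simp: prod_eq_iff)
    then have "Suc (snd i) \<le> snd j \<or> Suc (snd j) \<le> snd i" by linarith
    then have "knot n k (Suc (snd i)) \<le> knot n k (snd j) \<or> knot n k (Suc (snd j)) \<le> knot n k (snd i)"
      using knot_mono by blast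
    then show ?thesis by (auto simp: block_def)
  qed (auto simp: block_def)
  then show "disjoint_family_on (block n k) J" by (auto simp: disjoint_family_on_def)
qed

lemma block_sum_meas: "block_sum n k j \<in> borel_measurable (M n)"
  unfolding block_sum_def using block_sub[of n k j] by (intro borel_measurable_sum Y_meas) auto

lemma sum_block_sum:
  assumes "knot n k j \<le> L n b"
  shows "(\<Sum>l<j. block_sum n k (b, l) \<omega>) = walk n b (knot n k j) \<omega>"
  using assms
proof (induction j)
  case 0
  then show ?case by (simp add: knot_def walk_def)
next
  case (Suc j)
  have le: "knot n k j \<le> knot n k (Suc j)" by (rule knot_mono) simp
  have "block n k (b, j) = (\<lambda>i. (b, i)) ` {knot n k j..<knot n k (Suc j)}"
    using Suc.prems by (auto simp: block_def)
  then have "block_sum n k (b, j) \<omega> = (\<Sum>i\<in>{knot n k j..<knot n k (Suc j)}. Y n (b, i) \<omega>)"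
    by (simp add: block_sum_def sum.reindex inj_on_def)
  then show ?case using Suc le
    by (simp add: walk_def lessThan_atLeast0 sum.atLeastLessThan_concat)
qed

text \<open>Rounding the endpoints changes the number of steps by at most one in either direction,
  that is, by at most a after rescaling.\<close>

lemma card_block_tendsto: "(\<lambda>n. real (card (block n k j)) * a n) \<longlonglongrightarrow> 1 / 2 ^ k"
proof (rule tendsto_sandwich[of "\<lambda>n. 1 / 2 ^ k - a n" _ _ "\<lambda>n. 1 / 2 ^ k + a n"])
  have ev: "\<forall>\<^sub>F n in sequentially. real (card (block n k j)) = real (knot n k (Suc (snd j))) - real (knot n k (snd j))"
    using eventually_aL[of "real (Suc (snd j)) / 2 ^ k" "fst j"]
  proof eventually_elim
    case (elim n)
    have "a n * real (knot n k (Suc (snd j))) < a n * real (L n (fst j))"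
      using knot_le'[of n k "Suc (snd j)"] elim by linarith
    then have "knot n k (Suc (snd j)) \<le> L n (fst j)" using a(1)[of n] by simp
    then have "{knot n k (snd j)..<knot n k (Suc (snd j))} \<inter> {..<L n (fst j)} = {knot n k (snd j)..<knot n k (Suc (snd j))}" by auto
    then show ?case using knot_mono[of "snd j" "Suc (snd j)" n k]
      by (simp add: block_def card_cartesian_product of_nat_diff)
  qed
  have b: "real (Suc (snd j)) / (2 ^ k * a n) = real (snd j) / (2 ^ k * a n) + 1 / (2 ^ k * a n)" for n
    by (simp add: add_divide_distrib)
  have e: "(1 / (2 ^ k * a n) - 1) * a n = 1 / 2 ^ k - a n" "(1 / (2 ^ k * a n) + 1) * a n = 1 / 2 ^ k + a n" for n
    using a(1)[of n] by (simp_all add: field_simps)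
  show "\<forall>\<^sub>F n in sequentially. 1 / 2 ^ k - a n \<le> real (card (block n k j)) * a n"
    using ev
  proof eventually_elim
    case (elim n)
    have "1 / (2 ^ k * a n) - 1 \<le> real (card (block n k j))"
      using elim b[of n] knot_le[of n k "snd j"] knot_gt[of "Suc (snd j)" k n] by linarith
    then have "(1 / (2 ^ k * a n) - 1) * a n \<le> real (card (block n k j)) * a n"
      using a(1)[of n] by (intro mult_right_mono) auto
    then show ?case by (simp only: e)
  qed
  show "\<forall>\<^sub>F n in sequentially. real (card (block n k j)) * a n \<le> 1 / 2 ^ k + a n"
    using ev
  proof eventually_elim
    case (elim n)
    have "real (card (block n k j)) \<le> 1 / (2 ^ k * a n) + 1"
      using elim b[of n] knot_le[of n k "Suc (snd j)"] knot_gt[of "snd j" k n] by linarith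
    then have "real (card (block n k j)) * a n \<le> (1 / (2 ^ k * a n) + 1) * a n"
      using a(1)[of n] by (intro mult_right_mono) auto
    then show ?case by (simp only: e)
  qed
  have "(\<lambda>n. 1 / 2 ^ k - a n) \<longlonglongrightarrow> 1 / 2 ^ k - 0" by (intro tendsto_intros a(2))
  then show "(\<lambda>n. 1 / 2 ^ k - a n) \<longlonglongrightarrow> 1 / 2 ^ k" by simp
  have "(\<lambda>n. 1 / 2 ^ k + a n) \<longlonglongrightarrow> 1 / 2 ^ k + 0" by (intro tendsto_intros a(2))
  then show "(\<lambda>n. 1 / 2 ^ k + a n) \<longlonglongrightarrow> 1 / 2 ^ k" by simp
qed

text \<open>A block has about 1 / (2^k a) terms of variance a v with v -> 1, so its sum has limiting
  variance 1 / 2^k, the variance of the Brownian increment over one mesh.\<close>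

lemma block_sum_weak_conv:
  "weak_conv_m (\<lambda>n. distr (M n) borel (block_sum n k j)) (distr N borel (incr k j))"
proof (rule levy_continuity)
  show "real_distribution (distr (M n) borel (block_sum n k j))" for n
    by (rule prob_space.real_distribution_distr[OF M block_sum_meas])
  show "real_distribution (distr N borel (incr k j))"
    by (rule real_distribution_distr[OF incr_measurable])
  fix t
  have bs: "snd i < L n (fst i)" if "i \<in> block n k j" for i n using block_sub that by blast
  have "(\<lambda>n. char (distr (M n) borel (\<lambda>\<omega>. \<Sum>i\<in>block n k j. Y n i \<omega>)) t) \<longlonglongrightarrow> complex_of_real (exp (- (1 / 2 ^ k * t\<^sup>2 / 2)))"
  proof (rule subgaussian_array_clt[OF M _ _ _ _ _ K a v card_block_tendsto])
    show "finite (block n k j)" for n by (simp add: block_def)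
    show "prob_space.indep_vars (M n) (\<lambda>_. borel) (Y n) (block n k j)" for n
      using prob_space.indep_vars_subset[OF M ind block_sub] .
  qed (blast intro: mean var sg bs)+
  then show "(\<lambda>n. char (distr (M n) borel (block_sum n k j)) t) \<longlonglongrightarrow> char (distr N borel (incr k j)) t"
    using char_normal[OF incr_distributed] by (simp add: block_sum_def[abs_def])
qed

lemma almost_min_sets: "almost_min F R k \<in> sets (PiM (index k) (\<lambda>_. borel))"
proof -
  have m: "grid_value k p \<in> borel_measurable (PiM (index k) (\<lambda>_. borel))" if "p \<in> grid k" for p
    using that unfolding grid_value_def
    by (intro borel_measurable_diff borel_measurable_times borel_measurable_const borel_measurable_sum measurable_component_singleton) auto
  have n: "p \<in> grid k" if "p \<in> near F R k" for p using that by (simp add: near_def)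
  show ?thesis
    unfolding almost_min_def
  proof (rule sets.sets_Collect_finite_Ex[OF _ finite_near])
    fix p assume p: "p \<in> near F R k"
    show "{x \<in> space (PiM (index k) (\<lambda>_. borel)). \<forall>q\<in>grid k. grid_value k p x \<le> grid_value k q x + tol k}
      \<in> sets (PiM (index k) (\<lambda>_. borel))"
    proof (rule sets.sets_Collect_finite_All)
      fix q assume q: "q \<in> grid k"
      show "{x \<in> space (PiM (index k) (\<lambda>_. borel)). grid_value k p x \<le> grid_value k q x + tol k}
        \<in> sets (PiM (index k) (\<lambda>_. borel))"
        by (intro borel_measurable_le borel_measurable_add borel_measurable_const m n p q)
    qed simp
  qed
qed

text \<open>Since \<open>near\<close> is finite, a single grid point is almost minimal infinitely
  often, and its finitely many inequalities pass to the limit.\<close>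

lemma almost_min_closed:
  assumes lim: "\<And>i. i \<in> index k \<Longrightarrow> (\<lambda>n. f n i) \<longlonglongrightarrow> g i" and g: "g \<in> extensional (index k)"
    and inf: "\<exists>\<^sub>\<infinity>n. f n \<in> almost_min F R k"
  shows "g \<in> almost_min F R k"
proof -
  have "\<exists>\<^sub>\<infinity>n. \<exists>p\<in>near F R k. \<forall>q\<in>grid k. grid_value k p (f n) \<le> grid_value k q (f n) + tol k"
    using inf by (rule INFM_mono) (auto simp: almost_min_def)
  then obtain p where p: "p \<in> near F R k"
    and inf: "\<exists>\<^sub>\<infinity>n. \<forall>q\<in>grid k. grid_value k p (f n) \<le> grid_value k q (f n) + tol k"
    by (subst (asm) INFM_finite_Bex_distrib[OF finite_near]) blast
  have conv: "(\<lambda>n. grid_value k q (f n)) \<longlonglongrightarrow> grid_value k q g" if "q \<in> grid k" for q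
    unfolding grid_value_def using that by (intro tendsto_intros lim) auto
  have pg: "p \<in> grid k" using p by (simp add: near_def)
  have "grid_value k p g \<le> grid_value k q g + tol k" if q: "q \<in> grid k" for q
  proof (rule tendsto_le_INFM)
    show "(\<lambda>n. grid_value k p (f n)) \<longlonglongrightarrow> grid_value k p g" by (rule conv[OF pg])
    show "(\<lambda>n. grid_value k q (f n) + tol k) \<longlonglongrightarrow> grid_value k q g + tol k" by (intro tendsto_intros conv[OF q])
    show "\<exists>\<^sub>\<infinity>n. grid_value k p (f n) \<le> grid_value k q (f n) + tol k"
      using inf by (rule INFM_mono) (use q in blast)
  qed
  then show ?thesis using p g by (auto simp: almost_min_def space_PiM PiE_def)
qed

text \<open>By independence both joint laws are products of their marginals, so weak convergence of
  each block sum suffices.\<close>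

lemma almost_min_limsup:
  assumes k: "k > 0" and \<epsilon>: "\<epsilon> > 0"
  shows "\<forall>\<^sub>F n in sequentially.
    measure (M n) {\<omega>\<in>space (M n). (\<lambda>j\<in>index k. block_sum n k j \<omega>) \<in> almost_min F R k}
      \<le> measure N {\<omega>\<in>space N. (\<lambda>j\<in>index k. incr k j \<omega>) \<in> almost_min F R k} + \<epsilon>"
proof -
  have "(True, 0) \<in> index k" using k by simp
  then have ne: "index k \<noteq> {}" by blast
  have 1: "measure (M n) {\<omega>\<in>space (M n). (\<lambda>j\<in>index k. block_sum n k j \<omega>) \<in> almost_min F R k} =
    measure (PiM (index k) (\<lambda>j. distr (M n) borel (block_sum n k j))) (almost_min F R k)" for n
  proof -
    have "distr (M n) (PiM (index k) (\<lambda>_. borel)) (\<lambda>\<omega>. \<lambda>j\<in>index k. block_sum n k j \<omega>) = PiM (index k) (\<lambda>j. distr (M n) borel (block_sum n k j))"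
      by (rule iffD1[OF prob_space.indep_vars_iff_distr_eq_PiM'[OF M ne]]) (rule block_sum_meas block_sum_indep)+
    then show ?thesis
      by (subst (asm) eq_commute) (simp, subst measure_distr[OF _ almost_min_sets],
        auto intro!: measurable_restrict block_sum_meas arg_cong[where f = "measure (M n)"])
  qed
  have 2: "measure N {\<omega>\<in>space N. (\<lambda>j\<in>index k. incr k j \<omega>) \<in> almost_min F R k} =
    measure (PiM (index k) (\<lambda>j. distr N borel (incr k j))) (almost_min F R k)"
  proof -
    have "distr N (PiM (index k) (\<lambda>_. borel)) (\<lambda>\<omega>. \<lambda>j\<in>index k. incr k j \<omega>) = PiM (index k) (\<lambda>j. distr N borel (incr k j))"
      by (rule iffD1[OF indep_vars_iff_distr_eq_PiM'[OF ne]]) (rule incr_measurable incr_indep_dyadic)+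
    then show ?thesis
      by (subst (asm) eq_commute) (simp, subst measure_distr[OF _ almost_min_sets],
        auto intro!: measurable_restrict incr_measurable arg_cong[where f = "measure N"])
  qed
  show ?thesis unfolding 1 2
    by (rule PiM_weak_conv_limsup[OF _ _ _ block_sum_weak_conv almost_min_sets almost_min_closed \<epsilon>])
      (auto intro: real_distribution_distr[OF incr_measurable] prob_space.real_distribution_distr[OF M block_sum_meas])
qed

text \<open>Along a subsequence the almost minimizing grid points converge, and their limit minimizes the drifted path.\<close>

lemma bm_almost_min_limsup:
  assumes F: "closed F" and \<epsilon>: "\<epsilon> > 0"
  shows "\<forall>\<^sub>F k in sequentially. measure N {\<omega>\<in>space N. (\<lambda>j\<in>index k. incr k j \<omega>) \<in> almost_min F R k}
    \<le> measure N {\<omega>\<in>space N. X \<omega> \<in> F} + \<epsilon>"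
proof (rule eventually_measure_le_limsup[OF _ _ _ \<epsilon>])
  show "{\<omega>\<in>space N. (\<lambda>j\<in>index k. incr k j \<omega>) \<in> almost_min F R k} \<in> events" for k
  proof -
    have "(\<lambda>\<omega>. \<lambda>j\<in>index k. incr k j \<omega>) \<in> measurable N (PiM (index k) (\<lambda>_. borel))"
      by (intro measurable_restrict incr_measurable)
    from measurable_sets[OF this almost_min_sets[of F R k]] show ?thesis
      by (simp add: vimage_def Int_def conj_commute)
  qed
  show "{\<omega>\<in>space N. X \<omega> \<in> F} \<in> events"
    using measurable_sets[OF X_meas, of F] F by (simp add: vimage_def Int_def conj_commute)
  show "AE \<omega> in N. (\<exists>\<^sub>\<infinity>k. \<omega> \<in> {\<omega>\<in>space N. (\<lambda>j\<in>index k. incr k j \<omega>) \<in> almost_min F R k}) \<longrightarrow> \<omega> \<in> {\<omega>\<in>space N. X \<omega> \<in> F}"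
    using X_argmin AE_space
  proof eventually_elim
    case (elim \<omega>)
    have gv: "grid_value k q (\<lambda>j\<in>index k. incr k j \<omega>) = drifted (fst q) (real (snd q) / 2 ^ k) \<omega>" if "q \<in> grid k" for k q
    proof -
      have "(\<Sum>l<snd q. (\<lambda>j\<in>index k. incr k j \<omega>) (fst q, l)) = (\<Sum>l<snd q. incr k (fst q, l) \<omega>)"
        using that by (intro sum.cong) auto
      then show ?thesis using elim(1) by (simp add: grid_value_def drifted_def walk_incr)
    qed
    have dcont: "(\<lambda>n. drifted b'' (q n) \<omega>) \<longlonglongrightarrow> drifted b'' r \<omega>"
      if "q \<longlonglongrightarrow> r" "r \<ge> 0" "\<And>n. q n \<ge> 0" for b'' q r
      unfolding drifted_def using elim(1) that
      by (intro tendsto_intros continuous_on_tendsto_compose[of "{0..}" "\<lambda>t. B b'' t \<omega>"]) auto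
    define P where "P b j k \<longleftrightarrow> (b, j) \<in> near F R k \<and> (\<forall>q\<in>grid k. drifted b (real j / 2 ^ k) \<omega> \<le> drifted (fst q) (real (snd q) / 2 ^ k) \<omega> + tol k)" for b j k
    show ?case
    proof
      assume "\<exists>\<^sub>\<infinity>k. \<omega> \<in> {\<omega>\<in>space N. (\<lambda>j\<in>index k. incr k j \<omega>) \<in> almost_min F R k}"
      then have "\<exists>\<^sub>\<infinity>k. \<exists>b\<in>UNIV. \<exists>j. P b j k"
      proof (rule INFM_mono)
        fix k assume "\<omega> \<in> {\<omega>\<in>space N. (\<lambda>j\<in>index k. incr k j \<omega>) \<in> almost_min F R k}"
        then obtain p where p: "p \<in> near F R k" and q: "\<And>q. q \<in> grid k \<Longrightarrow> grid_value k p (\<lambda>j\<in>index k. incr k j \<omega>) \<le> grid_value k q (\<lambda>j\<in>index k. incr k j \<omega>) + tol k"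
          by (auto simp: almost_min_def)
        have "p \<in> grid k" using p by (simp add: near_def)
        then have "P (fst p) (snd p) k" using p q by (auto simp: P_def gv)
        then show "\<exists>b\<in>UNIV. \<exists>j. P b j k" by blast
      qed
      \<comment> \<open>Pigeonhole over the two sides.\<close>
      then obtain b where "\<exists>\<^sub>\<infinity>k. \<exists>j. P b j k"
        by (subst (asm) INFM_finite_Bex_distrib) auto
      then have "infinite {k. \<exists>j. P b j k}" by (simp add: INFM_iff_infinite)
      then obtain s :: "nat \<Rightarrow> nat" where s: "strict_mono s" "\<And>i. s i \<in> {k. \<exists>j. P b j k}"
        using infinite_enumerate by blast
      then obtain j where j: "\<And>i. P b (j i) (s i)" by (simp, metis)
      define u where "u i = real (j i) / 2 ^ s i" for i
      have "u i \<in> {0..R + 1}" for i using j[of i] by (auto simp: u_def P_def near_def)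
      then obtain u0 q where u0: "u0 \<in> {0..R + 1}" and q: "strict_mono q" and uq: "(u \<circ> q) \<longlonglongrightarrow> u0"
        using compact_Icc[of 0 "R + 1"] unfolding compact_def by metis
      define t where "t = s \<circ> q"
      have t: "strict_mono t" using s(1) q by (auto simp: t_def strict_mono_def)
      have ft: "filterlim t sequentially sequentially" using t by (rule filterlim_subseq)
      have Pt: "P b (j (q i)) (t i)" for i using j by (simp add: t_def)
      have ulim: "(\<lambda>i. real (j (q i)) / 2 ^ t i) \<longlonglongrightarrow> u0" using uq by (simp add: u_def[abs_def] t_def comp_def)
      have tolt: "(\<lambda>i. tol (t i)) \<longlonglongrightarrow> 0" using filterlim_compose[OF tol_tendsto ft] by simp
      have "drifted b u0 \<omega> \<le> drifted b' r \<omega>" if r: "r \<ge> 0" for b' r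
      proof (rule tendsto_le[OF sequentially_bot])
        \<comment> \<open>Rounded down to the grid of level \<open>t i\<close>, the competitor r
          lies within the horizon of that grid as soon as t i >= r.\<close>
        define f where "f i = real (nat \<lfloor>r * 2 ^ t i\<rfloor>) / 2 ^ t i" for i
        have fl: "f \<longlonglongrightarrow> r" unfolding f_def by (rule filterlim_compose[OF dyadic_floor_tendsto[OF r] ft])
        have f0: "f i \<ge> 0" for i unfolding f_def by (rule divide_nonneg_pos) simp_all
        have "(\<lambda>i. drifted b' (f i) \<omega> + tol (t i)) \<longlonglongrightarrow> drifted b' r \<omega> + 0"
          by (intro tendsto_add dcont[OF fl r f0] tolt)
        then show "(\<lambda>i. drifted b' (f i) \<omega> + tol (t i)) \<longlonglongrightarrow> drifted b' r \<omega>" by simp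
        show "(\<lambda>i. drifted b (real (j (q i)) / 2 ^ t i) \<omega>) \<longlonglongrightarrow> drifted b u0 \<omega>"
          using u0 by (intro dcont[OF ulim]) auto
        have "\<forall>\<^sub>F i in sequentially. t i \<ge> nat \<lceil>r\<rceil>" using ft unfolding filterlim_at_top by blast
        then show "\<forall>\<^sub>F i in sequentially. drifted b (real (j (q i)) / 2 ^ t i) \<omega> \<le> drifted b' (f i) \<omega> + tol (t i)"
        proof eventually_elim
          case (elim i)
          have "r \<le> real (t i)" using elim by linarith
          then have "r * 2 ^ t i \<le> real (t i * 2 ^ t i)" by simp
          then have "nat \<lfloor>r * 2 ^ t i\<rfloor> \<le> t i * 2 ^ t i" by linarith
          then have "(b', nat \<lfloor>r * 2 ^ t i\<rfloor>) \<in> grid (t i)" by simp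
          then show ?case using Pt[of i] unfolding P_def f_def by fastforce
        qed
      qed
      \<comment> \<open>Uniqueness enters here: the limit point minimizes the drifted path over both
        sides, so it is the value of X.\<close>
      then have X: "X \<omega> = signed b u0" using elim(1) u0 by simp
      have "\<exists>f\<in>F. \<bar>signed b (real (j (q i)) / 2 ^ t i) - f\<bar> \<le> tol (t i)" for i
        using Pt[of i] by (cases b) (simp_all add: P_def near_def)
      \<comment> \<open>The points of \<open>F\<close> that accompany the grid points have the same
        limit, and it lies in \<open>F\<close> because \<open>F\<close> is closed.\<close>
      then obtain f where f: "\<And>i. f i \<in> F" "\<And>i. \<bar>signed b (real (j (q i)) / 2 ^ t i) - f i\<bar> \<le> tol (t i)" by metis
      have sl: "(\<lambda>i. signed b (real (j (q i)) / 2 ^ t i)) \<longlonglongrightarrow> signed b u0"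
        using ulim by (cases b) (auto intro: tendsto_minus)
      have "(\<lambda>i. signed b (real (j (q i)) / 2 ^ t i) - f i) \<longlonglongrightarrow> 0"
        by (rule Lim_null_comparison[OF _ tolt]) (use f(2) in auto)
      from tendsto_diff[OF sl this] have "f \<longlonglongrightarrow> signed b u0" by simp
      then have "signed b u0 \<in> F" using closed_sequentially[OF F] f(1) by blast
      then show "\<omega> \<in> {\<omega>\<in>space N. X \<omega> \<in> F}" using X elim(2) by simp
    qed
  qed
qed

text \<open>Off the oscillation event, moving the near-minimizer to the grid point before it changes
  the walk by less than tol / 4, hence the criterion by less than tol / 2; the plug-in error takes
  the other tol / 2. The distance to \<open>F\<close> splits likewise into the mesh and the rounding
  error \<open>e\<close>, at most tol / 2 each.\<close>

lemma near_min_imp_almost_min: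
  assumes k: "R + 1 < real k" "1 / 2 ^ k \<le> tol k / 2"
  shows "\<forall>\<^sub>F n in sequentially. {\<omega>\<in>Good n. r n \<omega> \<in> F \<and> \<bar>r n \<omega>\<bar> \<le> R} \<subseteq>
    osc n k \<union> {\<omega>\<in>space (M n). (\<lambda>j\<in>index k. block_sum n k j \<omega>) \<in> almost_min F R k}"
proof -
  \<comment> \<open>Bounds the bracket multiplied by \<open>\<rho>\<close>: the minimizer has time
    at most R + 1 and grid competitors have time at most k.\<close>
  define C where "C = R + 1 + sqrt (R + 1) + real k + sqrt (real k)"
  have "(\<lambda>n. \<rho> n * C) \<longlonglongrightarrow> 0 * C" by (intro tendsto_intros \<rho>(2))
  then have "\<forall>\<^sub>F n in sequentially. \<rho> n * C < tol k / 2" by (rule order_tendstoD) (use tol_pos[of k] in simp)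
  moreover have "\<forall>\<^sub>F n in sequentially. e n < tol k / 2" using e by (rule order_tendstoD) (use tol_pos[of k] in simp)
  moreover have "\<forall>\<^sub>F n in sequentially. e n < 1" using e by (rule order_tendstoD) simp
  ultimately show ?thesis using eventually_knot_less[of k True] eventually_knot_less[of k False]
  proof eventually_elim
    case (elim n)
    have an: "a n > 0" by (rule a)
    have kL: "knot n k j < L n b" if "j \<le> k * 2 ^ k" for j b using elim(4,5) that by (cases b) auto
    show ?case
    proof (rule subsetI, rule ccontr)
      fix \<omega> assume w: "\<omega> \<in> {\<omega>\<in>Good n. r n \<omega> \<in> F \<and> \<bar>r n \<omega>\<bar> \<le> R}"
        and no: "\<omega> \<notin> osc n k \<union> {\<omega>\<in>space (M n). (\<lambda>j\<in>index k. block_sum n k j \<omega>) \<in> almost_min F R k}"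
      have sp: "\<omega> \<in> space (M n)" using w sets.sets_into_space[OF Good(1)] by blast
      from w obtain b m where m: "m \<le> L n b" "\<bar>r n \<omega> - signed b (a n * real m)\<bar> \<le> e n"
        and min: "\<And>b' m'. m' < L n b' \<Longrightarrow> a n * real m - 2 * walk n b m \<omega> \<le> a n * real m' - 2 * walk n b' m' \<omega>
        + \<rho> n * (a n * real m + sqrt (a n * real m) + a n * real m' + sqrt (a n * real m'))"
        using near_min[of \<omega> n] unfolding walk_def by blast
      define u where "u = a n * real m"
      have u0: "u \<ge> 0" using an by (simp add: u_def)
      have "u \<le> \<bar>r n \<omega>\<bar> + e n" using m(2) u0 by (auto simp: u_def split: if_splits)
      then have uR: "u \<le> R + 1" using w elim(3) by simp
      define j where "j = nat \<lfloor>u * 2 ^ k\<rfloor>"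
      have j1: "real j \<le> u * 2 ^ k" unfolding j_def using u0 by (intro of_nat_floor) simp
      have j2: "u * 2 ^ k < real (Suc j)" unfolding j_def by linarith
      have jk: "j < k * 2 ^ k"
      proof -
        have "real j < real k * 2 ^ k"
          by (rule le_less_trans[OF j1]) (use uR k(1) in simp)
        then have "real j < real (k * 2 ^ k)" by simp
        then show ?thesis by (simp only: of_nat_less_iff)
      qed
      have ju: "real j / 2 ^ k \<le> u" "u - 1 / 2 ^ k \<le> real j / 2 ^ k"
      proof -
        show "real j / 2 ^ k \<le> u" using j1 by (simp add: field_simps)
        have "u \<le> real (Suc j) / 2 ^ k" using j2 by (simp add: field_simps)
        then show "u - 1 / 2 ^ k \<le> real j / 2 ^ k" by (simp add: add_divide_distrib)
      qed
      have g1: "knot n k j \<le> m"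
      proof -
        have "a n * real (knot n k j) \<le> a n * real m" using knot_le'[of n k j] ju(1) by (simp add: u_def)
        then show ?thesis using an by simp
      qed
      have g2: "m \<le> knot n k (Suc j)"
      proof -
        have "real m \<le> real (Suc j) / (2 ^ k * a n)" using j2 an by (simp add: u_def field_simps)
        then show ?thesis unfolding knot_def by (simp add: le_nat_floor)
      qed
      have walk_split: "walk n b m \<omega> = walk n b (knot n k j) \<omega> + (\<Sum>i<m - knot n k j. Y n (b, knot n k j + i) \<omega>)"
      proof -
        have "(\<Sum>i<c + d. f i) = (\<Sum>i<c. f i) + (\<Sum>i<d. f (c + i))" for f :: "nat \<Rightarrow> real" and c d
          by (induction d) auto
        from this[of _ "knot n k j" "m - knot n k j"] show ?thesis unfolding walk_def using g1 by simp
      qed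
      have "\<not> 2 * (tol k / 8) \<le> \<bar>\<Sum>i<m - knot n k j. Y n (b, knot n k j + i) \<omega>\<bar>"
      proof
        assume *: "2 * (tol k / 8) \<le> \<bar>\<Sum>i<m - knot n k j. Y n (b, knot n k j + i) \<omega>\<bar>"
        have "\<omega> \<in> osc n k" unfolding osc_def mem_Collect_eq
        proof (intro conjI sp bexI[of _ "(b, j)"] exI[of _ "m - knot n k j"])
          show "m - knot n k j \<le> knot n k (Suc (snd (b, j))) - knot n k (snd (b, j))" using g2 by simp
        qed (use * jk in auto)
        then show False using no by simp
      qed
      then have osc: "\<bar>walk n b m \<omega> - walk n b (knot n k j) \<omega>\<bar> < tol k / 4"
        using walk_split by simp
      let ?x = "\<lambda>j\<in>index k. block_sum n k j \<omega>"
      have gv: "grid_value k q ?x = real (snd q) / 2 ^ k - 2 * walk n (fst q) (knot n k (snd q)) \<omega>" if q: "q \<in> grid k" for q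
      proof -
        have "(\<Sum>l<snd q. ?x (fst q, l)) = (\<Sum>l<snd q. block_sum n k (fst q, l) \<omega>)"
          using q by (intro sum.cong) auto
        also have "\<dots> = walk n (fst q) (knot n k (snd q)) \<omega>"
          by (rule sum_block_sum) (use q in \<open>auto intro!: less_imp_le[OF kL]\<close>)
        finally show ?thesis by (simp add: grid_value_def)
      qed
      have p: "(b, j) \<in> grid k" using jk by simp
      have "(b, j) \<in> near F R k"
      proof -
        have "\<bar>signed b (real j / 2 ^ k) - r n \<omega>\<bar> \<le> tol k"
          using m(2) ju k(2) elim(2) unfolding u_def[symmetric] by (cases b) (auto simp: abs_le_iff)
        then show ?thesis unfolding near_def using p ju(1) uR w by (auto intro!: bexI[of _ "r n \<omega>"])
      qed
      moreover have "grid_value k (b, j) ?x \<le> grid_value k q ?x + tol k" if q: "q \<in> grid k" for q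
      proof -
        define m' where "m' = knot n k (snd q)"
        have m'L: "m' < L n (fst q)" unfolding m'_def by (rule kL) (use q in auto)
        have am': "a n * real m' \<le> real (snd q) / 2 ^ k" unfolding m'_def by (rule knot_le')
        have "snd q \<le> k * 2 ^ k" using q by auto
        then have "real (snd q) \<le> real (k * 2 ^ k)" by (simp only: of_nat_le_iff)
        then have qk: "real (snd q) / 2 ^ k \<le> real k" by (simp add: field_simps)
        have "\<rho> n * (u + sqrt u + a n * real m' + sqrt (a n * real m')) \<le> \<rho> n * C"
          unfolding C_def using uR am' qk \<rho>(1)[of n] by (intro mult_left_mono add_mono real_sqrt_le_mono) auto
        moreover have "walk n b m \<omega> - walk n b (knot n k j) \<omega> < tol k / 4" using osc by linarith
        moreover have "grid_value k (b, j) ?x = real j / 2 ^ k - 2 * walk n b (knot n k j) \<omega>" using gv[OF p] by simp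
        ultimately show ?thesis
          using min[OF m'L] am' ju(1) elim(1) gv[OF q] unfolding u_def[symmetric] m'_def[symmetric] by linarith
      qed
      ultimately have "?x \<in> almost_min F R k"
        unfolding almost_min_def by (auto simp: space_PiM)
      then show False using no sp by simp
    qed
  qed
qed

section \<open>Weak convergence of the near-minimizer\<close>

lemma eventually_tol: "\<forall>\<^sub>F k in sequentially. (1::real) / 2 ^ k \<le> tol k / 2"
  unfolding tol_def by real_asymp

theorem limsup_measure_le:
  assumes F: "closed F" and \<epsilon>: "\<epsilon> > 0"
  shows "\<forall>\<^sub>F n in sequentially. measure (M n) {\<omega>\<in>space (M n). r n \<omega> \<in> F} \<le> measure N {\<omega>\<in>space N. X \<omega> \<in> F} + \<epsilon>"
proof -
  \<comment> \<open>Five sources of error: the complement of \<open>Good\<close>, escape beyond R,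
    oscillation, the limit in n at fixed k, and the limit in k. R is fixed before k, and k before
    n.\<close>
  define d where "d = \<epsilon> / 5"
  have d: "d > 0" using \<epsilon> by (simp add: d_def)
  obtain R where R: "\<forall>\<^sub>F n in sequentially. measure (M n) {\<omega>\<in>Good n. \<bar>r n \<omega>\<bar> > R} \<le> d" using tight[OF d] by blast
  have "\<forall>\<^sub>F k in sequentially. R + 1 < real k" using filterlim_real_sequentially by (simp add: filterlim_at_top_dense)
  moreover have "\<forall>\<^sub>F k in sequentially. osc_bound k < d" using osc_bound_tendsto by (rule order_tendstoD) (rule d)
  moreover have "\<forall>\<^sub>F k in sequentially. k > 0" by (rule eventually_gt_at_top)
  ultimately have "\<forall>\<^sub>F k in sequentially. R + 1 < real k \<and> (1::real) / 2 ^ k \<le> tol k / 2 \<and> k > 0 \<and> osc_bound k < d \<and>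
    measure N {\<omega>\<in>space N. (\<lambda>j\<in>index k. incr k j \<omega>) \<in> almost_min F R k} \<le> measure N {\<omega>\<in>space N. X \<omega> \<in> F} + d"
    using eventually_tol bm_almost_min_limsup[OF F d, of R] by eventually_elim blast
  then obtain k where k: "R + 1 < real k" "(1::real) / 2 ^ k \<le> tol k / 2" "k > 0" "osc_bound k < d"
    "measure N {\<omega>\<in>space N. (\<lambda>j\<in>index k. incr k j \<omega>) \<in> almost_min F R k} \<le> measure N {\<omega>\<in>space N. X \<omega> \<in> F} + d"
    using eventually_happens'[OF sequentially_bot] by blast
  have "\<forall>\<^sub>F n in sequentially. measure (M n) (Good n) > 1 - d" using Good(2) by (rule order_tendstoD) (use d in simp)
  then show ?thesis using R osc_measure[of k] near_min_imp_almost_min[OF k(1,2), of F] almost_min_limsup[OF k(3) d, of F R]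
  proof eventually_elim
    case (elim n)
    interpret Mn: prob_space "M n" by (rule M)
    define A1 where "A1 = space (M n) - Good n"
    define A2 where "A2 = {\<omega>\<in>Good n. \<bar>r n \<omega>\<bar> > R}"
    define A3 where "A3 = {\<omega>\<in>space (M n). (\<lambda>j\<in>index k. block_sum n k j \<omega>) \<in> almost_min F R k}"
    have A1: "A1 \<in> sets (M n)" using Good(1)[of n] by (simp add: A1_def)
    have A2: "A2 \<in> sets (M n)"
    proof -
      note r_meas[measurable]
      have "A2 = Good n \<inter> {\<omega>\<in>space (M n). \<bar>r n \<omega>\<bar> > R}"
        using sets.sets_into_space[OF Good(1)] by (auto simp: A2_def)
      also have "\<dots> \<in> sets (M n)" using Good(1)[of n] by measurable
      finally show ?thesis .
    qed
    have A3: "A3 \<in> sets (M n)"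
    proof -
      have "(\<lambda>\<omega>. \<lambda>j\<in>index k. block_sum n k j \<omega>) \<in> measurable (M n) (PiM (index k) (\<lambda>_. borel))"
        by (intro measurable_restrict block_sum_meas)
      from measurable_sets[OF this almost_min_sets[of F R k]] show ?thesis
        by (simp add: A3_def vimage_def Int_def conj_commute)
    qed
    have O: "osc n k \<in> sets (M n)" using elim(3) by blast
    have "{\<omega>\<in>space (M n). r n \<omega> \<in> F} \<subseteq> (A1 \<union> A2) \<union> (osc n k \<union> A3)"
    proof
      fix \<omega> assume w: "\<omega> \<in> {\<omega>\<in>space (M n). r n \<omega> \<in> F}"
      show "\<omega> \<in> (A1 \<union> A2) \<union> (osc n k \<union> A3)"
      proof (cases "\<omega> \<in> Good n \<and> \<bar>r n \<omega>\<bar> \<le> R")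
        case True
        then have "\<omega> \<in> {\<omega>\<in>Good n. r n \<omega> \<in> F \<and> \<bar>r n \<omega>\<bar> \<le> R}" using w by simp
        then show ?thesis using elim(4) by (auto simp: A3_def)
      qed (use w in \<open>auto simp: A1_def A2_def\<close>)
    qed
    then have "measure (M n) {\<omega>\<in>space (M n). r n \<omega> \<in> F} \<le> measure (M n) ((A1 \<union> A2) \<union> (osc n k \<union> A3))"
      by (rule Mn.finite_measure_mono) (use A1 A2 A3 O in auto)
    also have "\<dots> \<le> (measure (M n) A1 + measure (M n) A2) + (measure (M n) (osc n k) + measure (M n) A3)"
      using A1 A2 A3 O by (intro order_trans[OF measure_Un_le] add_mono measure_Un_le) auto
    also have "measure (M n) A1 \<le> d" using elim(1) Mn.prob_compl[OF Good(1)] by (simp add: A1_def)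
    also have "measure (M n) A2 \<le> d" using elim(2) by (simp add: A2_def)
    also have "measure (M n) (osc n k) \<le> d" using elim(3) k(4) by linarith
    also have "measure (M n) A3 \<le> measure N {\<omega>\<in>space N. X \<omega> \<in> F} + d + d" using elim(5) k(5) by (simp add: A3_def)
    finally show ?case by (simp add: d_def)
  qed
qed

text \<open>The closed half-lines up to x and from x bound the distribution function from above and
  from below. They overlap in the atom at x, which has limiting probability zero at a continuity
  point.\<close>

theorem weak_conv: "weak_conv_m (\<lambda>n. distr (M n) borel (r n)) (distr N borel X)"
  unfolding weak_conv_m_def weak_conv_def
proof (intro allI impI)
  fix x assume "isCont (cdf (distr N borel X)) x"
  interpret X: real_distribution "distr N borel X" by (rule real_distribution_distr[OF X_meas])
  have "measure (distr N borel X) {x} = 0" using \<open>isCont _ x\<close> X.isCont_cdf by blast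
  then have "prob {\<omega>\<in>space N. X \<omega> = x} = 0"
    using X_meas by (simp add: measure_distr vimage_def Int_def conj_commute)
  have cX: "cdf (distr N borel X) x = prob {\<omega>\<in>space N. X \<omega> \<in> {..x}}"
    using X_meas by (simp add: cdf_def measure_distr vimage_def Int_def conj_commute)
  have ge: "prob {\<omega>\<in>space N. X \<omega> \<in> {x..}} = 1 - cdf (distr N borel X) x"
  proof -
    note X_meas[measurable]
    have "prob {\<omega>\<in>space N. X \<omega> \<in> {x..}} = prob {\<omega>\<in>space N. X \<omega> \<in> {x<..}} + prob {\<omega>\<in>space N. X \<omega> = x}"
      by (subst finite_measure_Union[symmetric]) (auto intro!: arg_cong[where f = prob])
    also have "{\<omega>\<in>space N. X \<omega> \<in> {x<..}} = space N - {\<omega>\<in>space N. X \<omega> \<in> {..x}}" by auto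
    also have "prob \<dots> = 1 - prob {\<omega>\<in>space N. X \<omega> \<in> {..x}}" by (rule prob_compl) measurable
    finally show ?thesis using \<open>prob {\<omega>\<in>space N. X \<omega> = x} = 0\<close> cX by simp
  qed
  have cr: "cdf (distr (M n) borel (r n)) x = measure (M n) {\<omega>\<in>space (M n). r n \<omega> \<in> {..x}}" for n
    using r_meas[of n] by (simp add: cdf_def measure_distr vimage_def Int_def conj_commute)
  show "(\<lambda>n. cdf (distr (M n) borel (r n)) x) \<longlonglongrightarrow> cdf (distr N borel X) x"
  proof (rule tendstoI)
    fix \<epsilon> :: real assume "\<epsilon> > 0"
    then have d: "\<epsilon> / 2 > 0" by simp
    show "\<forall>\<^sub>F n in sequentially. dist (cdf (distr (M n) borel (r n)) x) (cdf (distr N borel X) x) < \<epsilon>"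
      using limsup_measure_le[OF closed_atMost[of x] d] limsup_measure_le[OF closed_atLeast[of x] d]
    proof eventually_elim
      case (elim n)
      interpret Mn: prob_space "M n" by (rule M)
      note r_meas[measurable]
      have "1 - measure (M n) {\<omega>\<in>space (M n). r n \<omega> \<in> {..x}} = measure (M n) (space (M n) - {\<omega>\<in>space (M n). r n \<omega> \<in> {..x}})"
        by (rule Mn.prob_compl[symmetric]) measurable
      also have "\<dots> \<le> measure (M n) {\<omega>\<in>space (M n). r n \<omega> \<in> {x..}}"
        by (rule Mn.finite_measure_mono) auto
      finally show ?case using elim \<open>\<epsilon> > 0\<close> unfolding cr cX[symmetric] ge dist_real_def by (simp add: abs_less_iff)
    qed
  qed
qed

end

section \<open>Quadratic forms of the noise\<close>

lemma quad_form_sum: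
  assumes "A \<in> carrier_mat p p"
  shows "quad_form p A v = (\<Sum>i<p. v i * (\<Sum>j<p. A $$ (i, j) * v j))"
  using assms by (simp add: quad_form_def scalar_prod_def mult_mat_vec_def lessThan_atLeast0)

lemma norm2_sq: "(norm2 p v)\<^sup>2 = (\<Sum>j<p. (v j)\<^sup>2)"
  by (simp add: norm2_def L2_set_def sum_nonneg)

lemma norm2_nonneg: "norm2 p v \<ge> 0"
  by (simp add: norm2_def)

lemma dot_self: "dot p v v = (norm2 p v)\<^sup>2"
  unfolding dot_def norm2_sq by (simp add: power2_eq_square)

lemma dot_le_norm2: "\<bar>dot p u v\<bar> \<le> norm2 p u * norm2 p v"
proof -
  have "\<bar>dot p u v\<bar> \<le> (\<Sum>j<p. \<bar>u j\<bar> * \<bar>v j\<bar>)"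
    unfolding dot_def by (rule order_trans[OF sum_abs]) (simp add: abs_mult)
  also have "\<dots> \<le> norm2 p u * norm2 p v" unfolding norm2_def by (rule L2_set_mult_ineq)
  finally show ?thesis .
qed

lemma finite_eigenvalues:
  fixes A :: "real mat"
  assumes "A \<in> carrier_mat p p"
  shows "finite {k. eigenvalue A k}"
proof -
  have "char_poly A \<noteq> 0" using degree_monic_char_poly[OF assms] by (metis coeff_0 zero_neq_one)
  then have "finite {k. poly (char_poly A) k = 0}" by (rule poly_roots_finite)
  then show ?thesis by (simp add: eigenvalue_root_char_poly[OF assms])
qed

text \<open>First-order condition: with a nonzero slope b the quadratic would be negative at t = - b
  / m, where m = |c| + 1.\<close>

lemma quadratic_nonneg_linear_zero:
  fixes b c :: real
  assumes "\<And>t. 0 \<le> 2 * t * b + t\<^sup>2 * c"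
  shows "b = 0"
proof (rule ccontr)
  assume b: "b \<noteq> 0"
  define m where "m = \<bar>c\<bar> + 1"
  have m: "m > 0" "c \<le> m" by (auto simp: m_def)
  define t where "t = - b / m"
  have "2 * t * b + t\<^sup>2 * c \<le> 2 * t * b + t\<^sup>2 * m" using m by (intro add_left_mono mult_left_mono) auto
  also have "\<dots> = - (b\<^sup>2 / m)" using m by (simp add: t_def field_simps power2_eq_square)
  also have "\<dots> < 0" using b m by (simp add: zero_less_divide_iff)
  finally show False using assms[of t] by simp
qed

text \<open>A minimizer of the quadratic form on the unit sphere is an eigenvector, and the minimum is its eigenvalue.\<close>

lemma lambda_min_le_quad_form:
  assumes A: "A \<in> carrier_mat p p" and sym: "\<And>i j. i < p \<Longrightarrow> j < p \<Longrightarrow> A $$ (i, j) = A $$ (j, i)" and p: "p \<ge> 1"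
  shows "lambda_min A * (norm2 p v)\<^sup>2 \<le> quad_form p A v"
proof -
  define f where "f u = (\<Sum>i<p. u i * (\<Sum>j<p. A $$ (i, j) * u j))" for u :: "nat \<Rightarrow> real"
  define g where "g u = (\<Sum>i<p. (u i)\<^sup>2)" for u :: "nat \<Rightarrow> real"
  \<comment> \<open>The unit box in the first p coordinates, extended by zero: compact in the
    product topology on all sequences by Tychonoff's theorem.\<close>
  define C where "C = PiE UNIV (\<lambda>i. if i < p then {-1..1::real} else {0})"
  have "compactin (product_topology (\<lambda>_. euclidean) UNIV) C"
    unfolding C_def compactin_PiE by (auto simp: compactin_euclidean_iff)
  then have "compact C" by (simp add: euclidean_product_topology compactin_euclidean_iff)
  have cc: "continuous_on S (\<lambda>u. u i)" for i and S :: "(nat \<Rightarrow> real) set"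
    using continuous_on_product_coordinates[of i] by (rule continuous_on_subset) simp
  have cf: "continuous_on S f" and cg: "continuous_on S g" for S
    unfolding f_def g_def by (intro continuous_intros cc)+
  define K where "K = C \<inter> {u. g u = 1}"
  have "closed {u. g u = 1}" using cg[of UNIV] by (intro closed_Collect_eq) (auto intro: continuous_intros)
  then have "compact K" unfolding K_def using \<open>compact C\<close> by (intro compact_Int_closed)
  moreover have "(\<lambda>i. if i = 0 then 1 else 0) \<in> K"
    using p by (auto simp: K_def C_def g_def if_distrib[of "\<lambda>x. x\<^sup>2"] cong: if_cong)
  ultimately obtain u where u: "u \<in> K" "\<And>w. w \<in> K \<Longrightarrow> f u \<le> f w"
    using continuous_attains_inf[of K f] cf by blast
  have scale: "f (\<lambda>i. c * w i) = c\<^sup>2 * f w" "g (\<lambda>i. c * w i) = c\<^sup>2 * g w" for c w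
    by (simp_all add: f_def g_def sum_distrib_left power_mult_distrib power2_eq_square mult_ac)
  \<comment> \<open>By homogeneity the minimum on the sphere bounds the form at every vector. The
    normalized vector is set to zero outside the first p coordinates to lie in
    \<open>C\<close>.\<close>
  have min: "f u * g w \<le> f w" for w
  proof (cases "g w = 0")
    case True
    then have "\<And>i. i < p \<Longrightarrow> w i = 0" by (simp add: g_def sum_nonneg_eq_0_iff)
    then have "f w = 0" by (simp add: f_def)
    then show ?thesis using True by simp
  next
    case False
    have g0: "g w \<ge> 0" by (simp add: g_def sum_nonneg)
    define c where "c = 1 / sqrt (g w)"
    define w' where "w' i = (if i < p then c * w i else 0)" for i
    have fw: "f w' = f (\<lambda>i. c * w i)" "g w' = g (\<lambda>i. c * w i)" by (simp_all add: f_def g_def w'_def)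
    have c2: "c\<^sup>2 * g w = 1" using False g0 by (simp add: c_def power_divide)
    then have g1: "g w' = 1" by (simp add: fw scale)
    have "\<bar>w' i\<bar> \<le> 1" if "i < p" for i
    proof -
      have "(w' i)\<^sup>2 \<le> g w'" unfolding g_def using that by (intro member_le_sum) auto
      then show ?thesis using g1 by (simp add: abs_square_le_1)
    qed
    then have "w' \<in> C" by (auto simp: C_def w'_def abs_le_iff minus_le_iff)
    then have "f u \<le> f w'" using g1 by (intro u(2)) (simp add: K_def)
    then have "f u * g w \<le> c\<^sup>2 * f w * g w" using g0 by (simp add: fw scale mult_right_mono)
    also have "\<dots> = f w" using c2 by (simp add: mult_ac)
    finally show ?thesis .
  qed
  have gu: "g u = 1" using u(1) by (simp add: K_def)
  \<comment> \<open>The residual of the eigenvalue equation, which is half the gradient of f - f(u)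
    g at u.\<close>
  define z where "z i = (\<Sum>j<p. A $$ (i, j) * u j) - f u * u i" for i
  have z0: "z i = 0" if i: "i < p" for i
  proof (rule quadratic_nonneg_linear_zero)
    fix t :: real
    define d where "d j = (if j = i then 1 else 0 :: real)" for j
    define w where "w j = u j + t * d j" for j
    have s1: "(\<Sum>j<p. d j * x j) = x i" for x :: "nat \<Rightarrow> real"
      using i by (simp add: d_def if_distrib[of "\<lambda>y. y * _"] sum.delta cong: if_cong)
    have s2: "(\<Sum>j<p. x j * d j) = x i" for x :: "nat \<Rightarrow> real"
      using s1[of x] by (simp add: mult.commute)
    have gw: "g w = g u + 2 * t * u i + t\<^sup>2"
    proof -
      have "g w = (\<Sum>j<p. (u j)\<^sup>2 + 2 * t * (u j * d j) + t\<^sup>2 * (d j * d j))"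
        unfolding g_def w_def by (intro sum.cong refl) (simp add: power2_eq_square algebra_simps)
      also have "\<dots> = g u + 2 * t * u i + t\<^sup>2 * d i"
        by (simp only: sum.distrib g_def sum_distrib_left[symmetric] s2)
      finally show ?thesis by (simp add: d_def)
    qed
    have fw: "f w = f u + 2 * t * (\<Sum>j<p. A $$ (i, j) * u j) + t\<^sup>2 * A $$ (i, i)"
    proof -
      have in1: "(\<Sum>j<p. A $$ (k, j) * w j) = (\<Sum>j<p. A $$ (k, j) * u j) + t * A $$ (k, i)" for k
      proof -
        have "(\<Sum>j<p. A $$ (k, j) * w j) = (\<Sum>j<p. A $$ (k, j) * u j + t * (A $$ (k, j) * d j))"
          unfolding w_def by (intro sum.cong refl) (simp add: algebra_simps)
        then show ?thesis by (simp only: sum.distrib sum_distrib_left[symmetric] s2)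
      qed
      have "f w = (\<Sum>k<p. u k * (\<Sum>j<p. A $$ (k, j) * u j) + t * (A $$ (k, i) * u k)
          + t * (d k * (\<Sum>j<p. A $$ (k, j) * u j)) + t\<^sup>2 * (d k * A $$ (k, i)))"
        unfolding f_def in1 by (intro sum.cong refl) (simp add: w_def algebra_simps power2_eq_square)
      also have "\<dots> = f u + t * (\<Sum>k<p. A $$ (k, i) * u k) + t * (\<Sum>j<p. A $$ (i, j) * u j) + t\<^sup>2 * A $$ (i, i)"
        by (simp only: sum.distrib sum_distrib_left[symmetric] s1 f_def)
      also have "(\<Sum>k<p. A $$ (k, i) * u k) = (\<Sum>j<p. A $$ (i, j) * u j)"
        using sym i by (intro sum.cong) auto
      finally show ?thesis by simp
    qed
    have "0 \<le> f w - f u * g w" using min[of w] by simp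
    also have "\<dots> = 2 * t * z i + t\<^sup>2 * (A $$ (i, i) - f u)"
      unfolding fw gw gu z_def by (simp add: algebra_simps)
    finally show "0 \<le> 2 * t * z i + t\<^sup>2 * (A $$ (i, i) - f u)" .
  qed
  have "eigenvalue A (f u)"
    unfolding eigenvalue_def eigenvector_def
  proof (intro exI[of _ "Matrix.vec p u"] conjI)
    show "Matrix.vec p u \<in> carrier_vec (dim_row A)" using A by simp
    show "Matrix.vec p u \<noteq> 0\<^sub>v (dim_row A)"
    proof
      assume *: "Matrix.vec p u = 0\<^sub>v (dim_row A)"
      have "u i = 0" if "i < p" for i
        using arg_cong[OF *, of "\<lambda>x. x $ i"] that A by simp
      then have "g u = 0" by (simp add: g_def)
      then show False using gu by simp
    qed
    show "A *\<^sub>v Matrix.vec p u = f u \<cdot>\<^sub>v Matrix.vec p u"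
    proof (rule eq_vecI)
      fix i assume "i < dim_vec (f u \<cdot>\<^sub>v Matrix.vec p u)"
      then have i: "i < p" by simp
      have "(A *\<^sub>v Matrix.vec p u) $ i = (\<Sum>j<p. A $$ (i, j) * u j)"
        using A i by (simp add: scalar_prod_def lessThan_atLeast0)
      then show "(A *\<^sub>v Matrix.vec p u) $ i = (f u \<cdot>\<^sub>v Matrix.vec p u) $ i"
        using z0[OF i] i by (simp add: z_def)
    qed (use A in simp)
  qed
  then have "lambda_min A \<le> f u"
    unfolding lambda_min_def using finite_eigenvalues[OF A] by (intro Min_le) auto
  then have "lambda_min A * g v \<le> f u * g v" by (intro mult_right_mono) (auto simp: g_def sum_nonneg)
  also have "\<dots> \<le> f v" by (rule min)
  finally show ?thesis by (simp add: quad_form_sum[OF A] f_def g_def norm2_sq)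
qed

lemma subgaussian_mono:
  assumes "subgaussian M \<alpha> X" "\<bar>\<alpha>\<bar> \<le> \<bar>\<beta>\<bar>"
  shows "subgaussian M \<beta> X"
  unfolding subgaussian_def
proof (intro allI conjI)
  fix u
  show "integrable M (\<lambda>\<omega>. exp (u * X \<omega>))" by (rule subgaussian_integrable_exp[OF assms(1)])
  have "\<alpha>\<^sup>2 * u\<^sup>2 / 2 \<le> \<beta>\<^sup>2 * u\<^sup>2 / 2" using assms(2) by (intro divide_right_mono mult_right_mono) (auto simp: abs_le_square_iff)
  then show "(\<integral>\<omega>. exp (u * X \<omega>) \<partial>M) \<le> exp (\<beta>\<^sup>2 * u\<^sup>2 / 2)"
    using subgaussian_mgf_le[OF assms(1), of u] by (meson exp_le_cancel_iff order_trans)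
qed

text \<open>The definition speaks of unit vectors, so v is normalized; a vector of norm zero gives
  the constant 0.\<close>

lemma (in prob_space) subgaussian_dot:
  assumes "subgaussian_vec M p \<alpha> Z"
  shows "subgaussian M (\<alpha> * norm2 p v) (\<lambda>\<omega>. dot p (Z \<omega>) v)"
proof (cases "norm2 p v = 0")
  case True
  then have "(\<Sum>j<p. (v j)\<^sup>2) = 0" using norm2_sq[of p v] by simp
  then have "\<And>j. j < p \<Longrightarrow> v j = 0" by (simp add: sum_nonneg_eq_0_iff)
  then have "(\<lambda>\<omega>. dot p (Z \<omega>) v) = (\<lambda>_. 0)" by (simp add: dot_def)
  then show ?thesis using True by (simp add: subgaussian_def prob_space)
next
  case False
  define c where "c = norm2 p v"
  have c: "c > 0" using False norm2_nonneg[of p v] by (simp add: c_def)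
  have "norm2 p (\<lambda>j. v j / c) = 1"
  proof -
    have "(norm2 p (\<lambda>j. v j / c))\<^sup>2 = (norm2 p v)\<^sup>2 / c\<^sup>2"
      by (simp add: norm2_sq power_divide sum_divide_distrib)
    also have "\<dots> = 1" using c by (simp add: c_def)
    finally show ?thesis using norm2_nonneg[of p "\<lambda>j. v j / c"] by (simp add: power2_eq_1_iff)
  qed
  then have "subgaussian M \<alpha> (\<lambda>\<omega>. dot p (Z \<omega>) (\<lambda>j. v j / c))"
    using assms by (simp add: subgaussian_vec_def)
  from subgaussian_scale[OF this, of c] show ?thesis
    using c by (simp add: c_def[symmetric] dot_def sum_distrib_left mult.commute)
qed

lemma dot_unit: "j < p \<Longrightarrow> dot p u (\<lambda>i. if i = j then 1 else 0) = u j"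
  by (simp add: dot_def if_distrib[of "\<lambda>x. _ * x"] cong: if_cong)

lemma norm2_unit: "j < p \<Longrightarrow> norm2 p (\<lambda>i. if i = j then 1 else 0) = 1"
proof -
  assume "j < p"
  then have "(norm2 p (\<lambda>i. if i = j then 1 else 0))\<^sup>2 = 1"
    by (simp add: norm2_sq if_distrib[of "\<lambda>x. x\<^sup>2"] cong: if_cong)
  then show ?thesis using norm2_nonneg[of p "\<lambda>i. if i = j then 1 else 0"] by (simp add: power2_eq_1_iff)
qed

lemma subgaussian_coordinate:
  assumes "subgaussian_vec M p \<alpha> Z" "j < p"
  shows "subgaussian M \<alpha> (\<lambda>\<omega>. Z \<omega> j)"
proof -
  have "subgaussian M \<alpha> (\<lambda>\<omega>. dot p (Z \<omega>) (\<lambda>i. if i = j then 1 else 0))"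
    using assms norm2_unit unfolding subgaussian_vec_def by blast
  then show ?thesis by (simp add: dot_unit[OF assms(2)])
qed

lemma (in prob_space) quad_form_second_moment:
  assumes Z: "random_variable (rvec p) Z" and sg: "subgaussian_vec M p \<alpha> Z" and \<alpha>: "\<alpha> > 0"
  shows "quad_form p (second_moment_mat M p Z) v = expectation (\<lambda>\<omega>. (dot p (Z \<omega>) v)\<^sup>2)"
proof -
  have mj: "random_variable borel (\<lambda>\<omega>. Z \<omega> j)" if "j < p" for j
    using measurable_compose[OF Z measurable_component_singleton[of j]] that by simp
  have int: "integrable M (\<lambda>\<omega>. Z \<omega> i * Z \<omega> j)" if "i < p" "j < p" for i j
  proof (rule Bochner_Integration.integrable_bound)
    have sq: "integrable M (\<lambda>\<omega>. (Z \<omega> k)\<^sup>2)" if "k < p" for k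
      using subgaussian_moment(1)[OF mj[OF that] subgaussian_coordinate[OF sg that] \<alpha>, of 2] by simp
    show "integrable M (\<lambda>\<omega>. (Z \<omega> i)\<^sup>2 + (Z \<omega> j)\<^sup>2)" using sq that by simp
    show "(\<lambda>\<omega>. Z \<omega> i * Z \<omega> j) \<in> borel_measurable M" using mj that by simp
    have "\<bar>x * y\<bar> \<le> x\<^sup>2 + y\<^sup>2" for x y :: real
    proof -
      have "0 \<le> \<bar>x\<bar> * \<bar>y\<bar>" by simp
      moreover have "2 * (\<bar>x\<bar> * \<bar>y\<bar>) \<le> x\<^sup>2 + y\<^sup>2"
        using sum_squares_bound[of "\<bar>x\<bar>" "\<bar>y\<bar>"] by (simp add: mult.assoc)
      ultimately show ?thesis unfolding abs_mult by linarith
    qed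
    then show "AE \<omega> in M. norm (Z \<omega> i * Z \<omega> j) \<le> norm ((Z \<omega> i)\<^sup>2 + (Z \<omega> j)\<^sup>2)" by simp
  qed
  have "(dot p (Z \<omega>) v)\<^sup>2 = (\<Sum>i<p. \<Sum>j<p. v i * v j * (Z \<omega> i * Z \<omega> j))" for \<omega>
    by (simp add: dot_def power2_eq_square sum_product mult_ac)
  then have "expectation (\<lambda>\<omega>. (dot p (Z \<omega>) v)\<^sup>2) = expectation (\<lambda>\<omega>. \<Sum>i<p. \<Sum>j<p. v i * v j * (Z \<omega> i * Z \<omega> j))"
    by simp
  also have "\<dots> = (\<Sum>i<p. expectation (\<lambda>\<omega>. \<Sum>j<p. v i * v j * (Z \<omega> i * Z \<omega> j)))"
    by (rule Bochner_Integration.integral_sum) (intro Bochner_Integration.integrable_sum integrable_mult_right int, auto)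
  also have "\<dots> = (\<Sum>i<p. \<Sum>j<p. expectation (\<lambda>\<omega>. v i * v j * (Z \<omega> i * Z \<omega> j)))"
    by (intro sum.cong refl Bochner_Integration.integral_sum integrable_mult_right int) auto
  also have "\<dots> = (\<Sum>i<p. \<Sum>j<p. v i * v j * expectation (\<lambda>\<omega>. Z \<omega> i * Z \<omega> j))"
    by (simp only: integral_mult_right_zero)
  also have "\<dots> = quad_form p (second_moment_mat M p Z) v"
    by (subst quad_form_sum) (auto simp: second_moment_mat_def sum_distrib_left mult_ac)
  finally show ?thesis by simp
qed

section \<open>The projected criterion around the change point\<close>

text \<open>Observations are numbered by their distance from the change point \<open>k0\<close>: the pair \<open>(True, i)\<close> is
  the \<open>(i + 1)\<close>-st observation after it and \<open>(False, i)\<close> the \<open>(i + 1)\<close>-st one counted backwards.\<close>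

definition obs :: "nat \<Rightarrow> bool \<times> nat \<Rightarrow> nat" where
  "obs k0 j = (if fst j then k0 + 1 + snd j else k0 - snd j)"

definition side_length :: "nat \<Rightarrow> nat \<Rightarrow> bool \<Rightarrow> nat" where
  "side_length T k0 b = (if b then T - k0 else k0)"

definition side_shift :: "nat \<Rightarrow> bool \<Rightarrow> nat \<Rightarrow> nat" where
  "side_shift k0 b m = (if b then k0 + m else k0 - m)"

lemma obs_range: "k0 \<le> T \<Longrightarrow> snd j < side_length T k0 (fst j) \<Longrightarrow> obs k0 j \<in> {1..T}"
  by (auto simp: obs_def side_length_def split: if_splits)

lemma obs_inj: "inj_on (obs k0) {j. snd j < side_length T k0 (fst j)}"
  by (rule inj_onI) (auto simp: obs_def side_length_def prod_eq_iff split: if_splits)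

definition crit :: "nat \<Rightarrow> (nat \<Rightarrow> real) \<Rightarrow> real \<Rightarrow> real \<Rightarrow> nat \<Rightarrow> real" where
  "crit T z \<theta>1 \<theta>2 k = (\<Sum>t\<in>{1..k}. (z t - \<theta>1)\<^sup>2) + (\<Sum>t\<in>{k + 1..T}. (z t - \<theta>2)\<^sup>2)"

lemma Q_eq_crit: "Q T z \<tau> \<theta>1 \<theta>2 = 1 / real T * crit T z \<theta>1 \<theta>2 (nat \<lfloor>real T * \<tau>\<rfloor>)"
  by (simp add: Q_def crit_def distrib_left)

text \<open>The integer k is the split that the minimizer realizes. Over the open interval it is a
  floor, with rounding error below one and possibly k = 0; over the grid it is exact.\<close>

lemma projected_lse_crit:
  assumes T: "T \<ge> 2" and lse: "projected_lse T p y m1 m2 \<tau>"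
  defines "h \<equiv> \<lambda>j. m1 j - m2 j"
  defines "c \<equiv> crit T (\<lambda>t. dot p h (y t)) (dot p h m1) (dot p h m2)"
  shows "\<exists>k\<le>T - 1. \<bar>real T * \<tau> - real k\<bar> \<le> 1 \<and> (\<forall>k'\<in>{1..T - 1}. c k \<le> c k')"
proof -
  have pc: "projected_criterion T p y m1 m2 u = 1 / real T * c (nat \<lfloor>real T * u\<rfloor>)" for u
    by (simp add: projected_criterion_def Let_def Q_eq_crit c_def h_def)
  have grid: "nat \<lfloor>real T * (real k / real T)\<rfloor> = k" for k using T by simp
  have le: "c k \<le> c k'" if "1 / real T * c k \<le> 1 / real T * c k'" for k k'
    using that T by (simp add: divide_le_cancel)
  from lse consider
    "is_arg_min (projected_criterion T p y m1 m2) (\<lambda>u. u \<in> {0<..<1}) \<tau>"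
    | "is_arg_min (projected_criterion T p y m1 m2) (\<lambda>u. u \<in> (\<lambda>k. real k / real T) ` {1..T - 1}) \<tau>"
    by (auto simp: projected_lse_def)
  then show ?thesis
  proof cases
    case 1
    then have \<tau>: "0 < \<tau>" "\<tau> < 1" and min: "\<And>u. u \<in> {0<..<1} \<Longrightarrow> projected_criterion T p y m1 m2 \<tau> \<le> projected_criterion T p y m1 m2 u"
      by (auto simp: is_arg_min_linorder)
    define k where "k = nat \<lfloor>real T * \<tau>\<rfloor>"
    have pos: "0 \<le> real T * \<tau>" "real T * \<tau> < real T" using \<tau> T by auto
    then have "real k \<le> real T * \<tau>" "real T * \<tau> < real k + 1" unfolding k_def by linarith+
    moreover from this pos have "k < T" by linarith
    moreover have "c k \<le> c k'" if k': "k' \<in> {1..T - 1}" for k'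
    proof -
      have "real k' / real T \<in> {0<..<1}" using k' T by (auto simp: field_simps)
      from min[OF this] show ?thesis unfolding pc grid k_def by (rule le)
    qed
    ultimately show ?thesis by (intro exI[of _ k]) auto
  next
    case 2
    then obtain k where k: "k \<in> {1..T - 1}" "\<tau> = real k / real T"
      and min: "\<And>u. u \<in> (\<lambda>k. real k / real T) ` {1..T - 1} \<Longrightarrow> projected_criterion T p y m1 m2 \<tau> \<le> projected_criterion T p y m1 m2 u"
      by (auto simp: is_arg_min_linorder)
    have "c k \<le> c k'" if k': "k' \<in> {1..T - 1}" for k'
    proof -
      have "projected_criterion T p y m1 m2 \<tau> \<le> projected_criterion T p y m1 m2 (real k' / real T)"
        by (rule min) (use k' in blast)
      then show ?thesis unfolding pc k(2) grid by (rule le)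
    qed
    then show ?thesis using k T by (intro exI[of _ k]) auto
  qed
qed

text \<open>Moving the split by one position reassigns a single observation from one fitted mean to
  the other; moving it to the left reverses the sign.\<close>

lemma crit_shift:
  assumes k0: "k0 \<le> T" and m: "m \<le> side_length T k0 b"
  shows "crit T z \<theta>1 \<theta>2 (side_shift k0 b m) - crit T z \<theta>1 \<theta>2 k0 =
    signed b (\<Sum>i<m. (z (obs k0 (b, i)) - \<theta>1)\<^sup>2 - (z (obs k0 (b, i)) - \<theta>2)\<^sup>2)"
proof -
  define g where "g t = (z t - \<theta>1)\<^sup>2 - (z t - \<theta>2)\<^sup>2" for t
  have step: "crit T z \<theta>1 \<theta>2 (Suc k) = crit T z \<theta>1 \<theta>2 k + g (Suc k)" if "k < T" for k
    using that by (simp add: crit_def g_def sum.atLeast_Suc_atMost[of "Suc k"])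
  show ?thesis
  proof (cases b)
    case True
    have "m \<le> T - k0 \<Longrightarrow> crit T z \<theta>1 \<theta>2 (k0 + m) - crit T z \<theta>1 \<theta>2 k0 = (\<Sum>i<m. g (k0 + 1 + i))"
    proof (induction m)
      case (Suc m)
      then show ?case using step[of "k0 + m"] by simp
    qed simp
    then show ?thesis using True m by (simp add: side_length_def side_shift_def obs_def g_def)
  next
    case False
    have "m \<le> k0 \<Longrightarrow> crit T z \<theta>1 \<theta>2 (k0 - m) - crit T z \<theta>1 \<theta>2 k0 = - (\<Sum>i<m. g (k0 - i))"
    proof (induction m)
      case (Suc m)
      then have "Suc (k0 - Suc m) = k0 - m" by simp
      then show ?case using Suc step[of "k0 - Suc m"] k0 by simp
    qed simp
    then show ?thesis using False m by (simp add: side_length_def side_shift_def obs_def g_def)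
  qed
qed

lemma dot_diff_right: "dot p u (\<lambda>j. v j - w j) = dot p u v - dot p u w"
  by (simp add: dot_def right_diff_distrib sum_subtractf)

lemma dot_commute: "dot p u v = dot p v u"
  by (simp add: dot_def mult.commute)

text \<open>Factoring the difference of squares extracts the difference of the fitted projected
  means, which is |h|^2. What remains is the drift |h|^2, a correction for the estimation error in
  the mean of that side, and twice the projected noise.\<close>

lemma crit_increment:
  fixes m1 m2 mu1 mu2 eps :: "nat \<Rightarrow> real"
  assumes y: "\<And>j. j < p \<Longrightarrow> y t j = (if b then mu2 j else mu1 j) + eps j"
  defines "h \<equiv> \<lambda>j. m1 j - m2 j"
  shows "signed b ((dot p h (y t) - dot p h m1)\<^sup>2 - (dot p h (y t) - dot p h m2)\<^sup>2) =
    (norm2 p h)\<^sup>2 * ((norm2 p h)\<^sup>2 + 2 * (if b then dot p h (\<lambda>j. m2 j - mu2 j) else - dot p h (\<lambda>j. m1 j - mu1 j))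
      - 2 * signed b (dot p eps h))"
proof -
  have z: "dot p h (y t) = (if b then dot p h mu2 else dot p h mu1) + dot p eps h"
    using y by (simp add: dot_def sum.distrib[symmetric] algebra_simps)
  have hh: "(norm2 p h)\<^sup>2 = dot p h m1 - dot p h m2"
    unfolding dot_self[symmetric] h_def dot_diff_right[of p "\<lambda>j. m1 j - m2 j" m1 m2] ..
  show ?thesis unfolding z hh dot_diff_right
    by (cases b) (simp_all add: power2_eq_square algebra_simps)
qed

lemma norm2_diff_le: "norm2 p (\<lambda>j. u j - v j) \<le> norm2 p u + norm2 p v"
proof -
  have "norm2 p (\<lambda>j. u j + - v j) \<le> norm2 p u + norm2 p (\<lambda>j. - v j)"
    unfolding norm2_def by (rule L2_set_triangle_ineq)
  then show ?thesis by (simp add: norm2_def L2_set_def)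
qed

text \<open>The cone condition reduces the l1 norm to the coordinates in \<open>S\<close>, where the
  Cauchy-Schwarz inequality gives the factor sqrt s.\<close>

lemma sparse_cone_l1:
  assumes d: "d \<in> sparse_cone p S c" and S: "S \<subseteq> {..<p}" "real (card S) \<le> s" and c: "c \<ge> 0"
  shows "(\<Sum>j<p. \<bar>d j\<bar>) \<le> (1 + c) * sqrt s * norm2 p d"
proof -
  have "(\<Sum>j<p. \<bar>d j\<bar>) = (\<Sum>j\<in>{..<p} - S. \<bar>d j\<bar>) + (\<Sum>j\<in>S. \<bar>d j\<bar>)"
    using S by (intro sum.subset_diff) auto
  also have "\<dots> \<le> (1 + c) * (\<Sum>j\<in>S. \<bar>d j\<bar> * \<bar>1\<bar>)" using d by (simp add: sparse_cone_def algebra_simps)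
  also have "\<dots> \<le> (1 + c) * (L2_set d S * L2_set (\<lambda>_. 1) S)" using c by (intro mult_left_mono L2_set_mult_ineq) auto
  also have "\<dots> \<le> (1 + c) * (norm2 p d * sqrt s)"
  proof (intro mult_left_mono mult_mono)
    show "L2_set d S \<le> norm2 p d"
      unfolding norm2_def L2_set_def using S by (intro real_sqrt_le_mono sum_mono2) auto
    show "L2_set (\<lambda>_. 1) S \<le> sqrt s" using S by (simp add: L2_set_def)
  qed (use c in \<open>auto simp: norm2_nonneg L2_set_nonneg\<close>)
  finally show ?thesis by (simp add: mult_ac)
qed

text \<open>The plug-in error enters the drift through \<open>rate\<close> and the noise through the \<open>l1\<close>/\<open>l\<infinity>\<close> duality;
  both contributions are absorbed in \<open>\<rho>\<close>.\<close>

lemma projected_near_min: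
  fixes y eps :: "nat \<Rightarrow> nat \<Rightarrow> real" and S :: "nat set"
  assumes y: "\<And>t j. t \<in> {1..T} \<Longrightarrow> j < p \<Longrightarrow> y t j = (if t \<le> k0 then mu1 j else mu2 j) + eps t j"
    and k0: "1 \<le> k0" "k0 < T"
    and xi: "xi = norm2 p (\<lambda>j. mu1 j - mu2 j)" "xi > 0"
    and S: "S \<subseteq> {..<p}" "real (card S) \<le> s" and c: "c \<ge> 0"
    and d1: "norm2 p (\<lambda>j. m1 j - mu1 j) \<le> rate" "(\<lambda>j. m1 j - mu1 j) \<in> sparse_cone p S c"
    and d2: "norm2 p (\<lambda>j. m2 j - mu2 j) \<le> rate" "(\<lambda>j. m2 j - mu2 j) \<in> sparse_cone p S c"
    and rate: "2 * rate < xi"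
    and noise: "\<And>b m j. m \<le> side_length T k0 b \<Longrightarrow> j < p \<Longrightarrow> \<bar>\<Sum>i<m. eps (obs k0 (b, i)) j\<bar> \<le> w * sqrt (real m)"
    and w: "w \<ge> 0" and \<sigma>: "\<sigma>2 > 0"
    and k: "k \<le> T - 1"
    and min: "\<And>k'. k' \<in> {1..T - 1} \<Longrightarrow>
      crit T (\<lambda>t. dot p (\<lambda>j. m1 j - m2 j) (y t)) (dot p (\<lambda>j. m1 j - m2 j) m1) (dot p (\<lambda>j. m1 j - m2 j) m2) k
      \<le> crit T (\<lambda>t. dot p (\<lambda>j. m1 j - m2 j) (y t)) (dot p (\<lambda>j. m1 j - m2 j) m1) (dot p (\<lambda>j. m1 j - m2 j) m2) k'"
  defines "a \<equiv> xi\<^sup>2 / \<sigma>2"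
  defines "Y \<equiv> \<lambda>j. signed (fst j) (dot p (eps (obs k0 j)) (\<lambda>j. mu1 j - mu2 j)) / \<sigma>2"
  defines "\<rho> \<equiv> 6 * (rate / xi) + 8 * (rate / xi)\<^sup>2 + 4 * (1 + c) * sqrt s * rate * w / (xi * sqrt \<sigma>2)"
  shows "\<exists>b m. m \<le> side_length T k0 b \<and> real k - real k0 = signed b (real m) \<and>
    (\<forall>b' m'. m' < side_length T k0 b' \<longrightarrow> a * real m - 2 * (\<Sum>i<m. Y (b, i)) \<le> a * real m' - 2 * (\<Sum>i<m'. Y (b', i))
      + \<rho> * (a * real m + sqrt (a * real m) + a * real m' + sqrt (a * real m')))"
proof -
  define h where "h = (\<lambda>j. m1 j - m2 j)"
  define et where "et = (\<lambda>j. mu1 j - mu2 j)"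
  define e1 where "e1 = (\<lambda>j. m1 j - mu1 j)"
  define e2 where "e2 = (\<lambda>j. m2 j - mu2 j)"
  define e where "e = (\<lambda>j. e1 j - e2 j)"
  define C where "C = crit T (\<lambda>t. dot p h (y t)) (dot p h m1) (dot p h m2)"
  \<comment> \<open>The drift of one step on side b after division by |h|^2. \<open>G\<close> below
    is the criterion increment in this normalization, and \<open>D\<close> is what
    \<open>G / \<sigma>2\<close> becomes for the true jump and means.\<close>
  define cb where "cb b = (norm2 p h)\<^sup>2 + 2 * (if b then dot p h e2 else - dot p h e1)" for b
  define G where "G b m = real m * cb b - 2 * (\<Sum>i<m. signed b (dot p (eps (obs k0 (b, i))) h))" for b and m :: nat
  have rate0: "rate \<ge> 0" using d1(1) norm2_nonneg[of p "\<lambda>j. m1 j - mu1 j"] by linarith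
  have n1: "norm2 p e1 \<le> rate" and n2: "norm2 p e2 \<le> rate" using d1(1) d2(1) by (simp_all add: e1_def e2_def)
  have ne: "norm2 p e \<le> 2 * rate" unfolding e_def using norm2_diff_le[of p e1 e2] n1 n2 by simp
  have h_eq: "h = (\<lambda>j. et j - (e2 j - e1 j))" by (auto simp: h_def et_def e1_def e2_def)
  have het: "dot p x h = dot p x et + dot p x e" for x
    by (simp add: h_eq dot_diff_right e_def)
  have nh: "norm2 p h \<le> xi + 2 * rate" "xi - 2 * rate \<le> norm2 p h"
  proof -
    have "h = (\<lambda>j. et j - (\<lambda>j. e2 j - e1 j) j)" by (simp add: h_eq)
    moreover have "norm2 p (\<lambda>j. e2 j - e1 j) \<le> 2 * rate" using norm2_diff_le[of p e2 e1] n1 n2 by simp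
    ultimately show "norm2 p h \<le> xi + 2 * rate"
      using norm2_diff_le[of p et "\<lambda>j. e2 j - e1 j"] xi(1) by (simp add: et_def)
    have "et = (\<lambda>j. h j - e j)" by (auto simp: h_eq e_def)
    then show "xi - 2 * rate \<le> norm2 p h"
      using norm2_diff_le[of p h e] ne xi(1) by (simp add: et_def)
  qed
  have h0: "norm2 p h > 0" using nh(2) rate by linarith
  \<comment> \<open>The squared norm of h contributes 4 rate xi + 4 rate^2, and twice the mean
    correction 2 rate xi + 4 rate^2.\<close>
  have cb: "\<bar>cb b - xi\<^sup>2\<bar> \<le> 6 * rate * xi + 8 * rate\<^sup>2" for b
  proof -
    have "(norm2 p h)\<^sup>2 = dot p et et + 2 * dot p et e + dot p e e"
      unfolding dot_self[symmetric] het by (simp add: dot_commute[of p h] het dot_commute[of p e et])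
    then have 1: "(norm2 p h)\<^sup>2 - xi\<^sup>2 = 2 * dot p et e + (norm2 p e)\<^sup>2" using xi(1) by (simp add: dot_self et_def)
    have 2: "\<bar>dot p et e\<bar> \<le> 2 * (rate * xi)"
    proof (rule order_trans[OF dot_le_norm2])
      have "norm2 p et = xi" using xi(1) by (simp add: et_def)
      then show "norm2 p et * norm2 p e \<le> 2 * (rate * xi)" using mult_left_mono[OF ne, of xi] xi(2) by (simp add: mult_ac)
    qed
    have "(norm2 p e)\<^sup>2 \<le> (2 * rate)\<^sup>2" using ne norm2_nonneg by (intro power_mono) auto
    then have 3: "(norm2 p e)\<^sup>2 \<le> 4 * rate\<^sup>2" by (simp add: power_mult_distrib)
    have 4: "\<bar>dot p h x\<bar> \<le> rate * xi + 2 * rate\<^sup>2" if "norm2 p x \<le> rate" for x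
    proof (rule order_trans[OF dot_le_norm2])
      have "norm2 p h * norm2 p x \<le> (xi + 2 * rate) * rate"
        using norm2_nonneg[of p x] rate0 xi(2) by (intro mult_mono[OF nh(1) that]) auto
      then show "norm2 p h * norm2 p x \<le> rate * xi + 2 * rate\<^sup>2" by (simp add: power2_eq_square algebra_simps)
    qed
    have 5: "0 \<le> (norm2 p e)\<^sup>2" by simp
    show ?thesis
    proof -
      have "\<bar>if b then dot p h e2 else - dot p h e1\<bar> \<le> rate * xi + 2 * rate\<^sup>2"
        using 4[OF n1] 4[OF n2] by (cases b) simp_all
      then show ?thesis using 1 2 3 5 unfolding cb_def mult.assoc by linarith
    qed
  qed
  have l1: "(\<Sum>j<p. \<bar>e j\<bar>) \<le> 2 * ((1 + c) * sqrt s * rate)"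
  proof -
    have s0: "s \<ge> 0" using S(2) by (rule order_trans[rotated]) simp
    have "(\<Sum>j<p. \<bar>e j\<bar>) \<le> (\<Sum>j<p. \<bar>e1 j\<bar>) + (\<Sum>j<p. \<bar>e2 j\<bar>)"
      unfolding e_def sum.distrib[symmetric] by (intro sum_mono abs_triangle_ineq4)
    also have "\<dots> \<le> (1 + c) * sqrt s * norm2 p e1 + (1 + c) * sqrt s * norm2 p e2"
      using sparse_cone_l1[OF _ S c] d1(2) d2(2) by (intro add_mono) (auto simp: e1_def e2_def)
    also have "\<dots> \<le> (1 + c) * sqrt s * rate + (1 + c) * sqrt s * rate"
      using c s0 by (intro add_mono mult_left_mono n1 n2) auto
    finally show ?thesis by (simp only: mult_2)
  qed
  have noise_e: "\<bar>(\<Sum>i<m. dot p (eps (obs k0 (b, i))) h) - (\<Sum>i<m. dot p (eps (obs k0 (b, i))) et)\<bar>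
      \<le> 2 * ((1 + c) * sqrt s * rate) * (w * sqrt (real m))" if m: "m \<le> side_length T k0 b" for b m
  proof -
    have "(\<Sum>i<m. dot p (eps (obs k0 (b, i))) h) - (\<Sum>i<m. dot p (eps (obs k0 (b, i))) et) = (\<Sum>i<m. dot p (eps (obs k0 (b, i))) e)"
      by (simp add: het sum.distrib)
    \<comment> \<open>Exchanging the sums exposes the partial sums of each coordinate, whose uniform
      bound pairs with the l1 norm of the estimation error.\<close>
    also have "\<dots> = (\<Sum>j<p. (\<Sum>i<m. eps (obs k0 (b, i)) j) * e j)"
      unfolding dot_def by (subst sum.swap) (simp add: sum_distrib_right)
    also have "\<bar>\<dots>\<bar> \<le> (\<Sum>j<p. (w * sqrt (real m)) * \<bar>e j\<bar>)"
      by (rule order_trans[OF sum_abs]) (auto simp: abs_mult intro!: sum_mono mult_right_mono noise[OF m])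
    also have "\<dots> \<le> (w * sqrt (real m)) * (2 * ((1 + c) * sqrt s * rate))"
      unfolding sum_distrib_left[symmetric] using w by (intro mult_left_mono l1) auto
    finally show ?thesis by (simp add: mult_ac)
  qed
  have Cdiff: "C (side_shift k0 b m) - C k0 = (norm2 p h)\<^sup>2 * G b m" if m: "m \<le> side_length T k0 b" for b m
  proof -
    have "C (side_shift k0 b m) - C k0 = (\<Sum>i<m. signed b ((dot p h (y (obs k0 (b, i))) - dot p h m1)\<^sup>2 - (dot p h (y (obs k0 (b, i))) - dot p h m2)\<^sup>2))"
      unfolding C_def crit_shift[OF less_imp_le[OF k0(2)] m] by (cases b) (simp_all only: if_True if_False sum_negf)
    also have "\<dots> = (\<Sum>i<m. (norm2 p h)\<^sup>2 * (cb b - 2 * signed b (dot p (eps (obs k0 (b, i))) h)))"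
    proof (rule sum.cong[OF refl])
      fix i assume i: "i \<in> {..<m}"
      have r: "obs k0 (b, i) \<in> {1..T}" by (rule obs_range) (use i m k0 in auto)
      have le: "obs k0 (b, i) \<le> k0 \<longleftrightarrow> \<not> b" by (auto simp: obs_def)
      show "signed b ((dot p h (y (obs k0 (b, i))) - dot p h m1)\<^sup>2 - (dot p h (y (obs k0 (b, i))) - dot p h m2)\<^sup>2) =
        (norm2 p h)\<^sup>2 * (cb b - 2 * signed b (dot p (eps (obs k0 (b, i))) h))"
        unfolding cb_def e1_def e2_def h_def
        by (rule crit_increment) (use y[OF r] le in auto)
    qed
    also have "\<dots> = (norm2 p h)\<^sup>2 * G b m"
      by (simp add: G_def sum_distrib_left[symmetric] sum_subtractf)
    finally show ?thesis .
  qed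
  define D where "D b m = a * real m - 2 * (\<Sum>i<m. Y (b, i))" for b and m :: nat
  have GD: "\<bar>G b m / \<sigma>2 - D b m\<bar> \<le> \<rho> * (a * real m + sqrt (a * real m))" if m: "m \<le> side_length T k0 b" for b m
  proof -
    have Ysum: "(\<Sum>i<m. Y (b, i)) = (\<Sum>i<m. signed b (dot p (eps (obs k0 (b, i))) et)) / \<sigma>2"
      unfolding Y_def et_def fst_conv sum_divide_distrib ..
    have "G b m / \<sigma>2 - D b m = (real m * (cb b - xi\<^sup>2) - 2 * ((\<Sum>i<m. signed b (dot p (eps (obs k0 (b, i))) h)) - (\<Sum>i<m. signed b (dot p (eps (obs k0 (b, i))) et)))) / \<sigma>2"
      unfolding G_def D_def Ysum a_def using \<sigma> by (simp add: field_simps)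
    also have "\<bar>\<dots>\<bar> \<le> (real m * (6 * rate * xi + 8 * rate\<^sup>2) + 2 * (2 * ((1 + c) * sqrt s * rate) * (w * sqrt (real m)))) / \<sigma>2"
    proof -
      have "\<bar>(\<Sum>i<m. signed b (dot p (eps (obs k0 (b, i))) h)) - (\<Sum>i<m. signed b (dot p (eps (obs k0 (b, i))) et))\<bar>
        \<le> 2 * ((1 + c) * sqrt s * rate) * (w * sqrt (real m))"
        using noise_e[OF m] by (cases b) (auto simp: sum_negf)
      moreover have "\<bar>real m * (cb b - xi\<^sup>2)\<bar> \<le> real m * (6 * rate * xi + 8 * rate\<^sup>2)"
        unfolding abs_mult using cb[of b] by (intro mult_mono) auto
      ultimately show ?thesis using \<sigma> unfolding abs_divide by (intro frac_le) auto
    qed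
    \<comment> \<open>In the rescaled time a m the drift error is linear, while the noise error is a
      multiple of sqrt (a m), which equals xi sqrt m / sqrt \<sigma>2.\<close>
    also have "\<dots> = (6 * (rate / xi) + 8 * (rate / xi)\<^sup>2) * (a * real m) + 4 * (1 + c) * sqrt s * rate * w / (xi * sqrt \<sigma>2) * sqrt (a * real m)"
    proof -
      have sq: "sqrt (a * real m) = xi * sqrt (real m) / sqrt \<sigma>2" using xi(2) by (simp add: a_def real_sqrt_divide real_sqrt_mult)
      have "x / (xi * q) * (xi * z / q) = x * z / (q * q)" if "q > 0" for x q z :: real
        using that xi(2) by (simp add: field_simps)
      from this[of "sqrt \<sigma>2" "4 * (1 + c) * sqrt s * rate * w" "sqrt (real m)"]
      have "4 * (1 + c) * sqrt s * rate * w / (xi * sqrt \<sigma>2) * sqrt (a * real m) = 2 * (2 * ((1 + c) * sqrt s * rate) * (w * sqrt (real m))) / \<sigma>2"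
        using \<sigma> unfolding sq by (simp add: mult_ac)
      moreover have "(6 * (rate / xi) + 8 * (rate / xi)\<^sup>2) * (a * real m) = real m * (6 * rate * xi + 8 * rate\<^sup>2) / \<sigma>2"
        using xi(2) \<sigma> by (simp add: a_def field_simps power2_eq_square)
      ultimately show ?thesis by (simp add: add_divide_distrib)
    qed
    also have "\<dots> \<le> \<rho> * (a * real m) + \<rho> * sqrt (a * real m)"
    proof (rule add_mono[OF mult_right_mono mult_right_mono])
      have "s \<ge> 0" using S(2) by (rule order_trans[rotated]) simp
      then have "0 \<le> 4 * (1 + c) * sqrt s * rate * w / (xi * sqrt \<sigma>2)"
        using rate0 xi(2) c w \<sigma> by (intro divide_nonneg_pos mult_nonneg_nonneg mult_pos_pos) auto
      moreover have "0 \<le> 6 * (rate / xi) + 8 * (rate / xi)\<^sup>2" using rate0 xi(2) by simp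
      ultimately show "6 * (rate / xi) + 8 * (rate / xi)\<^sup>2 \<le> \<rho>" "4 * (1 + c) * sqrt s * rate * w / (xi * sqrt \<sigma>2) \<le> \<rho>"
        unfolding \<rho>_def by linarith+
    qed (use \<sigma> in \<open>auto simp: a_def\<close>)
    finally show ?thesis by (simp add: distrib_left)
  qed
  define b where "b = (k \<ge> k0)"
  define m where "m = (if b then k - k0 else k0 - k)"
  have m: "m \<le> side_length T k0 b" "real k - real k0 = signed b (real m)" "side_shift k0 b m = k"
    using k k0 by (auto simp: m_def b_def side_length_def side_shift_def)
  moreover have "D b m \<le> D b' m' + \<rho> * (a * real m + sqrt (a * real m) + a * real m' + sqrt (a * real m'))"
    if m': "m' < side_length T k0 b'" for b' m'
  proof -
    \<comment> \<open>Strictness of \<open>m' < side_length T k0 b'\<close> keeps the competing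
      split inside the grid at both ends.\<close>
    have "side_shift k0 b' m' \<in> {1..T - 1}" using m' k0 by (auto simp: side_shift_def side_length_def split: if_splits)
    from min[OF this] have "C k \<le> C (side_shift k0 b' m')" by (simp add: C_def h_def)
    then have "(norm2 p h)\<^sup>2 * G b m \<le> (norm2 p h)\<^sup>2 * G b' m'"
      using Cdiff[OF m(1)] Cdiff[OF less_imp_le[OF m']] by (simp add: m(3))
    then have "G b m \<le> G b' m'" using h0 by (simp add: mult_le_cancel_left)
    then have "G b m / \<sigma>2 \<le> G b' m' / \<sigma>2" using \<sigma> by (simp add: divide_right_mono)
    then show ?thesis using GD[OF m(1)] GD[OF less_imp_le[OF m']] unfolding abs_le_iff distrib_left by linarith
  qed
  ultimately show ?thesis unfolding D_def by blast
qed

text \<open>Union bound over T p partial sums, the two sides having T positive lengths between them.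
  The constant 6 makes each tail 2 / q^3 with q = max p T, so the total is at most 2 / q, hence at
  most 2 / T.\<close>

lemma (in prob_space) noise_maximum:
  fixes eps :: "nat \<Rightarrow> 'a \<Rightarrow> nat \<Rightarrow> real"
  assumes ind: "indep_vars (\<lambda>_. rvec p) eps {1..T}"
    and sg: "\<And>t. t \<in> {1..T} \<Longrightarrow> subgaussian_vec M p \<alpha> (eps t)" and \<alpha>: "\<alpha> > 0"
    and k0: "k0 \<le> T" and T: "T \<ge> 2"
  defines "A \<equiv> {\<omega>\<in>space M. \<forall>b m j. m \<le> side_length T k0 b \<longrightarrow> j < p \<longrightarrow>
     \<bar>\<Sum>i<m. eps (obs k0 (b, i)) \<omega> j\<bar> \<le> \<alpha> * sqrt (6 * ln (real (max p T))) * sqrt (real m)}"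
  shows "A \<in> events" "prob A \<ge> 1 - 2 / real T"
proof -
  define q where "q = max p T"
  have q2: "q \<ge> 2" using T by (simp add: q_def)
  have lq: "ln (real q) > 0" using q2 by simp
  \<comment> \<open>Length m = 0 is left out: its sum and its bound are both 0, and the tail
    estimate asks for a positive threshold.\<close>
  define I where "I = (SIGMA b:UNIV. {1..side_length T k0 b}) \<times> {..<p}"
  have finI: "finite I" by (simp add: I_def)
  have cardI: "card I = T * p"
    using k0 by (simp add: I_def card_cartesian_product card_SigmaI UNIV_bool side_length_def)
  have coord: "indep_vars (\<lambda>_. borel) (\<lambda>i \<omega>. eps (obs k0 (b, i)) \<omega> j) {..<m}"
    if "m \<le> side_length T k0 b" "j < p" for b m j
  proof (rule indep_vars_inj_reindex[where X = "\<lambda>t \<omega>. eps t \<omega> j" and f = "\<lambda>i. obs k0 (b, i)"])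
    show "indep_vars (\<lambda>_. borel) (\<lambda>t \<omega>. eps t \<omega> j) {1..T}"
      by (rule indep_vars_compose2[OF ind, where Y = "\<lambda>_ x. x j"]) (use that in \<open>auto intro!: measurable_component_singleton\<close>)
    show "(\<lambda>i. obs k0 (b, i)) ` {..<m} \<subseteq> {1..T}" using obs_range[OF k0, of "(b, _)"] that(1) by auto
    show "inj_on (\<lambda>i. obs k0 (b, i)) {..<m}"
      using that(1) by (cases b) (auto simp: inj_on_def obs_def side_length_def)
  qed
  have mcoord: "random_variable borel (\<lambda>\<omega>. \<Sum>i<m. eps (obs k0 (b, i)) \<omega> j)" if "m \<le> side_length T k0 b" "j < p" for b m j
    using coord[OF that] by (intro borel_measurable_sum) (auto simp: indep_vars_def)
  define Bad where "Bad = (\<lambda>((b, m), j). {\<omega>\<in>space M. \<alpha> * sqrt (6 * ln (real q)) * sqrt (real m) \<le> \<bar>\<Sum>i<m. eps (obs k0 (b, i)) \<omega> j\<bar>})"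
  have mBad: "Bad x \<in> events" if "x \<in> I" for x
    using that mcoord unfolding Bad_def I_def by (auto intro!: borel_measurable_le borel_measurable_abs)
  have pBad: "prob (Bad x) \<le> 2 / real q ^ 3" if x: "x \<in> I" for x
  proof -
    obtain b m j where xe: "x = ((b, m), j)" by (metis prod.exhaust)
    with x have m: "1 \<le> m" "m \<le> side_length T k0 b" and j: "j < p" by (auto simp: I_def)
    have "subgaussian M (sqrt (real (card {..<m})) * \<alpha>) (\<lambda>\<omega>. \<Sum>i<m. eps (obs k0 (b, i)) \<omega> j)"
    proof (rule subgaussian_sum[OF _ coord[OF m(2) j]])
      fix i assume "i \<in> {..<m}"
      then have "obs k0 (b, i) \<in> {1..T}" using m by (intro obs_range k0) auto
      then show "subgaussian M \<alpha> (\<lambda>\<omega>. eps (obs k0 (b, i)) \<omega> j)" by (rule subgaussian_coordinate[OF sg j])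
    qed simp
    from subgaussian_tail[OF mcoord[OF m(2) j] this, of "\<alpha> * sqrt (6 * ln (real q)) * sqrt (real m)"]
    have "prob (Bad x) \<le> 2 * exp (- ((\<alpha> * sqrt (6 * ln (real q)) * sqrt (real m))\<^sup>2 / (2 * (sqrt (real m) * \<alpha>)\<^sup>2)))"
      using \<alpha> m lq by (simp add: xe Bad_def)
    also have "(\<alpha> * sqrt (6 * ln (real q)) * sqrt (real m))\<^sup>2 / (2 * (sqrt (real m) * \<alpha>)\<^sup>2) = real 3 * ln (real q)"
      using \<alpha> m lq by (simp add: power_mult_distrib)
    also have "2 * exp (- (real 3 * ln (real q))) = 2 / real q ^ 3"
    proof -
      have "exp (real 3 * ln (real q)) = real q ^ 3" using q2 by (subst exp_of_nat_mult) simp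
      then show ?thesis by (simp only: exp_minus divide_inverse)
    qed
    finally show ?thesis .
  qed
  have Aeq: "A = {\<omega>\<in>space M. \<forall>x\<in>(SIGMA b:UNIV. {..side_length T k0 b}) \<times> {..<p}.
     \<bar>\<Sum>i<snd (fst x). eps (obs k0 (fst (fst x), i)) \<omega> (snd x)\<bar> \<le> \<alpha> * sqrt (6 * ln (real q)) * sqrt (real (snd (fst x)))}"
    unfolding A_def q_def by (intro Collect_cong conj_cong refl) auto
  show A: "A \<in> events" unfolding Aeq
  proof (rule sets.sets_Collect_finite_All)
    fix x assume "x \<in> (SIGMA b:UNIV. {..side_length T k0 b}) \<times> {..<p}"
    then show "{\<omega>\<in>space M. \<bar>\<Sum>i<snd (fst x). eps (obs k0 (fst (fst x), i)) \<omega> (snd x)\<bar> \<le> \<alpha> * sqrt (6 * ln (real q)) * sqrt (real (snd (fst x)))} \<in> events"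
      using mcoord[of "snd (fst x)" "fst (fst x)" "snd x"] by (intro borel_measurable_le borel_measurable_abs) auto
  qed simp
  have "space M - A \<subseteq> (\<Union>x\<in>I. Bad x)"
  proof
    fix \<omega> assume w: "\<omega> \<in> space M - A"
    then obtain b m j where bmj: "m \<le> side_length T k0 b" "j < p"
      "\<not> \<bar>\<Sum>i<m. eps (obs k0 (b, i)) \<omega> j\<bar> \<le> \<alpha> * sqrt (6 * ln (real q)) * sqrt (real m)"
      unfolding A_def q_def by blast
    then have "m \<noteq> 0" by (intro notI) simp
    then have "((b, m), j) \<in> I" "\<omega> \<in> Bad ((b, m), j)" using bmj w by (auto simp: I_def Bad_def)
    then show "\<omega> \<in> (\<Union>x\<in>I. Bad x)" by blast
  qed
  then have "prob (space M - A) \<le> prob (\<Union>x\<in>I. Bad x)" by (rule finite_measure_mono) (use mBad finI in auto)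
  also have "\<dots> \<le> (\<Sum>x\<in>I. prob (Bad x))" by (rule finite_measure_subadditive_finite) (use mBad finI in auto)
  also have "\<dots> \<le> (\<Sum>x\<in>I. 2 / real q ^ 3)" by (intro sum_mono pBad)
  also have "\<dots> = real T * real p * (2 / real q ^ 3)" by (simp add: cardI)
  also have "\<dots> \<le> real q * real q * (2 / real q ^ 3)" by (intro mult_right_mono mult_mono) (auto simp: q_def)
  also have "\<dots> = 2 / real q" using q2 by (simp add: power3_eq_cube)
  also have "\<dots> \<le> 2 / real T" using T by (intro divide_left_mono) (auto simp: q_def)
  finally show "prob A \<ge> 1 - 2 / real T" using prob_compl[OF A] by simp
qed

section \<open>The limiting distribution\<close>

text \<open>The sign in \<open>Y\<close> reflects the exchanged roles of the two means when the
  split moves left. Identical distribution carries the second moment of the first observation to all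
  others.\<close>

lemma (in prob_space) projected_noise_row:
  fixes eps :: "nat \<Rightarrow> 'a \<Rightarrow> nat \<Rightarrow> real" and v :: "nat \<Rightarrow> real"
  assumes ind: "indep_vars (\<lambda>_. rvec p) eps {1..T}"
    and iid: "\<And>t. t \<in> {1..T} \<Longrightarrow> distr M (rvec p) (eps t) = distr M (rvec p) (eps 1)"
    and mean: "\<And>t j. t \<in> {1..T} \<Longrightarrow> j < p \<Longrightarrow> expectation (\<lambda>\<omega>. eps t \<omega> j) = 0"
    and sg: "\<And>t. t \<in> {1..T} \<Longrightarrow> subgaussian_vec M p \<alpha> (eps t)"
    and \<alpha>: "\<alpha> > 0" and k0: "k0 \<le> T" and T: "T \<ge> 1" and \<sigma>: "\<sigma>2 > 0"
  defines "Y \<equiv> \<lambda>j \<omega>. signed (fst j) (dot p (eps (obs k0 j) \<omega>) v) / \<sigma>2"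
  shows "indep_vars (\<lambda>_. borel) Y {j. snd j < side_length T k0 (fst j)}"
    and "\<And>j. snd j < side_length T k0 (fst j) \<Longrightarrow> expectation (Y j) = 0"
    and "\<And>j. snd j < side_length T k0 (fst j) \<Longrightarrow>
      expectation (\<lambda>\<omega>. (Y j \<omega>)\<^sup>2) = quad_form p (second_moment_mat M p (eps 1)) v / \<sigma>2\<^sup>2"
    and "\<And>j. snd j < side_length T k0 (fst j) \<Longrightarrow> subgaussian M (\<alpha> * norm2 p v / \<sigma>2) (Y j)"
proof -
  have Y: "Y j = (\<lambda>\<omega>. (signed (fst j) 1 / \<sigma>2) * dot p (eps (obs k0 j) \<omega>) v)" for j
    by (auto simp: Y_def)
  have dot_meas: "(\<lambda>x. dot p x v) \<in> borel_measurable (rvec p)"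
    unfolding dot_def by (intro borel_measurable_sum borel_measurable_times measurable_component_singleton) auto
  have rv: "random_variable (rvec p) (eps t)" if "t \<in> {1..T}" for t
    using ind that by (auto simp: indep_vars_def)
  have "indep_vars (\<lambda>_. borel) (\<lambda>t \<omega>. dot p (eps t \<omega>) v) {1..T}"
    by (rule indep_vars_compose2[OF ind, where Y = "\<lambda>_ x. dot p x v"]) (rule dot_meas)
  moreover have "obs k0 ` {j. snd j < side_length T k0 (fst j)} \<subseteq> {1..T}"
    using obs_range[OF k0] by blast
  ultimately have "indep_vars (\<lambda>_. borel) (\<lambda>j \<omega>. dot p (eps (obs k0 j) \<omega>) v) {j. snd j < side_length T k0 (fst j)}"
    by (rule indep_vars_inj_reindex[OF _ _ obs_inj])
  from indep_vars_compose2[OF this, where Y = "\<lambda>j x. (signed (fst j) 1 / \<sigma>2) * x"]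
  show "indep_vars (\<lambda>_. borel) Y {j. snd j < side_length T k0 (fst j)}"
    unfolding Y by simp
  fix j :: "bool \<times> nat" assume "snd j < side_length T k0 (fst j)"
  then have t: "obs k0 j \<in> {1..T}" by (rule obs_range[OF k0])
  have int: "integrable M (\<lambda>\<omega>. eps (obs k0 j) \<omega> i)" if "i < p" for i
  proof -
    have m: "random_variable borel (\<lambda>\<omega>. eps (obs k0 j) \<omega> i)"
      using measurable_compose[OF rv[OF t] measurable_component_singleton[of i]] that by simp
    from subgaussian_moment(1)[OF m subgaussian_coordinate[OF sg[OF t] that] \<alpha>, of 1] m
    show ?thesis by (simp add: integrable_abs_iff)
  qed
  have "expectation (\<lambda>\<omega>. dot p (eps (obs k0 j) \<omega>) v) = (\<Sum>i<p. expectation (\<lambda>\<omega>. eps (obs k0 j) \<omega> i) * v i)"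
    unfolding dot_def using int by (subst Bochner_Integration.integral_sum) auto
  then have "expectation (\<lambda>\<omega>. dot p (eps (obs k0 j) \<omega>) v) = 0" using mean[OF t] by simp
  then show "expectation (Y j) = 0" unfolding Y by simp
  have eq: "expectation (\<lambda>\<omega>. (dot p (eps t \<omega>) v)\<^sup>2) = (\<integral>x. (dot p x v)\<^sup>2 \<partial>distr M (rvec p) (eps t))" if "t \<in> {1..T}" for t
    using dot_meas by (intro integral_distr[symmetric] rv[OF that]) auto
  have "expectation (\<lambda>\<omega>. (dot p (eps (obs k0 j) \<omega>) v)\<^sup>2) = expectation (\<lambda>\<omega>. (dot p (eps 1 \<omega>) v)\<^sup>2)"
    unfolding eq[OF t] iid[OF t] using eq[of 1] T by simp
  also have "\<dots> = quad_form p (second_moment_mat M p (eps 1)) v"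
    by (rule quad_form_second_moment[symmetric, OF rv sg \<alpha>]) (use T in auto)
  finally show "expectation (\<lambda>\<omega>. (Y j \<omega>)\<^sup>2) = quad_form p (second_moment_mat M p (eps 1)) v / \<sigma>2\<^sup>2"
    unfolding Y power_mult_distrib integral_mult_right_zero by (simp add: power_divide)
  have "subgaussian M (\<bar>signed (fst j) 1 / \<sigma>2\<bar> * (\<alpha> * norm2 p v)) (Y j)"
    unfolding Y by (rule subgaussian_scale[OF subgaussian_dot[OF sg[OF t]]])
  then show "subgaussian M (\<alpha> * norm2 p v / \<sigma>2) (Y j)" using \<sigma> by (cases "fst j") (simp_all add: abs_divide)
qed

text \<open>The variance in direction v lies between the eigenvalue bound and the subgaussian second
  moment bound. Comparing the two keeps the variance proxy away from zero.\<close>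

lemma (in prob_space) lambda_min_le_proxy:
  assumes Z: "random_variable (rvec p) Z" and sg: "subgaussian_vec M p \<alpha> Z" and \<alpha>: "\<alpha> > 0" and p: "p \<ge> 1"
    and v: "norm2 p v > 0"
  shows "lambda_min (second_moment_mat M p Z) * (norm2 p v)\<^sup>2 \<le> quad_form p (second_moment_mat M p Z) v"
    and "lambda_min (second_moment_mat M p Z) \<le> 4 * exp (1 / 2) * \<alpha>\<^sup>2"
proof -
  show le: "lambda_min (second_moment_mat M p Z) * (norm2 p v)\<^sup>2 \<le> quad_form p (second_moment_mat M p Z) v"
    by (rule lambda_min_le_quad_form[OF _ _ p]) (auto simp: second_moment_mat_def mult.commute)
  have dot_meas: "(\<lambda>x. dot p x v) \<in> borel_measurable (rvec p)"
    unfolding dot_def by (intro borel_measurable_sum borel_measurable_times measurable_component_singleton) auto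
  have "expectation (\<lambda>\<omega>. \<bar>dot p (Z \<omega>) v\<bar> ^ 2) \<le> 2 * exp (1 / 2) * fact 2 * (\<alpha> * norm2 p v) ^ 2"
    by (rule subgaussian_moment(2)[OF measurable_compose[OF Z dot_meas] subgaussian_dot[OF sg]]) (use \<alpha> v in simp)
  then have "quad_form p (second_moment_mat M p Z) v \<le> 4 * exp (1 / 2) * \<alpha>\<^sup>2 * (norm2 p v)\<^sup>2"
    by (simp add: quad_form_second_moment[OF Z sg \<alpha>] power_mult_distrib)
  with le have "lambda_min (second_moment_mat M p Z) * (norm2 p v)\<^sup>2 \<le> 4 * exp (1 / 2) * \<alpha>\<^sup>2 * (norm2 p v)\<^sup>2" by linarith
  then show "lambda_min (second_moment_mat M p Z) \<le> 4 * exp (1 / 2) * \<alpha>\<^sup>2" using v by (simp add: mult_le_cancel_right)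
qed

theorem theorem2p2:
  fixes M :: "nat \<Rightarrow> 'a measure"
    and p s :: "nat \<Rightarrow> nat"
    and mu1 mu2 eta :: "nat \<Rightarrow> nat \<Rightarrow> real"
    and tau0 l xi sigma_eps Delta :: "nat \<Rightarrow> real"
    and S :: "nat \<Rightarrow> nat set"
    and Sig :: "nat \<Rightarrow> real mat"
    and eps y :: "nat \<Rightarrow> nat \<Rightarrow> 'a \<Rightarrow> nat \<Rightarrow> real"
    and mu1_hat mu2_hat :: "nat \<Rightarrow> 'a \<Rightarrow> nat \<Rightarrow> real"
    and tau_tilde :: "nat \<Rightarrow> 'a \<Rightarrow> real"
    and \<delta> \<kappa> \<phi> cA cB cC cK \<sigma> :: real
    and N :: "'b measure"
    and W :: "real \<Rightarrow> 'b \<Rightarrow> real"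
  assumes constants: "cA > 0" "cB > 0" "cC > 0" "cK > 0"
    \<comment> \<open>model\<close>
    and prob: "\<And>T. T \<ge> 2 \<Longrightarrow> prob_space (M T)"
    and dim: "\<And>T. T \<ge> 2 \<Longrightarrow> p T \<ge> 1"
    and dim_growth: "0 < \<delta>" "\<delta> < 1/2" "(\<lambda>T. ln (real (p T))) \<in> o(\<lambda>T. real T powr \<delta>)"
    and observations: "\<And>T t \<omega> j. T \<ge> 2 \<Longrightarrow> t \<in> {1..T} \<Longrightarrow> \<omega> \<in> space (M T) \<Longrightarrow> j < p T \<Longrightarrow>
      y T t \<omega> j = (if t \<le> nat \<lfloor>real T * tau0 T\<rfloor> then mu1 T j else mu2 T j) + eps T t \<omega> j"
    and eta: "\<And>T. T \<ge> 2 \<Longrightarrow> eta T = (\<lambda>j. mu1 T j - mu2 T j)"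
    and xi: "\<And>T. T \<ge> 2 \<Longrightarrow> xi T = norm2 (p T) (eta T)"
    \<comment> \<open>Condition A\<close>
    and A_i: "\<And>T. T \<ge> 2 \<Longrightarrow> S T = support (p T) (mu1 T) \<union> support (p T) (mu2 T)"
      "\<And>T. T \<ge> 2 \<Longrightarrow> s T \<ge> 1" "\<And>T. T \<ge> 2 \<Longrightarrow> card (S T) \<le> s T"
    and A_ii: "(\<lambda>T. real (s T) * ln (real (p T)) / sqrt (real T)) \<longlonglongrightarrow> 0"
    and A_iii: "\<And>T. T \<ge> 2 \<Longrightarrow> xi T > 0"
      "\<And>T. T \<ge> 2 \<Longrightarrow> 0 < l T \<and> l T < 1/2"
      "\<And>T. T \<ge> 2 \<Longrightarrow> min (tau0 T) (1 - tau0 T) \<ge> l T"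
      "\<And>T. T \<ge> 2 \<Longrightarrow> sigma_eps T / xi T *
         (real (s T) * ln (real (max (p T) T)) / sqrt (real T * l T)) \<le> cA"
    \<comment> \<open>Condition B\<close>
    and B_iid: "\<And>T. T \<ge> 2 \<Longrightarrow>
        prob_space.indep_vars (M T) (\<lambda>_. rvec (p T)) (eps T) {1..T}"
      "\<And>T t. T \<ge> 2 \<Longrightarrow> t \<in> {1..T} \<Longrightarrow>
        distr (M T) (rvec (p T)) (eps T t) = distr (M T) (rvec (p T)) (eps T 1)"
    and B_mean: "\<And>T t j. T \<ge> 2 \<Longrightarrow> t \<in> {1..T} \<Longrightarrow> j < p T \<Longrightarrow> (\<integral>\<omega>. eps T t \<omega> j \<partial>M T) = 0"
    and B_subgaussian: "\<And>T t. T \<ge> 2 \<Longrightarrow> t \<in> {1..T} \<Longrightarrow>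
        subgaussian_vec (M T) (p T) (sigma_eps T) (eps T t)"
      "\<And>T. T \<ge> 2 \<Longrightarrow> sigma_eps T > 0" "\<And>T. T \<ge> 2 \<Longrightarrow> (sigma_eps T)\<^sup>2 \<le> cB"
    and B_cov: "\<And>T. T \<ge> 2 \<Longrightarrow> Sig T = second_moment_mat (M T) (p T) (eps T 1)"
      "0 < \<kappa>" "\<And>T. T \<ge> 2 \<Longrightarrow> \<kappa> \<le> lambda_min (Sig T)"
      "\<And>T. T \<ge> 2 \<Longrightarrow> lambda_min (Sig T) < lambda_max (Sig T)"
      "\<And>T. T \<ge> 2 \<Longrightarrow> lambda_max (Sig T) \<le> \<phi>"
    \<comment> \<open>Condition C\<close>
    and C_meas: "\<And>T. T \<ge> 2 \<Longrightarrow> mu1_hat T \<in> measurable (M T) (rvec (p T))"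
      "\<And>T. T \<ge> 2 \<Longrightarrow> mu2_hat T \<in> measurable (M T) (rvec (p T))"
    and C_Delta: "Delta \<longlonglongrightarrow> 0"
    and C_event: "\<And>T. T \<ge> 2 \<Longrightarrow> measure (M T) {\<omega> \<in> space (M T).
          (let d1 = (\<lambda>j. mu1_hat T \<omega> j - mu1 T j);
               d2 = (\<lambda>j. mu2_hat T \<omega> j - mu2 T j);
               rate = cC * sigma_eps T *
                 sqrt (real (s T) * ln (real (max (p T) T)) / (real T * l T))
           in norm2 (p T) d1 \<le> rate \<and> norm2 (p T) d2 \<le> rate \<and>
              d1 \<in> sparse_cone (p T) (S T) cK \<and> d2 \<in> sparse_cone (p T) (S T) cK)}
        \<ge> 1 - Delta T"
    \<comment> \<open>projected least squares estimate\<close>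
    and tau_meas: "\<And>T. T \<ge> 2 \<Longrightarrow> tau_tilde T \<in> borel_measurable (M T)"
    and tau_lse: "\<And>T \<omega>. T \<ge> 2 \<Longrightarrow> \<omega> \<in> space (M T) \<Longrightarrow>
        projected_lse T (p T) (\<lambda>t. y T t \<omega>) (mu1_hat T \<omega>) (mu2_hat T \<omega>) (tau_tilde T \<omega>)"
    \<comment> \<open>additional assumptions\<close>
    and rate: "(\<lambda>T. sigma_eps T / xi T *
         (real (s T) * ln (real (max (p T) T)) / sqrt (real T * l T))) \<longlonglongrightarrow> 0"
    and jump: "xi \<longlonglongrightarrow> 0"
    and variance: "(\<lambda>T. quad_form (p T) (Sig T) (eta T) / (xi T)\<^sup>2) \<longlonglongrightarrow> \<sigma>\<^sup>2"
    and W: "two_sided_brownian_motion N W"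
  shows "\<exists>X. argmin_rv N (\<lambda>r \<omega>. \<bar>r\<bar> - 2 * W r \<omega>) X \<and>
    weak_conv_m
      (\<lambda>T. distr (M T) borel (\<lambda>\<omega>. real T * (xi T)\<^sup>2 / \<sigma>\<^sup>2 * (tau_tilde T \<omega> - tau0 T)))
      (distr N borel X)"
proof -
  define \<sigma>2 where "\<sigma>2 = \<sigma>\<^sup>2"
  define k0 where "k0 T = nat \<lfloor>real T * tau0 T\<rfloor>" for T
  define \<Lambda> where "\<Lambda> T = ln (real (max (p T) T))" for T
  define rt where "rt T = cC * sigma_eps T * sqrt (real (s T) * \<Lambda> T / (real T * l T))" for T
  define rs where "rs T = sigma_eps T / xi T * (real (s T) * \<Lambda> T / sqrt (real T * l T))" for T
  define a where "a T = (xi T)\<^sup>2 / \<sigma>2" for T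
  define q where "q T = quad_form (p T) (Sig T) (eta T)" for T
  define w where "w T = sigma_eps T * sqrt (6 * \<Lambda> T)" for T
  define \<rho> where "\<rho> T = 6 * (rt T / xi T) + 8 * (rt T / xi T)\<^sup>2 + 4 * (1 + cK) * sqrt (real (s T)) * rt T * w T / (xi T * sqrt \<sigma>2)" for T
  define Y where "Y T j \<omega> = signed (fst j) (dot (p T) (eps T (obs (k0 T) j) \<omega>) (eta T)) / \<sigma>2" for T j \<omega>
  define r where "r T \<omega> = real T * (xi T)\<^sup>2 / \<sigma>\<^sup>2 * (tau_tilde T \<omega> - tau0 T)" for T \<omega>
  define CE where "CE T = {\<omega> \<in> space (M T).
          (let d1 = (\<lambda>j. mu1_hat T \<omega> j - mu1 T j);
               d2 = (\<lambda>j. mu2_hat T \<omega> j - mu2 T j);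
               rate = cC * sigma_eps T *
                 sqrt (real (s T) * ln (real (max (p T) T)) / (real T * l T))
           in norm2 (p T) d1 \<le> rate \<and> norm2 (p T) d2 \<le> rate \<and>
              d1 \<in> sparse_cone (p T) (S T) cK \<and> d2 \<in> sparse_cone (p T) (S T) cK)}" for T
  define NE where "NE T = {\<omega>\<in>space (M T). \<forall>b m j. m \<le> side_length T (k0 T) b \<longrightarrow> j < p T \<longrightarrow>
     \<bar>\<Sum>i<m. eps T (obs (k0 T) (b, i)) \<omega> j\<bar> \<le> sigma_eps T * sqrt (6 * ln (real (max (p T) T))) * sqrt (real m)}" for T
  have ev2: "\<forall>\<^sub>F T in sequentially. T \<ge> (2::nat)" by (rule eventually_ge_at_top)
  have L2: "ln 2 \<le> \<Lambda> T" if "T \<ge> 2" for T using that by (simp add: \<Lambda>_def)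
  have l2: "ln (2::real) > 0" by simp
  have L0: "\<Lambda> T \<ge> 0" if "T \<ge> 2" for T using L2[OF that] l2 by linarith
  have sL: "ln 2 \<le> real (s T) * \<Lambda> T" if "T \<ge> 2" for T
    using mult_mono[of 1 "real (s T)" "ln 2" "\<Lambda> T"] A_i(2)[OF that] L2[OF that] by simp
  have Tl: "real T * l T > 0" if "T \<ge> 2" for T using A_iii(2)[OF that] that by simp
  have k0T: "k0 T < T" "real T * l T - 1 \<le> real (k0 T)" "real T * l T \<le> real (T - k0 T)" "\<bar>real T * tau0 T - real (k0 T)\<bar> \<le> 1" if T: "T \<ge> 2" for T
  proof -
    have l: "0 < l T" "l T \<le> tau0 T" "tau0 T \<le> 1 - l T" using A_iii(2,3)[OF T] by auto
    have "0 \<le> real T * tau0 T" using l by simp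
    then have k: "real (k0 T) \<le> real T * tau0 T" "real T * tau0 T < real (k0 T) + 1" unfolding k0_def by linarith+
    have u: "real T * tau0 T \<le> real T - real T * l T" using mult_left_mono[OF l(3), of "real T"] by (simp add: algebra_simps)
    have lo: "real T * l T \<le> real T * tau0 T" using l by (intro mult_left_mono) auto
    show "k0 T < T" using k u Tl[OF T] by linarith
    then have "real (T - k0 T) = real T - real (k0 T)" by (simp add: of_nat_diff)
    then show "real T * l T \<le> real (T - k0 T)" using k u by linarith
    show "real T * l T - 1 \<le> real (k0 T)" "\<bar>real T * tau0 T - real (k0 T)\<bar> \<le> 1"
      using k lo by linarith+
  qed
  have rv: "eps T t \<in> measurable (M T) (rvec (p T))" if "T \<ge> 2" "t \<in> {1..T}" for T t
    using B_iid(1)[OF that(1)] that(2) unfolding prob_space.indep_vars_def[OF prob[OF that(1)]] by blast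
  have low: "\<kappa> * (xi T)\<^sup>2 \<le> q T" "\<kappa> \<le> 4 * exp (1 / 2) * (sigma_eps T)\<^sup>2" if T: "T \<ge> 2" for T
  proof -
    interpret prob_space "M T" by (rule prob[OF T])
    have 1: "1 \<in> {1..T}" using T by simp
    have x0: "norm2 (p T) (eta T) > 0" using xi[OF T] A_iii(1)[OF T] by simp
    note lm = lambda_min_le_proxy[OF rv[OF T 1] B_subgaussian(1)[OF T 1] B_subgaussian(2)[OF T] dim[OF T] x0, folded B_cov(1)[OF T]]
    show "\<kappa> \<le> 4 * exp (1 / 2) * (sigma_eps T)\<^sup>2" using lm(2) B_cov(3)[OF T] by linarith
    have "\<kappa> * (xi T)\<^sup>2 \<le> lambda_min (Sig T) * (xi T)\<^sup>2" using B_cov(3)[OF T] by (intro mult_right_mono) auto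
    also have "\<dots> \<le> q T" using lm(1) xi[OF T] by (simp add: q_def)
    finally show "\<kappa> * (xi T)\<^sup>2 \<le> q T" .
  qed
  \<comment> \<open>The eigenvalue bound passes to the limit of the normalized variances, which
    justifies dividing by \<open>\<sigma>\<^sup>2\<close>.\<close>
  have \<sigma>2: "\<sigma>2 > 0"
  proof -
    have "\<forall>\<^sub>F T in sequentially. \<kappa> \<le> q T / (xi T)\<^sup>2"
      using ev2
    proof eventually_elim
      case (elim T)
      show ?case using low(1)[OF elim] A_iii(1)[OF elim] by (simp add: pos_le_divide_eq)
    qed
    then have "\<kappa> \<le> \<sigma>\<^sup>2" using tendsto_lowerbound[OF variance] unfolding q_def by (simp add: sequentially_bot)
    then show ?thesis using B_cov(2) unfolding \<sigma>2_def by linarith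
  qed
  \<comment> \<open>A lower bound for \<open>sigma_eps T\<close> uniform in T, from the comparison
    of \<kappa> with the variance proxy.\<close>
  define c0 where "c0 = sqrt (\<kappa> / (4 * exp (1 / 2)))"
  have c0: "c0 > 0" using B_cov(2) by (simp add: c0_def)
  have se_low: "c0 \<le> sigma_eps T" if "T \<ge> 2" for T
    unfolding c0_def using low(2)[OF that] B_subgaussian(2)[OF that] by (intro real_le_lsqrt) (auto simp: field_simps)
  have se_up: "sigma_eps T \<le> sqrt cB" if "T \<ge> 2" for T
    using B_subgaussian(3)[OF that] by (rule real_le_rsqrt)
  have rs: "rs \<longlonglongrightarrow> 0" using rate by (simp add: rs_def[abs_def] \<Lambda>_def)
  have rs0: "rs T \<ge> 0" if "T \<ge> 2" for T
    using L0[OF that] A_iii(1)[OF that] B_subgaussian(2)[OF that] Tl[OF that] unfolding rs_def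
    by (intro mult_nonneg_nonneg divide_nonneg_nonneg) auto
  \<comment> \<open>With \<open>sigma_eps\<close> and \<open>real (s T) * \<Lambda> T\<close>
    bounded below, the rate assumption forces \<open>xi T * sqrt (real T * l T)\<close> to infinity.
    Its square is \<open>\<sigma>2\<close> times the rescaled length treated in
    \<open>aTl\<close>.\<close>
  have inv: "(\<lambda>T. 1 / (xi T * sqrt (real T * l T))) \<longlonglongrightarrow> 0"
  proof (rule tendsto_sandwich[of "\<lambda>_. 0" _ _ "\<lambda>T. 1 / (c0 * ln 2) * rs T"])
    show "\<forall>\<^sub>F T in sequentially. 0 \<le> 1 / (xi T * sqrt (real T * l T))"
      using ev2 by eventually_elim (use A_iii(1) Tl in \<open>simp add: less_imp_le\<close>)
    show "\<forall>\<^sub>F T in sequentially. 1 / (xi T * sqrt (real T * l T)) \<le> 1 / (c0 * ln 2) * rs T"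
      using ev2
    proof eventually_elim
      case (elim T)
      have "c0 * ln 2 \<le> sigma_eps T * (real (s T) * \<Lambda> T)"
        using c0 l2 se_low[OF elim] sL[OF elim] by (intro mult_mono) auto
      then have "c0 * ln 2 / (xi T * sqrt (real T * l T)) \<le> sigma_eps T * (real (s T) * \<Lambda> T) / (xi T * sqrt (real T * l T))"
        using A_iii(1)[OF elim] Tl[OF elim] by (intro divide_right_mono) auto
      also have "\<dots> = rs T" by (simp add: rs_def)
      finally show ?case using c0 l2 by (simp add: field_simps)
    qed
    have "(\<lambda>T. 1 / (c0 * ln 2) * rs T) \<longlonglongrightarrow> 1 / (c0 * ln 2) * 0" by (intro tendsto_intros rs)
    then show "(\<lambda>T. 1 / (c0 * ln 2) * rs T) \<longlonglongrightarrow> 0" by simp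
  qed simp
  have a0: "a T > 0" if "T \<ge> 2" for T using A_iii(1)[OF that] \<sigma>2 by (simp add: a_def)
  have a_lim: "a \<longlonglongrightarrow> 0"
  proof -
    have "(\<lambda>T. (xi T)\<^sup>2 / \<sigma>2) \<longlonglongrightarrow> 0\<^sup>2 / \<sigma>2" using \<sigma>2 by (intro tendsto_intros jump) auto
    then show ?thesis by (simp add: a_def[abs_def])
  qed
  have aTl: "filterlim (\<lambda>T. a T * (real T * l T)) at_top sequentially"
  proof -
    have "(\<lambda>T. \<sigma>2 * (1 / (xi T * sqrt (real T * l T)))\<^sup>2) \<longlonglongrightarrow> \<sigma>2 * 0\<^sup>2" by (intro tendsto_intros inv)
    moreover have "\<forall>\<^sub>F T in sequentially. \<sigma>2 * (1 / (xi T * sqrt (real T * l T)))\<^sup>2 = inverse (a T * (real T * l T))"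
      using ev2
    proof eventually_elim
      case (elim T)
      have "\<sigma>2 * (1 / (z * sqrt x))\<^sup>2 = inverse (z\<^sup>2 / \<sigma>2 * x)" if "x > 0" for x z
        using that by (simp add: power_divide power_mult_distrib divide_inverse power_inverse mult_ac)
      from this[OF Tl[OF elim]] show ?case unfolding a_def .
    qed
    ultimately have "(\<lambda>T. inverse (a T * (real T * l T))) \<longlonglongrightarrow> 0" by (simp add: tendsto_cong)
    moreover have "\<forall>\<^sub>F T in sequentially. 0 < inverse (a T * (real T * l T))"
      using ev2 by eventually_elim (intro positive_imp_inverse_positive mult_pos_pos a0 Tl)
    ultimately have "filterlim (\<lambda>T. inverse (inverse (a T * (real T * l T)))) at_top sequentially"
      by (rule filterlim_inverse_at_top)
    then show ?thesis by simp
  qed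
  have aL: "filterlim (\<lambda>T. a T * real (side_length T (k0 T) b)) at_top sequentially" for b
  proof (rule filterlim_at_top_mono)
    have "filterlim (\<lambda>T. - a T + a T * (real T * l T)) at_top sequentially"
      by (rule filterlim_tendsto_add_at_top[OF tendsto_minus[OF a_lim] aTl])
    then show "filterlim (\<lambda>T. a T * (real T * l T) - a T) at_top sequentially" by simp
    show "\<forall>\<^sub>F T in sequentially. a T * (real T * l T) - a T \<le> a T * real (side_length T (k0 T) b)"
      using ev2
    proof eventually_elim
      case (elim T)
      have "real T * l T - 1 \<le> real (side_length T (k0 T) b)"
        using k0T(2,3)[OF elim] by (cases b) (auto simp: side_length_def)
      from mult_left_mono[OF this, of "a T"] show ?case using a0[OF elim] by (simp add: algebra_simps)
    qed
  qed
  have rt0: "rt T \<ge> 0" if "T \<ge> 2" for T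
    unfolding rt_def using constants(3) B_subgaussian(2)[OF that] L0[OF that] Tl[OF that]
    by (intro mult_nonneg_nonneg real_sqrt_ge_zero divide_nonneg_pos) auto
  \<comment> \<open>The estimation rate contains the square root of x = s \<Lambda>, the assumption
    x itself; the inequality sqrt x <= x / sqrt (ln 2) for x >= ln 2 bridges the two.\<close>
  have rt_lim: "(\<lambda>T. rt T / xi T) \<longlonglongrightarrow> 0"
  proof (rule tendsto_sandwich[of "\<lambda>_. 0" _ _ "\<lambda>T. cC / sqrt (ln 2) * rs T"])
    show "\<forall>\<^sub>F T in sequentially. 0 \<le> rt T / xi T"
      using ev2 by eventually_elim (use A_iii(1) rt0 in \<open>simp add: less_imp_le\<close>)
    show "\<forall>\<^sub>F T in sequentially. rt T / xi T \<le> cC / sqrt (ln 2) * rs T"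
      using ev2
    proof eventually_elim
      case (elim T)
      define x where "x = real (s T) * \<Lambda> T"
      have x: "ln 2 \<le> x" "x \<ge> 0" using sL[OF elim] L0[OF elim] by (auto simp: x_def)
      have "sqrt (ln 2) * sqrt x \<le> sqrt x * sqrt x"
        by (rule mult_right_mono[OF real_sqrt_le_mono[OF x(1)] real_sqrt_ge_zero[OF x(2)]])
      then have "sqrt x \<le> x / sqrt (ln 2)" using x l2 by (simp add: field_simps)
      then have "cC * sigma_eps T / (xi T * sqrt (real T * l T)) * sqrt x \<le> cC * sigma_eps T / (xi T * sqrt (real T * l T)) * (x / sqrt (ln 2))"
        using constants(3) B_subgaussian(2)[OF elim] A_iii(1)[OF elim] Tl[OF elim] by (intro mult_left_mono) auto
      then show ?case unfolding rt_def rs_def x_def[symmetric] real_sqrt_divide by (simp add: mult_ac)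
    qed
    have "(\<lambda>T. cC / sqrt (ln 2) * rs T) \<longlonglongrightarrow> cC / sqrt (ln 2) * 0" by (intro tendsto_intros rs)
    then show "(\<lambda>T. cC / sqrt (ln 2) * rs T) \<longlonglongrightarrow> 0" by simp
  qed simp
  have w0: "w T \<ge> 0" if "T \<ge> 2" for T
    unfolding w_def using B_subgaussian(2)[OF that] L0[OF that] by (intro mult_nonneg_nonneg real_sqrt_ge_zero) auto
  have \<rho>0: "\<rho> T \<ge> 0" if "T \<ge> 2" for T
    unfolding \<rho>_def using rt0[OF that] w0[OF that] A_iii(1)[OF that] constants(4) \<sigma>2
    by (intro add_nonneg_nonneg divide_nonneg_pos mult_nonneg_nonneg mult_pos_pos) auto
  have \<rho>_lim: "\<rho> \<longlonglongrightarrow> 0"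
  proof -
    define D where "D = 4 * (1 + cK) * cC * sqrt 6 / sqrt \<sigma>2"
    have D: "D \<ge> 0" using constants(3,4) \<sigma>2 by (simp add: D_def)
    define g where "g T = 4 * (1 + cK) * sqrt (real (s T)) * rt T * w T / (xi T * sqrt \<sigma>2)" for T
    have g: "g \<longlonglongrightarrow> 0"
    proof (rule tendsto_sandwich[of "\<lambda>_. 0" _ _ "\<lambda>T. D * sqrt cB * rs T"])
      show "\<forall>\<^sub>F T in sequentially. 0 \<le> g T"
        using ev2
      proof eventually_elim
        case (elim T)
        show ?case unfolding g_def using rt0[OF elim] w0[OF elim] A_iii(1)[OF elim] constants(4) \<sigma>2
          by (intro divide_nonneg_pos mult_nonneg_nonneg mult_pos_pos) auto
      qed
      show "\<forall>\<^sub>F T in sequentially. g T \<le> D * sqrt cB * rs T"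
        using ev2
      proof eventually_elim
        case (elim T)
        have \<Lambda>0: "\<Lambda> T \<ge> 0" using L2[OF elim] l2 by linarith
        \<comment> \<open>The factors sqrt s of the l1 bound, sqrt (s \<Lambda>) of the estimation
          rate and sqrt \<Lambda> of the noise maximum multiply to s \<Lambda>, exactly the
          numerator of the assumed rate. The remaining \<open>sigma_eps\<close> is at most
          \<open>sqrt cB\<close>.\<close>
        have "sqrt (real (s T)) * sqrt (real (s T) * \<Lambda> T) * sqrt (\<Lambda> T) = (sqrt (real (s T)) * sqrt (real (s T))) * (sqrt (\<Lambda> T) * sqrt (\<Lambda> T))"
          by (simp only: real_sqrt_mult mult_ac)
        then have sq: "sqrt (real (s T)) * sqrt (real (s T) * \<Lambda> T) * sqrt (\<Lambda> T) = real (s T) * \<Lambda> T"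
          using \<Lambda>0 by simp
        have "g T = D * sigma_eps T * (sigma_eps T / xi T * ((sqrt (real (s T)) * sqrt (real (s T) * \<Lambda> T) * sqrt (\<Lambda> T)) / sqrt (real T * l T)))"
          unfolding g_def rt_def w_def D_def real_sqrt_divide real_sqrt_mult[of 6 "\<Lambda> T"] by (simp add: mult_ac)
        also have "\<dots> = D * sigma_eps T * rs T" unfolding sq rs_def ..
        also have "\<dots> \<le> D * sqrt cB * rs T"
          using D se_up[OF elim] rs0[OF elim] by (intro mult_right_mono mult_left_mono) auto
        finally show ?case .
      qed
      have "(\<lambda>T. D * sqrt cB * rs T) \<longlonglongrightarrow> D * sqrt cB * 0" by (intro tendsto_intros rs)
      then show "(\<lambda>T. D * sqrt cB * rs T) \<longlonglongrightarrow> 0" by simp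
    qed simp
    have "(\<lambda>T. 6 * (rt T / xi T) + 8 * (rt T / xi T)\<^sup>2 + g T) \<longlonglongrightarrow> 6 * 0 + 8 * 0\<^sup>2 + 0"
      by (intro tendsto_intros rt_lim g)
    then show ?thesis by (simp add: \<rho>_def[abs_def] g_def)
  qed
  have "\<forall>\<^sub>F T in sequentially. rt T / xi T < 1 / 2" using rt_lim by (rule order_tendstoD) simp
  moreover have "\<forall>\<^sub>F T in sequentially. 0 < a T * real (side_length T (k0 T) False)"
    using aL[of False] by (simp add: filterlim_at_top_dense)
  moreover have "\<forall>\<^sub>F T in sequentially. Delta T < 1" using C_Delta by (rule order_tendstoD) simp
  ultimately have "\<forall>\<^sub>F T in sequentially. T \<ge> 2 \<and> 2 * rt T < xi T \<and> 1 \<le> k0 T \<and> Delta T < 1"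
    using ev2
  proof eventually_elim
    case (elim T)
    have "2 * rt T < xi T" using elim(1) A_iii(1)[OF elim(4)] by (simp add: field_simps)
    moreover have "1 \<le> k0 T" using elim(2) by (cases "k0 T") (auto simp: side_length_def)
    ultimately show ?case using elim by simp
  qed
  \<comment> \<open>Finitely many T are discarded, because the abstract argmin problem states its
    hypotheses at every index.\<close>
  then obtain T0 where T0: "\<And>T. T \<ge> T0 \<Longrightarrow> T \<ge> 2 \<and> 2 * rt T < xi T \<and> 1 \<le> k0 T \<and> Delta T < 1"
    by (auto simp: eventually_sequentially)
  have T2: "n + T0 \<ge> 2" for n using T0[of "n + T0"] by simp
  have se0: "sigma_eps T > 0" if "T \<ge> 2" for T by (rule B_subgaussian(2)[OF that])
  have NE: "NE T \<in> sets (M T)" "measure (M T) (NE T) \<ge> 1 - 2 / real T" if T: "T \<ge> 2" for T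
    unfolding NE_def
    by (rule prob_space.noise_maximum[OF prob[OF T] B_iid(1)[OF T] B_subgaussian(1)[OF T] se0[OF T] less_imp_le[OF k0T(1)[OF T]] T]; simp)+
  have CE: "CE T \<in> sets (M T)" "measure (M T) (CE T) \<ge> 1 - Delta T" if T: "T \<ge> T0" for T
  proof -
    show "measure (M T) (CE T) \<ge> 1 - Delta T" unfolding CE_def using C_event T0[OF T] by blast
    \<comment> \<open>A set outside the sigma-algebra has measure 0 by convention, so a nonzero
      measure proves that the event is measurable.\<close>
    then have "measure (M T) (CE T) \<noteq> 0" using T0[OF T] by auto
    then show "CE T \<in> sets (M T)" using measure_notin_sets by blast
  qed
  obtain B where bm: "two_sided_bm N B"
    and WB: "\<And>\<omega> r. \<omega> \<in> space N \<Longrightarrow> W r \<omega> = (if r > 0 then B True r \<omega> else if r < 0 then B False (- r) \<omega> else 0)"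
    using two_sided_brownian_motion_imp_bm[OF W] by blast
  obtain X where X: "argmin_rv N (\<lambda>r \<omega>. \<bar>r\<bar> - 2 * W r \<omega>) X"
    and XAE: "AE \<omega> in N. (\<forall>b. B b 0 \<omega> = 0 \<and> continuous_on {0..} (\<lambda>t. B b t \<omega>)) \<and>
      (\<forall>b u. u \<ge> 0 \<longrightarrow> (\<forall>b' r. r \<ge> 0 \<longrightarrow> two_sided_bm.drifted B b u \<omega> \<le> two_sided_bm.drifted B b' r \<omega>) \<longrightarrow> X \<omega> = signed b u)"
    using two_sided_bm.ex_argmin[OF bm WB] by blast
  have row: "prob_space.indep_vars (M T) (\<lambda>_. borel) (Y T) {j. snd j < side_length T (k0 T) (fst j)}"
    "\<And>j. snd j < side_length T (k0 T) (fst j) \<Longrightarrow> (\<integral>\<omega>. Y T j \<omega> \<partial>M T) = 0"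
    "\<And>j. snd j < side_length T (k0 T) (fst j) \<Longrightarrow> (\<integral>\<omega>. (Y T j \<omega>)\<^sup>2 \<partial>M T) = a T * (q T / (xi T)\<^sup>2 / \<sigma>2)"
    "\<And>j. snd j < side_length T (k0 T) (fst j) \<Longrightarrow> subgaussian (M T) (sqrt cB / sqrt \<sigma>2 * sqrt (a T)) (Y T j)"
    if T: "T \<ge> 2" for T
  proof -
    interpret prob_space "M T" by (rule prob[OF T])
    have T1: "T \<ge> 1" using T by simp
    show "indep_vars (\<lambda>_. borel) (Y T) {j. snd j < side_length T (k0 T) (fst j)}"
      unfolding Y_def[abs_def]
      by (rule projected_noise_row(1)[OF B_iid(1,2)[OF T] B_mean[OF T] B_subgaussian(1)[OF T] se0[OF T] less_imp_le[OF k0T(1)[OF T]] T1 \<sigma>2])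
    fix j :: "bool \<times> nat" assume j: "snd j < side_length T (k0 T) (fst j)"
    show "expectation (Y T j) = 0"
      unfolding Y_def[abs_def]
      by (rule projected_noise_row(2)[OF B_iid(1,2)[OF T] B_mean[OF T] B_subgaussian(1)[OF T] se0[OF T] less_imp_le[OF k0T(1)[OF T]] T1 \<sigma>2 j])
    have "expectation (\<lambda>\<omega>. (Y T j \<omega>)\<^sup>2) = q T / \<sigma>2\<^sup>2"
      unfolding Y_def q_def B_cov(1)[OF T]
      by (rule projected_noise_row(3)[OF B_iid(1,2)[OF T] B_mean[OF T] B_subgaussian(1)[OF T] se0[OF T] less_imp_le[OF k0T(1)[OF T]] T1 \<sigma>2 j])
    then show "expectation (\<lambda>\<omega>. (Y T j \<omega>)\<^sup>2) = a T * (q T / (xi T)\<^sup>2 / \<sigma>2)"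
      using A_iii(1)[OF T] by (simp add: a_def power2_eq_square)
    have sg: "subgaussian (M T) (sigma_eps T * norm2 (p T) (eta T) / \<sigma>2) (Y T j)"
      unfolding Y_def[abs_def]
      by (rule projected_noise_row(4)[OF B_iid(1,2)[OF T] B_mean[OF T] B_subgaussian(1)[OF T] se0[OF T] less_imp_le[OF k0T(1)[OF T]] T1 \<sigma>2 j])
    show "subgaussian (M T) (sqrt cB / sqrt \<sigma>2 * sqrt (a T)) (Y T j)"
    proof (rule subgaussian_mono[OF sg])
      have x0: "xi T > 0" by (rule A_iii(1)[OF T])
      have "sqrt cB / sqrt \<sigma>2 * sqrt (a T) = sqrt cB * xi T / \<sigma>2"
        using x0 \<sigma>2 by (simp add: a_def real_sqrt_divide)
      moreover have "sigma_eps T * xi T / \<sigma>2 \<le> sqrt cB * xi T / \<sigma>2"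
        using se_up[OF T] x0 \<sigma>2 by (intro divide_right_mono mult_right_mono) auto
      moreover have "0 \<le> sigma_eps T * xi T / \<sigma>2" using se0[OF T] x0 \<sigma>2 by simp
      ultimately show "\<bar>sigma_eps T * norm2 (p T) (eta T) / \<sigma>2\<bar> \<le> \<bar>sqrt cB / sqrt \<sigma>2 * sqrt (a T)\<bar>"
        unfolding xi[OF T, symmetric] by linarith
    qed
  qed
  have near: "\<exists>b m. m \<le> side_length T (k0 T) b \<and> \<bar>r T \<omega> - signed b (a T * real m)\<bar> \<le> 2 * a T \<and>
      (\<forall>b' m'. m' < side_length T (k0 T) b' \<longrightarrow> a T * real m - 2 * (\<Sum>i<m. Y T (b, i) \<omega>) \<le> a T * real m' - 2 * (\<Sum>i<m'. Y T (b', i) \<omega>)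
        + \<rho> T * (a T * real m + sqrt (a T * real m) + a T * real m' + sqrt (a T * real m')))"
    if T: "T \<ge> T0" and \<omega>: "\<omega> \<in> CE T \<inter> NE T" for T \<omega>
  proof -
    have T2: "T \<ge> 2" and rtx: "2 * rt T < xi T" and k01: "1 \<le> k0 T" using T0[OF T] by auto
    have sp: "\<omega> \<in> space (M T)" using \<omega> by (simp add: CE_def)
    have ce: "norm2 (p T) (\<lambda>j. mu1_hat T \<omega> j - mu1 T j) \<le> rt T" "norm2 (p T) (\<lambda>j. mu2_hat T \<omega> j - mu2 T j) \<le> rt T"
      "(\<lambda>j. mu1_hat T \<omega> j - mu1 T j) \<in> sparse_cone (p T) (S T) cK" "(\<lambda>j. mu2_hat T \<omega> j - mu2 T j) \<in> sparse_cone (p T) (S T) cK"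
      using \<omega> by (auto simp: CE_def Let_def rt_def \<Lambda>_def)
    obtain k where k: "k \<le> T - 1" "\<bar>real T * tau_tilde T \<omega> - real k\<bar> \<le> 1"
      and min: "\<And>k'. k' \<in> {1..T - 1} \<Longrightarrow>
        crit T (\<lambda>t. dot (p T) (\<lambda>j. mu1_hat T \<omega> j - mu2_hat T \<omega> j) (y T t \<omega>)) (dot (p T) (\<lambda>j. mu1_hat T \<omega> j - mu2_hat T \<omega> j) (mu1_hat T \<omega>)) (dot (p T) (\<lambda>j. mu1_hat T \<omega> j - mu2_hat T \<omega> j) (mu2_hat T \<omega>)) k
        \<le> crit T (\<lambda>t. dot (p T) (\<lambda>j. mu1_hat T \<omega> j - mu2_hat T \<omega> j) (y T t \<omega>)) (dot (p T) (\<lambda>j. mu1_hat T \<omega> j - mu2_hat T \<omega> j) (mu1_hat T \<omega>)) (dot (p T) (\<lambda>j. mu1_hat T \<omega> j - mu2_hat T \<omega> j) (mu2_hat T \<omega>)) k'"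
      using projected_lse_crit[OF T2 tau_lse[OF T2 sp]] by blast
    have SS: "S T \<subseteq> {..<p T}" unfolding A_i(1)[OF T2] support_def by auto
    have "\<exists>b m. m \<le> side_length T (k0 T) b \<and> real k - real (k0 T) = signed b (real m) \<and>
      (\<forall>b' m'. m' < side_length T (k0 T) b' \<longrightarrow> a T * real m - 2 * (\<Sum>i<m. Y T (b, i) \<omega>) \<le> a T * real m' - 2 * (\<Sum>i<m'. Y T (b', i) \<omega>)
        + \<rho> T * (a T * real m + sqrt (a T * real m) + a T * real m' + sqrt (a T * real m')))"
      unfolding a_def Y_def \<rho>_def eta[OF T2]
    proof (rule projected_near_min[where y = "\<lambda>t. y T t \<omega>" and eps = "\<lambda>t. eps T t \<omega>" and w = "w T" and xi = "xi T" and rate = "rt T" and s = "real (s T)" and c = cK,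
          OF _ k01 k0T(1)[OF T2] _ A_iii(1)[OF T2] SS _ _ ce(1,3) ce(2,4) rtx _ w0[OF T2] \<sigma>2 k(1) min])
      show "y T t \<omega> j = (if t \<le> k0 T then mu1 T j else mu2 T j) + eps T t \<omega> j" if "t \<in> {1..T}" "j < p T" for t j
        unfolding k0_def by (rule observations[OF T2 that(1) sp that(2)])
      show "xi T = norm2 (p T) (\<lambda>j. mu1 T j - mu2 T j)" using xi[OF T2] eta[OF T2] by simp
      show "real (card (S T)) \<le> real (s T)" using A_i(3)[OF T2] by simp
      show "0 \<le> cK" using constants(4) by simp
      show "\<bar>\<Sum>i<m. eps T (obs (k0 T) (b, i)) \<omega> j\<bar> \<le> w T * sqrt (real m)" if "m \<le> side_length T (k0 T) b" "j < p T" for b m j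
        using \<omega> that by (auto simp: NE_def w_def \<Lambda>_def)
    qed
    then obtain b m where m: "m \<le> side_length T (k0 T) b" "real k - real (k0 T) = signed b (real m)"
      and nm: "\<forall>b' m'. m' < side_length T (k0 T) b' \<longrightarrow> a T * real m - 2 * (\<Sum>i<m. Y T (b, i) \<omega>) \<le> a T * real m' - 2 * (\<Sum>i<m'. Y T (b', i) \<omega>)
        + \<rho> T * (a T * real m + sqrt (a T * real m) + a T * real m' + sqrt (a T * real m'))" by blast
    \<comment> \<open>The rounding error has two parts of at most a each: \<open>tau_tilde\<close>
      differs from its split, and \<open>k0\<close> is the floor of T times the true change
      point.\<close>
    have "r T \<omega> - signed b (a T * real m) = a T * ((real T * tau_tilde T \<omega> - real k) - (real T * tau0 T - real (k0 T)))"
    proof -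
      have "r T \<omega> = a T * (real T * tau_tilde T \<omega> - real T * tau0 T)"
        by (simp add: r_def a_def \<sigma>2_def algebra_simps diff_divide_distrib)
      moreover have "signed b (a T * real m) = a T * (real k - real (k0 T))" unfolding m(2) by simp
      ultimately show ?thesis by (simp add: algebra_simps)
    qed
    also have "\<bar>\<dots>\<bar> \<le> a T * 2"
    proof -
      have "\<bar>(real T * tau_tilde T \<omega> - real k) - (real T * tau0 T - real (k0 T))\<bar> \<le> 2"
        using k(2) k0T(4)[OF T2] by linarith
      then show ?thesis using a0[OF T2] unfolding abs_mult by (intro mult_mono) auto
    qed
    finally have "\<bar>r T \<omega> - signed b (a T * real m)\<bar> \<le> 2 * a T" by simp
    then show ?thesis using m(1) nm by blast
  qed
  have "two_sided_walks N B (\<lambda>n. M (n + T0)) (\<lambda>n. Y (n + T0)) (\<lambda>n. side_length (n + T0) (k0 (n + T0)))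
    (\<lambda>n. a (n + T0)) (\<lambda>n. q (n + T0) / (xi (n + T0))\<^sup>2 / \<sigma>2) (\<lambda>n. 2 * a (n + T0)) (\<lambda>n. \<rho> (n + T0)) (sqrt cB / sqrt \<sigma>2)
    (\<lambda>n. r (n + T0)) (\<lambda>n. CE (n + T0) \<inter> NE (n + T0)) X"
  proof (intro two_sided_walks.intro bm two_sided_walks_axioms.intro)
    show "prob_space (M (n + T0))" for n by (rule prob[OF T2])
    show "sqrt cB / sqrt \<sigma>2 > 0" using constants(2) \<sigma>2 by simp
    show "a (n + T0) > 0" for n by (rule a0[OF T2])
    show "(\<lambda>n. a (n + T0)) \<longlonglongrightarrow> 0" by (rule LIMSEQ_ignore_initial_segment[OF a_lim])
    have "(\<lambda>T. q T / (xi T)\<^sup>2 / \<sigma>2) \<longlonglongrightarrow> \<sigma>2 / \<sigma>2"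
      unfolding q_def \<sigma>2_def using \<sigma>2 by (intro tendsto_divide variance tendsto_const) (simp add: \<sigma>2_def)
    then show "(\<lambda>n. q (n + T0) / (xi (n + T0))\<^sup>2 / \<sigma>2) \<longlonglongrightarrow> 1"
      using \<sigma>2 LIMSEQ_ignore_initial_segment[of "\<lambda>T. q T / (xi T)\<^sup>2 / \<sigma>2" 1 T0] by simp
    show "filterlim (\<lambda>n. a (n + T0) * real (side_length (n + T0) (k0 (n + T0)) b)) at_top sequentially" for b
      using filterlim_compose[OF aL[of b] filterlim_add_const_nat_at_top[of T0]] by simp
    show "r (n + T0) \<in> borel_measurable (M (n + T0))" for n
      unfolding r_def using tau_meas[OF T2, of n] by measurable
    show "CE (n + T0) \<inter> NE (n + T0) \<in> sets (M (n + T0))" for n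
      using CE(1)[of "n + T0"] NE(1)[OF T2, of n] by auto
    show "(\<lambda>n. measure (M (n + T0)) (CE (n + T0) \<inter> NE (n + T0))) \<longlonglongrightarrow> 1"
    proof (rule tendsto_sandwich[of "\<lambda>n. 1 - Delta (n + T0) - 2 / real (n + T0)" _ _ "\<lambda>_. 1"])
      show "\<forall>\<^sub>F n in sequentially. 1 - Delta (n + T0) - 2 / real (n + T0) \<le> measure (M (n + T0)) (CE (n + T0) \<inter> NE (n + T0))"
      proof (intro always_eventually allI)
        fix n
        interpret prob_space "M (n + T0)" by (rule prob[OF T2])
        have C: "CE (n + T0) \<in> events" "prob (CE (n + T0)) \<ge> 1 - Delta (n + T0)" using CE[of "n + T0"] by auto
        have Ne: "NE (n + T0) \<in> events" "prob (NE (n + T0)) \<ge> 1 - 2 / real (n + T0)" using NE[OF T2, of n] by auto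
        have "prob (CE (n + T0)) = prob (CE (n + T0) \<inter> NE (n + T0)) + prob (CE (n + T0) - NE (n + T0))"
          using finite_measure_Union[of "CE (n + T0) \<inter> NE (n + T0)" "CE (n + T0) - NE (n + T0)"] C Ne by (simp add: Int_Diff_Un Int_Diff_disjoint)
        moreover have "prob (CE (n + T0) - NE (n + T0)) \<le> prob (space (M (n + T0)) - NE (n + T0))"
          by (rule finite_measure_mono) (use C Ne sets.sets_into_space in auto)
        moreover have "prob (space (M (n + T0)) - NE (n + T0)) = 1 - prob (NE (n + T0))" by (rule prob_compl[OF Ne(1)])
        ultimately show "1 - Delta (n + T0) - 2 / real (n + T0) \<le> prob (CE (n + T0) \<inter> NE (n + T0))" using C(2) Ne(2) by linarith
      qed
      show "\<forall>\<^sub>F n in sequentially. measure (M (n + T0)) (CE (n + T0) \<inter> NE (n + T0)) \<le> 1"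
        by (intro always_eventually allI prob_space.prob_le_1 prob T2)
      have "(\<lambda>T. 1 - Delta T - 2 * (1 / real T)) \<longlonglongrightarrow> 1 - 0 - 2 * 0" by (intro tendsto_intros C_Delta lim_1_over_n)
      from LIMSEQ_ignore_initial_segment[OF this, of T0]
      show "(\<lambda>n. 1 - Delta (n + T0) - 2 / real (n + T0)) \<longlonglongrightarrow> 1" by simp
    qed simp
    have "(\<lambda>T. 2 * a T) \<longlonglongrightarrow> 2 * 0" by (intro tendsto_intros a_lim)
    from LIMSEQ_ignore_initial_segment[OF this, of T0] show "(\<lambda>n. 2 * a (n + T0)) \<longlonglongrightarrow> 0" by simp
    show "\<rho> (n + T0) \<ge> 0" for n by (rule \<rho>0[OF T2])
    show "(\<lambda>n. \<rho> (n + T0)) \<longlonglongrightarrow> 0" by (rule LIMSEQ_ignore_initial_segment[OF \<rho>_lim])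
    show "X \<in> borel_measurable N" using X by (simp add: argmin_rv_def)
  qed (assumption | rule XAE row[OF T2] near[OF le_add2])+
  from two_sided_walks.weak_conv[OF this]
  have conv: "weak_conv_m (\<lambda>n. distr (M (n + T0)) borel (r (n + T0))) (distr N borel X)" .
  have "weak_conv_m (\<lambda>T. distr (M T) borel (r T)) (distr N borel X)"
    unfolding weak_conv_m_def weak_conv_def
  proof (intro allI impI)
    fix x assume "isCont (cdf (distr N borel X)) x"
    then have "(\<lambda>n. cdf (distr (M (n + T0)) borel (r (n + T0))) x) \<longlonglongrightarrow> cdf (distr N borel X) x"
      using conv unfolding weak_conv_m_def weak_conv_def by blast
    then show "(\<lambda>T. cdf (distr (M T) borel (r T)) x) \<longlonglongrightarrow> cdf (distr N borel X) x"
      by (rule LIMSEQ_offset)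
  qed
  then show ?thesis using X unfolding r_def[abs_def] by blast
qed

end
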